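(* Let $H\in(0,1)$ and let $\Theta$ be a set of (integrable, real-valued, pointwise defined) functions on $[0,1]$. Let $K(s,t)=\frac12(|t|^{2H}+|s|^{2H}-|t-s|^{2H})$, $s,t\in[0,1]$, let $(\mathbb{H},\|\cdot\|_{\mathbb{H}})$ be the reproducing kernel Hilbert space with reproducing kernel $K$, and for $f\in\Theta$ let $F_f(t)=\int_0^t f(u)\,du$, $t\in[0,1]$. Suppose that, as $n\to\infty$, (i) $(n^{1-2H}\vee 1)\,\sup_{f\in\Theta}\sum_{i=1}^n\Big(n\int_{(i-1)/n}^{i/n}f(u)\,du-f\big(\tfrac in\big)\Big)^2\rightarrow 0$, (ii) $n^{1-H}\,\sup_{f\in\Theta}\ \inf_{(\alpha_1,\ldots,\alpha_n)^t\in\mathbb{R}^n}\Big\|F_f-\sum_{j=1}^n\alpha_jK\big(\cdot,\tfrac jn\big)\Big\|_{\mathbb{H}}\rightarrow 0$. Then the sequences of experiments $\mathcal{E}_{1,n}(\Theta)$ and $\mathcal{E}_{2,n}(\Theta)$ are asymptotically equivalent, $\mathcal{E}_{1,n}(\Theta)\simeq\mathcal{E}_{2,n}(\Theta)$.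
   Context: Fractional Brownian motion (fBM) with Hurst index $H\in(0,1)$: the centered Gaussian process $(B^H_t)_{t\ge0}$ with continuous paths and covariance $\frac12(|t|^{2H}+|s|^{2H}-|t-s|^{2H})$. Fractional Gaussian noise (fGN): the centered stationary Gaussian sequence $(N_i^H)_{i\in\mathbb{N}}$ with autocovariance $\gamma(k)=\frac12(|k+1|^{2H}-2|k|^{2H}+|k-1|^{2H})$. $\mathcal{E}_{1,n}(\Theta)=(\mathbb{R}^n,\mathcal{B}(\mathbb{R}^n),(P_f^n:f\in\Theta))$, where $P_f^n$ is the distribution of $(Y_{1,n},\ldots,Y_{n,n})$ with $Y_{i,n}=f(i/n)+N_i^H$, $i=1,\ldots,n$. $\mathcal{E}_{2,n}(\Theta)=(\mathcal{C}[0,1],\mathcal{B}(\mathcal{C}[0,1]),(Q_f^n:f\in\Theta))$, where $Q_f^n$ is the distribution of $Y_t=\int_0^tf(u)\,du+n^{H-1}B_t^H$, $t\in[0,1]$. Condition (ii) includes the requirement $F_f\in\mathbb{H}$ for all $f\in\Theta$ (the norm is $+\infty$ off $\mathbb{H}$). For two experiments with the same parameter set $\Theta$ on Polish spaces, the deficiency of $(P_f)_f$ with respect to $(Q_f)_f$ is the infimum over Markov kernels $M$ of $\sup_{f\in\Theta}\|MP_f-Q_f\|_{TV}$, and the Le Cam distance $\Delta$ is the maximum of the two deficiencies. Asymptotic equivalence $\simeq$ of two sequences of experiments means that $\Delta\to0$ as $n\to\infty$. *)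

theory Defs
  imports "HOL-Probability.Probability"
begin

section \<open>Gaussian processes, fractional Brownian motion and fractional Gaussian noise\<close>

text \<open>Constant random variables count as Gaussian, with standard deviation 0. They occur here:
  the value of fractional Brownian motion at time 0 is one.\<close>

definition normal_law :: "real \<Rightarrow> real \<Rightarrow> real measure" where
  "normal_law \<mu> \<sigma> = (if \<sigma> = 0 then return borel \<mu> else density lborel (normal_density \<mu> \<sigma>))"

definition gaussian_process :: "'w measure \<Rightarrow> 't set \<Rightarrow> ('t \<Rightarrow> 'w \<Rightarrow> real) \<Rightarrow> bool" where
  "gaussian_process M T X \<longleftrightarrow>
     prob_space M \<and>
     (\<forall>t\<in>T. X t \<in> borel_measurable M) \<and>
     (\<forall>F a. finite F \<longrightarrow> F \<subseteq> T \<longrightarrow>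
        (\<exists>\<mu> \<sigma>. 0 \<le> \<sigma> \<and> distr M borel (\<lambda>\<omega>. \<Sum>t\<in>F. a t * X t \<omega>) = normal_law \<mu> \<sigma>))"

definition centered_gaussian_process ::
  "'w measure \<Rightarrow> 't set \<Rightarrow> ('t \<Rightarrow> 't \<Rightarrow> real) \<Rightarrow> ('t \<Rightarrow> 'w \<Rightarrow> real) \<Rightarrow> bool" where
  "centered_gaussian_process M T c X \<longleftrightarrow>
     gaussian_process M T X \<and>
     (\<forall>t\<in>T. (\<integral>\<omega>. X t \<omega> \<partial>M) = 0) \<and>
     (\<forall>s\<in>T. \<forall>t\<in>T. (\<integral>\<omega>. X s \<omega> * X t \<omega> \<partial>M) = c s t)"

definition fbm_cov :: "real \<Rightarrow> real \<Rightarrow> real \<Rightarrow> real" where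
  "fbm_cov H s t = 1/2 * (\<bar>t\<bar> powr (2*H) + \<bar>s\<bar> powr (2*H) - \<bar>t - s\<bar> powr (2*H))"

definition fractional_brownian_motion ::
  "real \<Rightarrow> 'w measure \<Rightarrow> (real \<Rightarrow> 'w \<Rightarrow> real) \<Rightarrow> bool" where
  "fractional_brownian_motion H M B \<longleftrightarrow>
     centered_gaussian_process M {0..} (fbm_cov H) B \<and>
     (\<forall>\<omega>\<in>space M. continuous_on {0..} (\<lambda>t. B t \<omega>))"

definition fgn_autocov :: "real \<Rightarrow> int \<Rightarrow> real" where
  "fgn_autocov H k =
     1/2 * (\<bar>of_int k + 1\<bar> powr (2*H) - 2 * \<bar>of_int k\<bar> powr (2*H) + \<bar>of_int k - 1\<bar> powr (2*H))"

text \<open>Stationarity is contained in the covariance depending on the time lag only. The sequence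
  starts at index 1.\<close>

definition fractional_gaussian_noise ::
  "real \<Rightarrow> 'w measure \<Rightarrow> (nat \<Rightarrow> 'w \<Rightarrow> real) \<Rightarrow> bool" where
  "fractional_gaussian_noise H M N \<longleftrightarrow>
     centered_gaussian_process M {1..} (\<lambda>i j. fgn_autocov H (int j - int i)) N"


section \<open>Reproducing kernel Hilbert spaces\<close>

text \<open>A Hilbert space of functions on \<open>T\<close> is given by its carrier \<open>V\<close> and its inner product \<open>ip\<close>.
  Functions on \<open>T\<close> are represented by extensional functions, so the pointwise operations
  have to be restricted to \<open>T\<close>.\<close>

definition hilbert_norm :: "(('t \<Rightarrow> real) \<Rightarrow> ('t \<Rightarrow> real) \<Rightarrow> real) \<Rightarrow> ('t \<Rightarrow> real) \<Rightarrow> real" where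
  "hilbert_norm ip f = sqrt (ip f f)"

text \<open>The metric is set to 0 off the carrier because \<^locale>\<open>Metric_space\<close> asks for nonnegativity
  and symmetry on the whole type.\<close>

definition hilbert_dist ::
  "'t set \<Rightarrow> ('t \<Rightarrow> real) set \<Rightarrow> (('t \<Rightarrow> real) \<Rightarrow> ('t \<Rightarrow> real) \<Rightarrow> real) \<Rightarrow>
   ('t \<Rightarrow> real) \<Rightarrow> ('t \<Rightarrow> real) \<Rightarrow> real" where
  "hilbert_dist T V ip f g =
     (if f \<in> V \<and> g \<in> V then hilbert_norm ip (\<lambda>t\<in>T. f t - g t) else 0)"

definition function_hilbert_space ::
  "'t set \<Rightarrow> ('t \<Rightarrow> real) set \<Rightarrow> (('t \<Rightarrow> real) \<Rightarrow> ('t \<Rightarrow> real) \<Rightarrow> real) \<Rightarrow> bool" where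
  "function_hilbert_space T V ip \<longleftrightarrow>
     V \<subseteq> extensional T \<and>
     (\<lambda>t\<in>T. 0) \<in> V \<and>
     (\<forall>f\<in>V. \<forall>g\<in>V. (\<lambda>t\<in>T. f t + g t) \<in> V) \<and>
     (\<forall>c. \<forall>f\<in>V. (\<lambda>t\<in>T. c * f t) \<in> V) \<and>
     (\<forall>f\<in>V. \<forall>g\<in>V. ip f g = ip g f) \<and>
     (\<forall>f\<in>V. \<forall>g\<in>V. \<forall>h\<in>V. ip (\<lambda>t\<in>T. f t + g t) h = ip f h + ip g h) \<and>
     (\<forall>c. \<forall>f\<in>V. \<forall>g\<in>V. ip (\<lambda>t\<in>T. c * f t) g = c * ip f g) \<and>
     (\<forall>f\<in>V. 0 \<le> ip f f) \<and>
     (\<forall>f\<in>V. ip f f = 0 \<longrightarrow> f = (\<lambda>t\<in>T. 0)) \<and>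
     Metric_space.mcomplete V (hilbert_dist T V ip)"

definition is_rkhs ::
  "'t set \<Rightarrow> ('t \<Rightarrow> 't \<Rightarrow> real) \<Rightarrow>
   ('t \<Rightarrow> real) set \<Rightarrow> (('t \<Rightarrow> real) \<Rightarrow> ('t \<Rightarrow> real) \<Rightarrow> real) \<Rightarrow> bool" where
  "is_rkhs T K V ip \<longleftrightarrow>
     function_hilbert_space T V ip \<and>
     (\<forall>t\<in>T. (\<lambda>s\<in>T. K s t) \<in> V) \<and>
     (\<forall>f\<in>V. \<forall>t\<in>T. ip f (\<lambda>s\<in>T. K s t) = f t)"

definition hilbert_enorm ::
  "('t \<Rightarrow> real) set \<Rightarrow> (('t \<Rightarrow> real) \<Rightarrow> ('t \<Rightarrow> real) \<Rightarrow> real) \<Rightarrow> ('t \<Rightarrow> real) \<Rightarrow> ennreal" where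
  "hilbert_enorm V ip f = (if f \<in> V then ennreal (hilbert_norm ip f) else \<infinity>)"


section \<open>Statistical experiments and the Le Cam distance\<close>

text \<open>Only the \<open>\<sigma>\<close>-algebra of \<open>sample_space\<close> matters; its measure is arbitrary.\<close>

record ('p, 'x) statistical_experiment =
  sample_space :: "'x measure"
  params :: "'p set"
  law :: "'p \<Rightarrow> 'x measure"

definition tv_dist :: "'x measure \<Rightarrow> 'x measure \<Rightarrow> ennreal" where
  "tv_dist P Q = (SUP A\<in>sets P. ennreal \<bar>measure P A - measure Q A\<bar>)"

text \<open>Meaningful only for experiments with the same parameter set. Suprema and infima are taken in
  \<^typ>\<open>ennreal\<close>, so that the supremum over an empty parameter set is 0.\<close>

definition deficiency :: "('p, 'x) statistical_experiment \<Rightarrow> ('p, 'y) statistical_experiment \<Rightarrow> ennreal" where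
  "deficiency E G =
     (INF M \<in> sample_space E \<rightarrow>\<^sub>M prob_algebra (sample_space G).
        SUP \<theta>\<in>params E. tv_dist (law E \<theta> \<bind> M) (law G \<theta>))"

definition le_cam_dist :: "('p, 'x) statistical_experiment \<Rightarrow> ('p, 'y) statistical_experiment \<Rightarrow> ennreal" where
  "le_cam_dist E G = max (deficiency E G) (deficiency G E)"

definition asymptotically_equivalent ::
  "(nat \<Rightarrow> ('p, 'x) statistical_experiment) \<Rightarrow> (nat \<Rightarrow> ('p, 'y) statistical_experiment) \<Rightarrow> bool" where
  "asymptotically_equivalent E G \<longleftrightarrow>
     (\<forall>n. params (E n) = params (G n)) \<and> (\<lambda>n. le_cam_dist (E n) (G n)) \<longlonglongrightarrow> 0"


section \<open>Regression under fractional noise and its continuous counterpart\<close>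

text \<open>\<open>\<real>\<^sup>n\<close> is the space of extensional functions on \<open>{1..n}\<close>.\<close>

abbreviation borel_Rn :: "nat \<Rightarrow> (nat \<Rightarrow> real) measure" where
  "borel_Rn n \<equiv> PiM {1..n} (\<lambda>_. borel)"

definition C01 :: "(real \<Rightarrow> real) metric" where
  "C01 = cfunspace (top_of_set {0..1}) euclidean_metric"

definition borel_C01 :: "(real \<Rightarrow> real) measure" where
  "borel_C01 = sigma (mspace C01) {U. openin (mtopology_of C01) U}"

lemma mspace_C01: "mspace C01 = {f \<in> extensional {0..1}. continuous_on {0..1} f}"
proof -
  have "bounded (f ` {0..1})" if "continuous_on {0..1} f" for f :: "real \<Rightarrow> real"
    using compact_continuous_image[OF that compact_Icc] by (rule compact_imp_bounded)
  then show ?thesis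
    by (auto simp: C01_def)
qed

lemma space_borel_C01: "space borel_C01 = {f \<in> extensional {0..1}. continuous_on {0..1} f}"
  by (simp add: borel_C01_def space_measure_of_conv mspace_C01)

definition primitive :: "(real \<Rightarrow> real) \<Rightarrow> real \<Rightarrow> real" where
  "primitive f = (\<lambda>t\<in>{0..1}. integral {0..t} f)"

text \<open>The distributions depend on the noise only through its law, so any realisation on any
  probability space may be used.\<close>

definition regression_experiment ::
  "'w measure \<Rightarrow> (nat \<Rightarrow> 'w \<Rightarrow> real) \<Rightarrow> (real \<Rightarrow> real) set \<Rightarrow> nat \<Rightarrow>
   (real \<Rightarrow> real, nat \<Rightarrow> real) statistical_experiment" where
  "regression_experiment M N \<Theta> n =
     \<lparr>sample_space = borel_Rn n, params = \<Theta>,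
      law = (\<lambda>f. distr M (borel_Rn n) (\<lambda>\<omega>. \<lambda>i\<in>{1..n}. f (real i / real n) + N i \<omega>))\<rparr>"

definition continuous_experiment ::
  "real \<Rightarrow> 'w measure \<Rightarrow> (real \<Rightarrow> 'w \<Rightarrow> real) \<Rightarrow> (real \<Rightarrow> real) set \<Rightarrow> nat \<Rightarrow>
   (real \<Rightarrow> real, real \<Rightarrow> real) statistical_experiment" where
  "continuous_experiment H M B \<Theta> n =
     \<lparr>sample_space = borel_C01, params = \<Theta>,
      law = (\<lambda>f. distr M borel_C01
                   (\<lambda>\<omega>. \<lambda>t\<in>{0..1}. primitive f t + real n powr (H - 1) * B t \<omega>))\<rparr>"

end

theory Submission
  imports Defs
begin

text \<open>The two experiments are compared through the model with observations
  \<open>n (F_f(i/n) - F_f((i-1)/n)) + N_i\<close>, where \<open>F_f\<close> is the primitive of \<open>f\<close>. By self-similarity these are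
  increments of the continuous path on the grid; they differ from the regression by a shift that is
  controlled by (i) and the smallest eigenvalue of the noise covariance, which the spectral representation
  bounds below by a constant times \<open>min (n^(2H-1)) 1\<close>. Conversely, predicting the path linearly from its grid
  values and adding an independent copy of the prediction error recovers fractional Brownian motion
  exactly, with \<open>F_f\<close> replaced by its projection to the span of the \<open>K(\<cdot>, j/n)\<close>; the remaining shift is the
  RKHS distance in (ii).

  A shift by \<open>h\<close> costs at most the RKHS norm of \<open>h\<close> in total variation: on finitely many coordinates
  only one standard normal variable is shifted, independent of the rest, and events of finitely many
  coordinates approximate all events.\<close>

section \<open>Linear systems with a positive semidefinite matrix\<close>

text \<open>Up to a constant, the factor \<open>max (n^(1-2H)) 1\<close> in (i) is the reciprocal of
  the eigenvalue bound: near frequency 0 the spectral density of the noise behaves like x^(1-2H),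
  which tends to 0 for H < 1/2, and n observations resolve frequencies down to order 1/n. The factor
  n^(1-H) in (ii) is the reciprocal of the noise level n^(H-1). The delicate direction is from data
  to paths. Gaussian laws on a path space whose covariances differ slightly may be mutually
  singular, so the covariance of the produced path has to be exactly right. This reduces to an
  identity between covariances, because uncorrelated Gaussian vectors are independent; hence
  Gaussian processes are handled through characteristic functions. The drift obtained is the
  interpolant of F_f on the grid. Interpolation is orthogonal projection in the RKHS, so it is at
  least as good as every competitor in (ii). Shifts are bounded without densities on path space: on
  finitely many coordinates the cost is the norm of an interpolant of the shift, which the norm of
  the shift itself dominates.\<close>

lemma psd_null_orthogonal:
  fixes a b c :: real
  assumes "\<And>s. 0 \<le> a + 2 * s * b + s\<^sup>2 * c" "a = 0"
  shows "b = 0"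
proof (rule ccontr)
  assume b: "b \<noteq> 0"
  \<comment> \<open>The minimiser would be -b/c; with \<open>\<bar>c\<bar> + 1\<close> in place of c
    the denominator is positive, and the value at s is still at most -b^2 / (|c| + 1).\<close>
  define s where "s = - b / (\<bar>c\<bar> + 1)"
  have c1: "\<bar>c\<bar> + 1 > 0" by simp
  have "0 \<le> 2 * s * b + s\<^sup>2 * c" using assms(1)[of s] assms(2) by simp
  also have "s\<^sup>2 * c \<le> s\<^sup>2 * (\<bar>c\<bar> + 1)" by (intro mult_left_mono) auto
  also have "2 * s * b + s\<^sup>2 * (\<bar>c\<bar> + 1) = - (b\<^sup>2 / (\<bar>c\<bar> + 1))"
    using c1 unfolding s_def power2_eq_square by (simp add: divide_simps)
  also have "\<dots> < 0" using b c1 by simp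
  finally show False by simp
qed

lemma psd_linear_solve:
  fixes G :: "'i \<Rightarrow> 'i \<Rightarrow> real"
  assumes "finite I"
    and sym: "\<And>i j. G i j = G j i"
    and psd: "\<And>x. 0 \<le> (\<Sum>i\<in>I. \<Sum>j\<in>I. x i * x j * G i j)"
    and c: "\<And>x. (\<Sum>i\<in>I. \<Sum>j\<in>I. x i * x j * G i j) = 0 \<Longrightarrow> (\<Sum>i\<in>I. x i * c i) = 0"
  shows "\<exists>\<alpha>. \<forall>i\<in>I. (\<Sum>j\<in>I. \<alpha> j * G i j) = c i"
  using assms(1) psd c
proof (induction I arbitrary: c)
  case empty
  then show ?case by simp
next
  case (insert k I)
  define Q where "Q x = (\<Sum>i\<in>I. \<Sum>j\<in>I. x i * x j * G i j)" for x
  have Qins: "(\<Sum>i\<in>insert k I. \<Sum>j\<in>insert k I. x i * x j * G i j)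
      = Q x + 2 * x k * (\<Sum>i\<in>I. x i * G i k) + (x k)\<^sup>2 * G k k" for x
  proof -
    have "(\<Sum>i\<in>I. x i * x k * G i k) = x k * (\<Sum>i\<in>I. x i * G i k)"
      "(\<Sum>i\<in>I. x k * x i * G k i) = x k * (\<Sum>i\<in>I. x i * G i k)"
      by (simp_all add: sum_distrib_left sym[of k] mult_ac)
    then show ?thesis using insert.hyps
      by (simp add: Q_def sum.distrib power2_eq_square algebra_simps)
  qed
  have upd: "Q (x(k := s)) = Q x" "(\<Sum>i\<in>I. (x(k := s)) i * d i) = (\<Sum>i\<in>I. x i * d i)" for x s d
    using insert.hyps unfolding Q_def by (auto intro!: sum.cong)
  have Qpos: "0 \<le> Q x + 2 * s * (\<Sum>i\<in>I. x i * G i k) + s\<^sup>2 * G k k" for x s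
    using insert.prems(1)[of "x(k := s)"] unfolding Qins upd by simp
  have psdI: "0 \<le> Q x" for x using Qpos[of x 0] by simp
  \<comment> \<open>The column of k is an admissible right-hand side: on a null vector of the
    smaller matrix plus s times the unit vector of k the form stays nonnegative for every s, so the
    mixed term is 0.\<close>
  have "\<exists>\<beta>. \<forall>i\<in>I. (\<Sum>j\<in>I. \<beta> j * G i j) = G i k"
  proof (rule insert.IH)
    show "0 \<le> (\<Sum>i\<in>I. \<Sum>j\<in>I. x i * x j * G i j)" for x using psdI[of x] by (simp add: Q_def)
    show "(\<Sum>i\<in>I. x i * G i k) = 0" if "(\<Sum>i\<in>I. \<Sum>j\<in>I. x i * x j * G i j) = 0" for x
      by (rule psd_null_orthogonal[of "Q x" _ "G k k"]) (use Qpos[of x] that in \<open>auto simp: Q_def\<close>)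
  qed
  then obtain \<beta> where \<beta>: "\<And>i. i \<in> I \<Longrightarrow> (\<Sum>j\<in>I. \<beta> j * G i j) = G i k" by blast
  have "\<exists>\<gamma>. \<forall>i\<in>I. (\<Sum>j\<in>I. \<gamma> j * G i j) = c i"
  proof (rule insert.IH)
    show "0 \<le> (\<Sum>i\<in>I. \<Sum>j\<in>I. x i * x j * G i j)" for x using psdI[of x] by (simp add: Q_def)
    show "(\<Sum>i\<in>I. x i * c i) = 0" if "(\<Sum>i\<in>I. \<Sum>j\<in>I. x i * x j * G i j) = 0" for x
      using insert.prems(2)[of "x(k := 0)"] insert.hyps that unfolding Qins upd
      by (simp add: Q_def upd[unfolded fun_upd_apply])
  qed
  then obtain \<gamma> where \<gamma>: "\<And>i. i \<in> I \<Longrightarrow> (\<Sum>j\<in>I. \<gamma> j * G i j) = c i" by blast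
  \<comment> \<open>The Schur complement; \<open>Dq\<close> below identifies it with the value of
    the form at the vector (-\<beta>, 1).\<close>
  define D where "D = G k k - (\<Sum>i\<in>I. \<beta> i * G k i)"
  have Qb: "Q \<beta> = (\<Sum>i\<in>I. \<beta> i * G k i)"
  proof -
    have "Q \<beta> = (\<Sum>i\<in>I. \<beta> i * (\<Sum>j\<in>I. \<beta> j * G i j))"
      by (simp add: Q_def sum_distrib_left mult_ac)
    also have "\<dots> = (\<Sum>i\<in>I. \<beta> i * G k i)" by (intro sum.cong) (simp_all add: \<beta> sym[of k])
    finally show ?thesis .
  qed
  have Qm: "Q (\<lambda>i. - \<beta> i) = Q \<beta>" by (simp add: Q_def)
  have Dq: "Q (\<lambda>i. - \<beta> i) + 2 * 1 * (\<Sum>i\<in>I. - \<beta> i * G i k) + 1\<^sup>2 * G k k = D"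
  proof -
    have "(\<Sum>i\<in>I. \<beta> i * G k i) = (\<Sum>i\<in>I. \<beta> i * G i k)"
      by (intro sum.cong refl) (metis sym)
    then show ?thesis unfolding Qm Qb D_def by (simp add: sum_negf)
  qed
  have sols: "(\<Sum>i\<in>I. \<gamma> i * G k i) = (\<Sum>i\<in>I. \<beta> i * c i)"
  proof -
    have "(\<Sum>i\<in>I. \<gamma> i * G k i) = (\<Sum>i\<in>I. \<Sum>j\<in>I. \<gamma> i * (\<beta> j * G i j))"
      by (intro sum.cong) (simp_all add: \<beta> sym[of k] sum_distrib_left[symmetric])
    also have "\<dots> = (\<Sum>j\<in>I. \<Sum>i\<in>I. \<gamma> i * (\<beta> j * G i j))" by (rule sum.swap)
    also have "\<dots> = (\<Sum>j\<in>I. \<beta> j * (\<Sum>i\<in>I. \<gamma> i * G j i))"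
      unfolding sum_distrib_left by (intro sum.cong) (simp_all add: sym mult_ac)
    also have "\<dots> = (\<Sum>i\<in>I. \<beta> i * c i)" by (intro sum.cong) (simp_all add: \<gamma>)
    finally show ?thesis .
  qed
  \<comment> \<open>Eliminating the indices in I leaves one scalar equation for the new coordinate
    u, with coefficient D. If D = 0, its right-hand side is 0 too and the value 0 is chosen.\<close>
  define u where "u = (if D = 0 then 0 else (c k - (\<Sum>i\<in>I. \<beta> i * c i)) / D)"
  have uD: "u * D = c k - (\<Sum>i\<in>I. \<beta> i * c i)"
  proof (cases "D = 0")
    case True
    define x where "x = (\<lambda>i. - \<beta> i)(k := 1)"
    have "(\<Sum>i\<in>insert k I. \<Sum>j\<in>insert k I. x i * x j * G i j) = 0"
    proof -
      have "Q x = Q (\<lambda>i. - \<beta> i)" "(\<Sum>i\<in>I. x i * G i k) = (\<Sum>i\<in>I. - \<beta> i * G i k)" "x k = 1"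
        unfolding x_def by (simp_all only: upd fun_upd_same)
      then show ?thesis unfolding Qins using Dq True by simp
    qed
    then have "(\<Sum>i\<in>insert k I. x i * c i) = 0" by (rule insert.prems(2))
    moreover have "(\<Sum>i\<in>I. x i * c i) = (\<Sum>i\<in>I. - \<beta> i * c i)" unfolding x_def by (rule upd(2))
    ultimately show ?thesis using insert.hyps True by (simp add: x_def sum_negf)
  qed (simp add: u_def)
  define \<alpha> where "\<alpha> = (\<lambda>j. \<gamma> j - u * \<beta> j)(k := u)"
  have sa: "(\<Sum>j\<in>insert k I. \<alpha> j * G i j) = u * G i k + ((\<Sum>j\<in>I. \<gamma> j * G i j) - u * (\<Sum>j\<in>I. \<beta> j * G i j))" for i
  proof -
    have "(\<Sum>j\<in>I. \<alpha> j * G i j) = (\<Sum>j\<in>I. (\<gamma> j - u * \<beta> j) * G i j)"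
      unfolding \<alpha>_def by (rule upd(2))
    then show ?thesis using insert.hyps
      by (simp add: \<alpha>_def sum_subtractf sum_distrib_left algebra_simps)
  qed
  have "(\<Sum>j\<in>insert k I. \<alpha> j * G i j) = c i" if "i \<in> insert k I" for i
  proof (cases "i = k")
    case True
    have "(\<Sum>j\<in>insert k I. \<alpha> j * G k j) = u * D + (\<Sum>i\<in>I. \<beta> i * c i)"
      unfolding sa sols D_def by (simp add: algebra_simps)
    then show ?thesis using uD True by simp
  next
    case False
    then have "i \<in> I" using that by simp
    then show ?thesis unfolding sa by (simp add: \<beta> \<gamma>)
  qed
  then show ?case by blast
qed

section \<open>Spectral lower bound for fractional Gaussian noise\<close>

text \<open>Up to a constant, this is the Levy density of the symmetric 2H-stable law on the
  positive half-line, and also the spectral density of fractional Brownian motion.\<close>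

definition stable_weight :: "real \<Rightarrow> real \<Rightarrow> real" where
  "stable_weight H x = x powr (- 1 - 2 * H)"

lemma one_minus_cos_le: "1 - cos x \<le> x\<^sup>2 / 2" for x :: real
proof -
  have "1 - cos x = 2 * (sin (x/2))\<^sup>2"
    using cos_double_sin[of "x/2"] by simp
  also have "(sin (x/2))\<^sup>2 \<le> (x/2)\<^sup>2"
    using abs_sin_x_le_abs_x[of "x/2"] by (simp only: abs_le_square_iff)
  finally show ?thesis by (simp add: power2_eq_square)
qed

text \<open>Maclaurin expansion of order 4, where x^2 \<le> pi^2 < 10 absorbs the quartic term. This
  yields the constant 1/12, which is relaxed to 1/20.\<close>

lemma one_minus_cos_ge:
  assumes "0 \<le> x" "x \<le> pi"
  shows "x\<^sup>2 / 20 \<le> 1 - cos x"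
proof -
  obtain t where t: "cos x = (\<Sum>m<4. cos_coeff m * x ^ m) + (cos (t + 1/2 * real 4 * pi) / fact 4) * x ^ 4"
    using Maclaurin_cos_expansion[of x 4] by blast
  have "cos x = 1 - x\<^sup>2/2 + cos (t + 2 * pi) / 24 * x ^ 4"
    using t by (simp add: cos_coeff_def lessThan_nat_numeral fact_numeral)
  also have "cos (t + 2 * pi) / 24 * x ^ 4 \<le> 1/24 * x ^ 4"
    by (intro mult_right_mono) auto
  also have "1/24 * x ^ 4 \<le> 1/24 * (x\<^sup>2 * 10)"
  proof -
    have "x * x \<le> pi * pi" using assms by (intro mult_mono) auto
    also have "pi * pi \<le> 3.15 * 3.15" using pi_approx by (intro mult_mono) auto
    finally have "x\<^sup>2 * x\<^sup>2 \<le> x\<^sup>2 * 10" by (intro mult_left_mono) (auto simp: power2_eq_square)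
    then show ?thesis by (simp add: power2_eq_square eval_nat_numeral)
  qed
  finally have "cos x \<le> 1 - x\<^sup>2 / 12" by simp
  then show ?thesis using zero_le_power2[of x] by linarith
qed

lemma set_integral_mono_set:
  fixes f :: "'a \<Rightarrow> real"
  assumes f: "set_integrable M B f" and "A \<subseteq> B" "A \<in> sets M" and pos: "\<And>x. x \<in> B \<Longrightarrow> 0 \<le> f x"
  shows "(LINT x:A|M. f x) \<le> (LINT x:B|M. f x)"
  using set_integrable_subset[OF f assms(3,2)] f assms(2) pos
  unfolding set_lebesgue_integral_def set_integrable_def
  by (intro integral_mono) (auto simp: indicator_def)

context
  fixes H :: real
  assumes H: "0 < H" "H < 1"
begin

text \<open>Near 0 the integrand is at most a multiple of x^(1-2H), integrable because H < 1; at
  infinity it is at most 2 x^(-1-2H), integrable because H > 0.\<close>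

lemma integrable_one_minus_cos_weight:
  "set_integrable lborel {0<..} (\<lambda>x. (1 - cos (t * x)) * stable_weight H x)"
proof -
  have meas: "set_borel_measurable borel {0<..} (\<lambda>x. (1 - cos (t * x)) * stable_weight H x)"
    unfolding set_borel_measurable_def stable_weight_def by measurable
  have 1: "set_integrable lebesgue {0..1} (\<lambda>x. t\<^sup>2 / 2 * x powr (1 - 2 * H))"
    using H by (intro nonnegative_absolutely_integrable_1 integrable_on_mult_right integrable_on_powr_from_0) auto
  have 2: "set_integrable lebesgue {1..} (\<lambda>x. 2 * x powr (- 1 - 2 * H))"
    using H by (intro nonnegative_absolutely_integrable_1 integrable_on_mult_right
        has_integral_integrable[OF has_integral_powr_to_inf]) auto
  have i1: "set_integrable lborel {0..1} (\<lambda>x. t\<^sup>2 / 2 * x powr (1 - 2 * H))"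
    using 1 unfolding set_integrable_def by (subst (asm) integrable_completion) auto
  have i2: "set_integrable lborel {1..} (\<lambda>x. 2 * x powr (- 1 - 2 * H))"
    using 2 unfolding set_integrable_def by (subst (asm) integrable_completion) auto
  have 3: "set_integrable lborel {0<..1} (\<lambda>x. (1 - cos (t * x)) * stable_weight H x)"
  proof (rule set_integrable_bound)
    show "set_integrable lborel {0<..1} (\<lambda>x. t\<^sup>2 / 2 * x powr (1 - 2 * H))"
      using i1 by (rule set_integrable_subset) auto
    show "set_borel_measurable lborel {0<..1} (\<lambda>x. (1 - cos (t * x)) * stable_weight H x)"
      unfolding set_borel_measurable_def stable_weight_def by measurable
    show "AE x in lborel. x \<in> {0<..1} \<longrightarrow> norm ((1 - cos (t * x)) * stable_weight H x) \<le> norm (t\<^sup>2 / 2 * x powr (1 - 2 * H))"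
    proof (intro AE_I2 impI)
      fix x :: real assume x: "x \<in> {0<..1}"
      have "norm ((1 - cos (t * x)) * stable_weight H x) = (1 - cos (t * x)) * stable_weight H x"
        by (simp add: stable_weight_def)
      also have "\<dots> \<le> (t * x)\<^sup>2 / 2 * stable_weight H x"
        by (intro mult_right_mono one_minus_cos_le) (simp add: stable_weight_def)
      also have "\<dots> = t\<^sup>2 / 2 * (x powr 2 * x powr (- 1 - 2 * H))"
        using x by (simp add: stable_weight_def power_mult_distrib)
      also have "\<dots> = t\<^sup>2 / 2 * x powr (1 - 2 * H)"
        by (simp add: powr_add[symmetric])
      finally show "norm ((1 - cos (t * x)) * stable_weight H x) \<le> norm (t\<^sup>2 / 2 * x powr (1 - 2 * H))"
        by simp
    qed
  qed
  have 4: "set_integrable lborel {1..} (\<lambda>x. (1 - cos (t * x)) * stable_weight H x)"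
  proof (rule set_integrable_bound[OF i2])
    show "set_borel_measurable lborel {1..} (\<lambda>x. (1 - cos (t * x)) * stable_weight H x)"
      unfolding set_borel_measurable_def stable_weight_def by measurable
    show "AE x in lborel. x \<in> {1..} \<longrightarrow> norm ((1 - cos (t * x)) * stable_weight H x) \<le> norm (2 * x powr (- 1 - 2 * H))"
    proof (intro AE_I2 impI)
      fix x :: real
      have "1 - cos (t * x) \<le> 2" using cos_ge_minus_one[of "t * x"] by linarith
      then show "norm ((1 - cos (t * x)) * stable_weight H x) \<le> norm (2 * x powr (- 1 - 2 * H))"
        by (auto simp: stable_weight_def abs_mult intro!: mult_right_mono)
    qed
  qed
  have "{0<..} = {0<..1} \<union> {1::real..}" by auto
  then show ?thesis using set_integrable_Un[OF 3 4] by simp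
qed

definition stable_const :: real where
  "stable_const = (LINT x:{0<..}|lborel. (1 - cos x) * stable_weight H x)"

lemma stable_const_pos: "0 < stable_const"
proof -
  have int: "set_integrable lborel {0<..} (\<lambda>x. (1 - cos x) * stable_weight H x)"
    using integrable_one_minus_cos_weight[of 1] by simp
  have sub: "set_integrable lborel {1..2} (\<lambda>x. (1 - cos x) * stable_weight H x)"
    by (rule set_integrable_subset[OF int]) auto
  have "0 < 1/20 * (2::real) powr (-1-2*H)" by simp
  also have "1/20 * (2::real) powr (-1-2*H) = (LINT x:{1..2::real}|lborel. 1/20 * (2::real) powr (-1-2*H))"
    by (simp add: set_lebesgue_integral_def)
  also have "\<dots> \<le> (LINT x:{1..2}|lborel. (1 - cos x) * stable_weight H x)"
  proof (rule set_integral_mono[OF _ sub])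
    show "set_integrable lborel {1..2::real} (\<lambda>x. 1/20 * (2::real) powr (-1-2*H))"
      by (intro borel_integrable_atLeastAtMost' continuous_on_const)
    fix x :: real assume x: "x \<in> {1..2}"
    have "1/20 \<le> x\<^sup>2/20" using x by (simp add: one_le_power)
    also have "\<dots> \<le> 1 - cos x" using x pi_gt3 by (intro one_minus_cos_ge) auto
    finally have a: "1/20 \<le> 1 - cos x" .
    have "2 powr (-1-2*H) \<le> x powr (-1-2*H)" using x H by (intro powr_mono2') auto
    then show "1/20 * (2::real) powr (-1-2*H) \<le> (1 - cos x) * stable_weight H x"
      unfolding stable_weight_def using a by (intro mult_mono) auto
  qed
  also have "\<dots> \<le> stable_const"
    unfolding stable_const_def
    by (rule set_integral_mono_set[OF int]) (auto simp: stable_weight_def)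
  finally show ?thesis .
qed

text \<open>Scaling x by |t|: the weight is homogeneous of degree -1-2H and dx contributes degree 1,
  so the integral is homogeneous of degree 2H in t.\<close>

lemma powr_eq_stable_integral:
  "(LINT x:{0<..}|lborel. (1 - cos (t * x)) * stable_weight H x) = stable_const * \<bar>t\<bar> powr (2 * H)"
proof (cases "t = 0")
  case True
  then show ?thesis by (simp add: set_lebesgue_integral_def)
next
  case False
  define g where "g x = indicator {0<..} x * ((1 - cos x) * stable_weight H x)" for x :: real
  have t: "\<bar>t\<bar> > 0" using False by simp
  have "stable_const = (\<integral>x. g x \<partial>lborel)"
    by (simp add: stable_const_def set_lebesgue_integral_def g_def)
  also have "\<dots> = \<bar>t\<bar> * (\<integral>x. g (0 + \<bar>t\<bar> * x) \<partial>lborel)"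
    using t lborel_integral_real_affine[of "\<bar>t\<bar>" g 0] by simp
  also have "(\<integral>x. g (0 + \<bar>t\<bar> * x) \<partial>lborel) =
      (\<integral>x. \<bar>t\<bar> powr (-1-2*H) * (indicator {0<..} x * ((1 - cos (t * x)) * stable_weight H x)) \<partial>lborel)"
  proof (rule Bochner_Integration.integral_cong[OF refl])
    fix x :: real
    show "g (0 + \<bar>t\<bar> * x) = \<bar>t\<bar> powr (-1-2*H) * (indicator {0<..} x * ((1 - cos (t * x)) * stable_weight H x))"
    proof (cases "x > 0")
      case True
      have "cos (\<bar>t\<bar> * x) = cos (t * x)" by (cases "t \<ge> 0") auto
      moreover have "0 < \<bar>t\<bar> * x" using True t by simp
      ultimately show ?thesis using True t
        by (simp add: g_def stable_weight_def powr_mult)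
    next
      case neg: False
      then have "\<not> 0 < \<bar>t\<bar> * x" using t by (simp add: zero_less_mult_iff)
      then show ?thesis using neg by (simp add: g_def)
    qed
  qed
  also have "\<dots> = \<bar>t\<bar> powr (-1-2*H) * (LINT x:{0<..}|lborel. (1 - cos (t * x)) * stable_weight H x)"
    by (simp add: set_lebesgue_integral_def)
  finally have "stable_const = (\<bar>t\<bar> powr 1 * \<bar>t\<bar> powr (-1-2*H)) * (LINT x:{0<..}|lborel. (1 - cos (t * x)) * stable_weight H x)"
    by simp
  also have "\<bar>t\<bar> powr 1 * \<bar>t\<bar> powr (-1-2*H) = \<bar>t\<bar> powr (- (2*H))"
    by (simp only: powr_add[symmetric]) simp
  finally show ?thesis using t by (simp add: powr_minus field_simps)
qed

text \<open>The autocovariance is half the second difference of |t|^(2H) at k. Under the integral,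
  half the second difference of 1 - cos(t x) is cos(k x) (1 - cos x). Frequencies range over the
  whole half-line instead of being folded into [0, pi], which is harmless for lower bounds.\<close>

lemma fgn_autocov_spectral:
  "set_integrable lborel {0<..} (\<lambda>x. cos (real_of_int k * x) * (1 - cos x) * stable_weight H x)"
  "(LINT x:{0<..}|lborel. cos (real_of_int k * x) * (1 - cos x) * stable_weight H x)
     = stable_const * fgn_autocov H k"
proof -
  define J where "J t x = (1 - cos (t * x)) * stable_weight H x" for t x :: real
  have J: "set_integrable lborel {0<..} (J t)" "(LINT x:{0<..}|lborel. J t x) = stable_const * \<bar>t\<bar> powr (2*H)" for t
    using integrable_one_minus_cos_weight[of t] powr_eq_stable_integral[of t] unfolding J_def by auto
  have eq: "cos (real_of_int k * x) * (1 - cos x) * stable_weight H x =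
      1/2 * (J (k + 1) x - 2 * J k x + J (k - 1) x)" for x
  proof -
    have "cos ((k + 1) * x) + cos ((k - 1) * x) = 2 * cos (k * x) * cos x"
      by (simp add: ring_distribs cos_add cos_diff)
    then have "cos (k * x) * (1 - cos x) = 1/2 * ((1 - cos ((k + 1) * x)) - 2 * (1 - cos (k * x)) + (1 - cos ((k - 1) * x)))"
      by (simp add: algebra_simps)
    from arg_cong[OF this, of "\<lambda>z. z * stable_weight H x"] show ?thesis
      unfolding J_def by (simp add: algebra_simps)
  qed
  show "set_integrable lborel {0<..} (\<lambda>x. cos (real_of_int k * x) * (1 - cos x) * stable_weight H x)"
    unfolding eq using J(1) by (intro set_integrable_mult_right set_integral_add set_integral_diff) auto
  show "(LINT x:{0<..}|lborel. cos (real_of_int k * x) * (1 - cos x) * stable_weight H x)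
     = stable_const * fgn_autocov H k"
    unfolding eq using J(1)
    by (simp add: set_integral_add set_integral_diff J(2) fgn_autocov_def algebra_simps del: mult_divide_mult_cancel_left_if)
qed

end

text \<open>The squared modulus of the trigonometric polynomial with coefficients b, split into real
  and imaginary part so that all integrals stay real.\<close>

lemma trig_sum_square:
  fixes b :: "nat \<Rightarrow> real"
  shows "(\<Sum>i\<in>I. b i * cos (real i * x))\<^sup>2 + (\<Sum>i\<in>I. b i * sin (real i * x))\<^sup>2
    = (\<Sum>i\<in>I. \<Sum>j\<in>I. b i * b j * cos (real_of_int (int j - int i) * x))"
  unfolding power2_eq_square sum_product sum.distrib[symmetric]
  by (intro sum.cong refl) (simp add: cos_diff left_diff_distrib algebra_simps)

text \<open>Cauchy-Schwarz for each part, and cos^2 + sin^2 = 1 summed over I. It caps the mass that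
  the polynomial can place on a short interval of frequencies near 0.\<close>

lemma trig_sum_square_le:
  fixes b :: "nat \<Rightarrow> real"
  assumes "finite I"
  shows "(\<Sum>i\<in>I. b i * cos (real i * x))\<^sup>2 + (\<Sum>i\<in>I. b i * sin (real i * x))\<^sup>2
    \<le> card I * (\<Sum>i\<in>I. (b i)\<^sup>2)"
proof -
  have "(\<Sum>i\<in>I. b i * cos (real i * x))\<^sup>2 + (\<Sum>i\<in>I. b i * sin (real i * x))\<^sup>2
    \<le> (\<Sum>i\<in>I. (b i)\<^sup>2) * (\<Sum>i\<in>I. (cos (real i * x))\<^sup>2) + (\<Sum>i\<in>I. (b i)\<^sup>2) * (\<Sum>i\<in>I. (sin (real i * x))\<^sup>2)"
    by (intro add_mono Cauchy_Schwarz_ineq_sum)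
  also have "\<dots> = (\<Sum>i\<in>I. (b i)\<^sup>2) * (\<Sum>i\<in>I. 1)"
    unfolding distrib_left[symmetric] sum.distrib[symmetric] by (simp del: sum_constant)
  finally show ?thesis by (simp add: mult.commute)
qed

lemma integral_cos_int:
  "((\<lambda>x. cos (real_of_int m * x)) has_integral (if m = 0 then pi else 0)) {0..pi}"
proof (cases "m = 0")
  case True
  then show ?thesis using has_integral_const_real[of "1::real" 0 pi] by simp
next
  case False
  have "((\<lambda>x. cos (real_of_int m * x)) has_integral (sin (real_of_int m * pi) / m - sin (real_of_int m * 0) / m)) {0..pi}"
    using False
    by (intro fundamental_theorem_of_calculus)
       (auto intro!: derivative_eq_intros simp: has_real_derivative_iff_has_vector_derivative[symmetric])
  then show ?thesis using False by (simp add: sin_zero_iff_int2 mult.commute)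
qed

text \<open>The reciprocal of a lower bound for the smallest eigenvalue of the covariance matrix of
  n noise variables. The 40 is 20 from \<open>one_minus_cos_ge\<close> times 2 for the half of the
  spectral mass that is discarded.\<close>

definition fgn_bound :: "real \<Rightarrow> nat \<Rightarrow> real" where
  "fgn_bound H n = 40 * stable_const H * max (real n powr (1 - 2 * H)) 1"

lemma fgn_bound_pos: "0 < H \<Longrightarrow> H < 1 \<Longrightarrow> 0 < fgn_bound H n"
  using stable_const_pos[of H] by (simp add: fgn_bound_def less_max_iff_disj)

text \<open>The form is an integral of the squared modulus D against a weight of order x^(1-2H).
  Over [0, pi] the integral of D alone is pi times the sum of squares, by orthogonality of the
  cosines. For H < 1/2 the weight degenerates at 0, but D is too small to concentrate there, so that
  half of its mass sits where the weight is bounded below.\<close>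

lemma fgn_quadratic_form_lower_bound:
  fixes b :: "nat \<Rightarrow> real"
  assumes n: "1 \<le> n" and H: "0 < H" "H < 1"
  shows "(\<Sum>i=1..n. (b i)\<^sup>2) \<le> fgn_bound H n * (\<Sum>i=1..n. \<Sum>j=1..n. b i * b j * fgn_autocov H (int j - int i))"
proof -
  define D where "D x = (\<Sum>i=1..n. b i * cos (real i * x))\<^sup>2 + (\<Sum>i=1..n. b i * sin (real i * x))\<^sup>2" for x
  define g where "g x = (1 - cos x) * stable_weight H x * D x" for x
  define B where "B = (\<Sum>i=1..n. (b i)\<^sup>2)"
  define \<mu> where "\<mu> = max (real n powr (1 - 2 * H)) 1"
  \<comment> \<open>Chosen so that d times the bound n * B for D is half of the total mass pi *
    B.\<close>
  define d where "d = pi / (2 * n)"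
  have D0: "0 \<le> D x" for x by (simp add: D_def)
  have g0: "0 \<le> g x" for x by (simp add: g_def D0 stable_weight_def)
  have Dle: "D x \<le> n * B" for x using trig_sum_square_le[of "{1..n}" b x] by (simp add: D_def B_def)
  have Dcont: "continuous_on S D" for S unfolding D_def by (intro continuous_intros)
  have d: "0 < d" "d \<le> pi" using n by (auto simp: d_def field_simps)
  define T where "T i j x = b i * b j * (cos (real_of_int (int j - int i) * x) * (1 - cos x) * stable_weight H x)" for i j x
  have geq: "g x = (\<Sum>i=1..n. \<Sum>j=1..n. T i j x)" for x
    unfolding g_def D_def T_def trig_sum_square sum_distrib_left by (intro sum.cong refl) (simp add: mult_ac)
  have T: "integrable lborel (\<lambda>x. indicator {0<..} x *\<^sub>R T i j x)"
    "(\<integral>x. indicator {0<..} x *\<^sub>R T i j x \<partial>lborel) = b i * b j * (stable_const H * fgn_autocov H (int j - int i))" for i j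
    using set_integrable_mult_right[OF fgn_autocov_spectral(1)[OF H], of "b i * b j" "int j - int i"]
      set_integral_mult_right[of lborel "{0<..}" "b i * b j"
        "\<lambda>x. cos (real_of_int (int j - int i) * x) * (1 - cos x) * stable_weight H x"]
    unfolding fgn_autocov_spectral(2)[OF H]
    by (simp_all only: T_def set_integrable_def set_lebesgue_integral_def)
  have gint: "set_integrable lborel {0<..} g"
    unfolding geq set_integrable_def scaleR_sum_right using T(1)
    by (intro Bochner_Integration.integrable_sum) auto
  have gval: "(LINT x:{0<..}|lborel. g x) = stable_const H * (\<Sum>i=1..n. \<Sum>j=1..n. b i * b j * fgn_autocov H (int j - int i))"
    unfolding geq set_lebesgue_integral_def scaleR_sum_right sum_distrib_left
    by (simp only: Bochner_Integration.integral_sum Bochner_Integration.integrable_sum T) (simp add: mult_ac)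
  have Dint: "integral {0..pi} D = pi * B"
  proof -
    have "(D has_integral (\<Sum>i=1..n. \<Sum>j=1..n. b i * b j * (if int j - int i = 0 then pi else 0))) {0..pi}"
      unfolding D_def trig_sum_square
      by (intro has_integral_sum has_integral_mult_right integral_cos_int) auto
    moreover have "(\<Sum>i=1..n. \<Sum>j=1..n. b i * b j * (if int j - int i = 0 then pi else 0)) = pi * B"
      unfolding B_def sum_distrib_left
      by (intro sum.cong refl) (simp add: if_distrib[of "\<lambda>x. _ * x"] power2_eq_square cong: if_cong)
    ultimately show ?thesis by (simp add: integral_unique)
  qed
  have "integral {0..d} D \<le> integral {0..d} (\<lambda>x. n * B)"
    by (intro integral_le integrable_continuous_interval Dcont Dle) auto
  also have "\<dots> = pi / 2 * B" using d n by (simp add: d_def)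
  finally have "integral {0..d} D \<le> pi / 2 * B" .
  moreover have "integral {0..d} D + integral {d..pi} D = integral {0..pi} D"
    using d by (intro Henstock_Kurzweil_Integration.integral_combine integrable_continuous_interval Dcont) auto
  ultimately have Dd: "pi / 2 * B \<le> integral {d..pi} D" using Dint by simp
  \<comment> \<open>On [d, pi] the power is smallest at the left end if H \<le> 1/2, where d \<ge>
    1/n, and at the right end otherwise, where the exponent exceeds -1.\<close>
  have weight: "1 / (pi * \<mu>) \<le> x powr (1 - 2 * H)" if x: "d \<le> x" "x \<le> pi" for x
  proof (cases "H \<le> 1/2")
    case True
    have "1 / (pi * \<mu>) \<le> 1 / real n powr (1 - 2 * H)"
      using n pi_gt3 by (intro frac_le) (auto simp: \<mu>_def intro!: order.trans[OF _ mult_right_mono[of 1 pi]])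
    also have "\<dots> = (1 / real n) powr (1 - 2 * H)" using n by (simp add: powr_divide)
    also have "\<dots> \<le> x powr (1 - 2 * H)"
    proof (rule powr_mono2)
      have "1 / real n \<le> d" using n pi_gt3 by (simp add: d_def field_simps)
      then show "1 / real n \<le> x" using x by simp
    qed (use True in auto)
    finally show ?thesis .
  next
    case False
    have "1 / (pi * \<mu>) \<le> 1 / pi" by (simp add: \<mu>_def field_simps)
    also have "\<dots> = pi powr (-1)" by (simp add: powr_minus_divide)
    also have "\<dots> \<le> pi powr (1 - 2 * H)" using H pi_gt3 by (intro powr_mono) auto
    also have "\<dots> \<le> x powr (1 - 2 * H)" using x d False by (intro powr_mono2') auto
    finally show ?thesis .
  qed
  have "1 / (20 * pi * \<mu>) * (pi / 2 * B) \<le> 1 / (20 * pi * \<mu>) * integral {d..pi} D"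
    by (intro mult_left_mono Dd) (auto simp: \<mu>_def)
  also have "\<dots> = 1 / (20 * pi * \<mu>) * (LINT x:{d..pi}|lborel. D x)"
    by (subst set_borel_integral_eq_integral) (auto intro!: borel_integrable_atLeastAtMost' Dcont)
  also have "\<dots> = (LINT x:{d..pi}|lborel. 1 / (20 * pi * \<mu>) * D x)" by simp
  also have "\<dots> \<le> (LINT x:{d..pi}|lborel. g x)"
  proof (rule set_integral_mono)
    show "set_integrable lborel {d..pi} (\<lambda>x. 1 / (20 * pi * \<mu>) * D x)"
      by (intro set_integrable_mult_right borel_integrable_atLeastAtMost' Dcont)
    show "set_integrable lborel {d..pi} g"
      by (rule set_integrable_subset[OF gint]) (use d in auto)
    fix x assume x: "x \<in> {d..pi}"
    have "1 / (20 * pi * \<mu>) = 1 / (pi * \<mu>) / 20" by simp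
    also have "\<dots> \<le> x powr (1 - 2 * H) / 20" using weight x by (intro divide_right_mono) auto
    also have "\<dots> = x\<^sup>2 / 20 * stable_weight H x"
      using x d by (simp add: stable_weight_def powr_add[symmetric] powr_numeral[symmetric] del: powr_numeral)
    also have "\<dots> \<le> (1 - cos x) * stable_weight H x"
      using x d by (intro mult_right_mono one_minus_cos_ge) (auto simp: stable_weight_def)
    finally show "1 / (20 * pi * \<mu>) * D x \<le> g x"
      unfolding g_def by (intro mult_right_mono D0)
  qed
  also have "\<dots> \<le> (LINT x:{0<..}|lborel. g x)"
    by (rule set_integral_mono_set[OF gint]) (use d g0 in auto)
  finally have "B \<le> 40 * \<mu> * (LINT x:{0<..}|lborel. g x)"
    by (simp add: \<mu>_def field_simps)
  then show ?thesis unfolding gval B_def \<mu>_def fgn_bound_def by (simp add: mult_ac)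
qed

section \<open>Gaussian laws and characteristic functions\<close>

abbreviation real_PiM :: "'i set \<Rightarrow> ('i \<Rightarrow> real) measure" where
  "real_PiM I \<equiv> PiM I (\<lambda>_. borel)"

abbreviation process_prob :: "'w measure \<Rightarrow> 'i set \<Rightarrow> ('i \<Rightarrow> 'w \<Rightarrow> real) \<Rightarrow> ('i \<Rightarrow> real) set \<Rightarrow> real" where
  "process_prob M T X A \<equiv> measure M {w \<in> space M. (\<lambda>t\<in>T. X t w) \<in> A}"

lemma measurable_sets_Collect:
  "f \<in> M \<rightarrow>\<^sub>M N \<Longrightarrow> A \<in> sets N \<Longrightarrow> {x \<in> space M. f x \<in> A} \<in> sets M"
  using measurable_sets[of f M N A] by (simp add: vimage_def Int_def conj_commute)

lemma measure_distr_Collect: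
  "f \<in> M \<rightarrow>\<^sub>M N \<Longrightarrow> A \<in> sets N \<Longrightarrow> measure (distr M N f) A = measure M {x \<in> space M. f x \<in> A}"
  by (simp add: measure_distr vimage_def Int_def conj_commute)

lemma integrable_return:
  fixes g :: "'a \<Rightarrow> 'b::{banach, second_countable_topology}"
  assumes "x \<in> space M" "g \<in> borel_measurable M"
  shows "integrable (return M x) g"
  using assms by (simp add: integrable_iff_bounded nn_integral_return)

lemma normal_law_facts:
  assumes "0 \<le> \<sigma>"
  shows "integrable (normal_law \<mu> \<sigma>) (\<lambda>x. x)" "(\<integral>x. x \<partial>normal_law \<mu> \<sigma>) = \<mu>"
    "integrable (normal_law \<mu> \<sigma>) (\<lambda>x. x\<^sup>2)" "(\<integral>x. x\<^sup>2 \<partial>normal_law 0 \<sigma>) = \<sigma>\<^sup>2"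
    "(CLINT x|normal_law 0 \<sigma>. iexp x) = of_real (exp (- \<sigma>\<^sup>2 / 2))"
proof -
  have "integrable (normal_law \<mu> \<sigma>) (\<lambda>x. x) \<and> (\<integral>x. x \<partial>normal_law \<mu> \<sigma>) = \<mu> \<and>
    integrable (normal_law \<mu> \<sigma>) (\<lambda>x. x\<^sup>2) \<and> (\<integral>x. x\<^sup>2 \<partial>normal_law 0 \<sigma>) = \<sigma>\<^sup>2 \<and>
    (CLINT x|normal_law 0 \<sigma>. iexp x) = of_real (exp (- \<sigma>\<^sup>2 / 2))"
  proof (cases "\<sigma> = 0")
    case True
    then show ?thesis by (simp add: normal_law_def integrable_return integral_return)
  next
    case False
    then have s: "0 < \<sigma>" using assms by simp
    have law: "normal_law \<nu> \<sigma> = density lborel (normal_density \<nu> \<sigma>)" for \<nu>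
      using False by (simp add: normal_law_def)
    have 1: "integrable (normal_law \<mu> \<sigma>) (\<lambda>x. x)"
      using integrable_normal_moment_nz_1[OF s, of \<mu>] by (simp add: law integrable_real_density)
    have "integrable (normal_law \<mu> \<sigma>) (\<lambda>x. (x - \<mu>)\<^sup>2)" "integrable (normal_law \<mu> \<sigma>) (\<lambda>_. \<mu>\<^sup>2)"
      using integrable_normal_moment[OF s, of \<mu> 2] integrable_normal_density[OF s, of \<mu>]
      by (simp_all add: law integrable_real_density)
    then have "integrable (normal_law \<mu> \<sigma>) (\<lambda>x. (x - \<mu>)\<^sup>2 + 2 * \<mu> * x - \<mu>\<^sup>2)"
      using 1 by (intro Bochner_Integration.integrable_add Bochner_Integration.integrable_diff integrable_mult_right)
    moreover have "(\<lambda>x. (x - \<mu>)\<^sup>2 + 2 * \<mu> * x - \<mu>\<^sup>2) = (\<lambda>x. x\<^sup>2)"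
      by (simp add: fun_eq_iff power2_eq_square algebra_simps)
    ultimately have 2: "integrable (normal_law \<mu> \<sigma>) (\<lambda>x. x\<^sup>2)" by simp
    have "(CLINT x|normal_law 0 \<sigma>. iexp x) = (CLINT x|lborel. normal_density 0 \<sigma> x *\<^sub>R iexp x)"
      by (simp add: law integral_density)
    also have "\<dots> = \<bar>\<sigma>\<bar> *\<^sub>R (CLINT x|lborel. normal_density 0 \<sigma> (0 + \<sigma> * x) *\<^sub>R iexp (0 + \<sigma> * x))"
      using False by (rule lborel_integral_real_affine)
    also have "\<dots> = (CLINT x|lborel. \<sigma> *\<^sub>R (normal_density 0 \<sigma> (0 + \<sigma> * x) *\<^sub>R iexp (0 + \<sigma> * x)))"
      by (simp only: integral_scaleR_right abs_of_pos[OF s])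
    also have "\<dots> = (CLINT x|lborel. std_normal_density x *\<^sub>R iexp (\<sigma> * x))"
    proof (intro Bochner_Integration.integral_cong refl)
      fix x :: real
      have "\<sigma> * normal_density 0 \<sigma> (\<sigma> * x) = std_normal_density x"
        using s by (simp add: normal_density_def power_mult_distrib real_sqrt_mult)
      then show "\<sigma> *\<^sub>R (normal_density 0 \<sigma> (0 + \<sigma> * x) *\<^sub>R iexp (0 + \<sigma> * x)) = std_normal_density x *\<^sub>R iexp (\<sigma> * x)"
        by (metis add_0 scaleR_scaleR)
    qed
    also have "\<dots> = char std_normal_distribution \<sigma>"
      unfolding char_def by (subst integral_density) auto
    finally have "(CLINT x|normal_law 0 \<sigma>. iexp x) = of_real (exp (- \<sigma>\<^sup>2 / 2))"
      by (simp add: char_std_normal_distribution)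
    moreover have "(\<integral>x. x \<partial>normal_law \<mu> \<sigma>) = \<mu>"
      using integral_normal_moment_nz_1[OF s, of \<mu>] by (simp add: law integral_real_density)
    moreover have "(\<integral>x. x\<^sup>2 \<partial>normal_law 0 \<sigma>) = \<sigma>\<^sup>2"
      using integral_normal_moment_even[OF s, of 0 1] by (simp add: law integral_real_density fact_numeral)
    ultimately show ?thesis using 1 2 by blast
  qed
  then show "integrable (normal_law \<mu> \<sigma>) (\<lambda>x. x)" "(\<integral>x. x \<partial>normal_law \<mu> \<sigma>) = \<mu>"
    "integrable (normal_law \<mu> \<sigma>) (\<lambda>x. x\<^sup>2)" "(\<integral>x. x\<^sup>2 \<partial>normal_law 0 \<sigma>) = \<sigma>\<^sup>2"
    "(CLINT x|normal_law 0 \<sigma>. iexp x) = of_real (exp (- \<sigma>\<^sup>2 / 2))" by blast+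
qed

text \<open>The characteristic function is taken at argument 1 only, since the coefficients a absorb
  the scale. In this form linear images and independent sums are computations with exponents, and
  degenerate variances need no separate case.\<close>

definition gaussian_char ::
  "'w measure \<Rightarrow> 't set \<Rightarrow> ('t \<Rightarrow> 't \<Rightarrow> real) \<Rightarrow> ('t \<Rightarrow> 'w \<Rightarrow> real) \<Rightarrow> bool" where
  "gaussian_char M T c X \<longleftrightarrow> prob_space M \<and> (\<forall>t\<in>T. X t \<in> borel_measurable M) \<and>
     (\<forall>F a. finite F \<longrightarrow> F \<subseteq> T \<longrightarrow>
        (CLINT w|M. iexp (\<Sum>t\<in>F. a t * X t w)) = of_real (exp (- (\<Sum>s\<in>F. \<Sum>t\<in>F. a s * a t * c s t) / 2)))"

lemma gaussian_charD:
  assumes "gaussian_char M T c X"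
  shows "prob_space M" "\<And>t. t \<in> T \<Longrightarrow> X t \<in> borel_measurable M"
    "\<And>F a. finite F \<Longrightarrow> F \<subseteq> T \<Longrightarrow>
        (CLINT w|M. iexp (\<Sum>t\<in>F. a t * X t w)) = of_real (exp (- (\<Sum>s\<in>F. \<Sum>t\<in>F. a s * a t * c s t) / 2))"
  using assms unfolding gaussian_char_def by blast+

lemma gaussian_char_mono: "gaussian_char M T c X \<Longrightarrow> S \<subseteq> T \<Longrightarrow> gaussian_char M S c X"
  unfolding gaussian_char_def by blast

text \<open>The one-dimensional Gaussian laws supply square integrability first: the integral of a
  non-integrable function is 0 by convention, so the mean and covariance equations alone carry no
  such information. After that, mean and variance of a linear combination can be computed termwise,
  which identifies its normal law.\<close>

lemma centered_gaussian_process_imp_char: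
  assumes "centered_gaussian_process M T c X"
  shows "gaussian_char M T c X"
proof -
  interpret prob_space M using assms by (simp add: centered_gaussian_process_def gaussian_process_def)
  have meas[measurable]: "X t \<in> borel_measurable M" if "t \<in> T" for t
    using assms that by (simp add: centered_gaussian_process_def gaussian_process_def)
  have law: "\<exists>\<mu> \<sigma>. 0 \<le> \<sigma> \<and> distr M borel (\<lambda>w. \<Sum>t\<in>F. a t * X t w) = normal_law \<mu> \<sigma>" if "finite F" "F \<subseteq> T" for F a
    using assms that unfolding centered_gaussian_process_def gaussian_process_def by blast
  have mean: "(\<integral>w. X t w \<partial>M) = 0" if "t \<in> T" for t
    using assms that by (simp add: centered_gaussian_process_def)
  have cov: "(\<integral>w. X s w * X t w \<partial>M) = c s t" if "s \<in> T" "t \<in> T" for s t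
    using assms that by (simp add: centered_gaussian_process_def)
  have int: "integrable M (X t)" "integrable M (\<lambda>w. (X t w)\<^sup>2)" if t: "t \<in> T" for t
  proof -
    obtain \<mu> \<sigma> where ms: "0 \<le> \<sigma>" "distr M borel (X t) = normal_law \<mu> \<sigma>"
      using law[of "{t}" "\<lambda>_. 1"] t by auto
    have "integrable (distr M borel (X t)) (\<lambda>x. x)" "integrable (distr M borel (X t)) (\<lambda>x. x\<^sup>2)"
      unfolding ms(2) by (rule normal_law_facts[OF ms(1)])+
    then show "integrable M (X t)" "integrable M (\<lambda>w. (X t w)\<^sup>2)"
      using meas[OF t] by (simp_all add: integrable_distr_eq)
  qed
  have int2: "integrable M (\<lambda>w. X s w * X t w)" if st: "s \<in> T" "t \<in> T" for s t
  proof (rule Bochner_Integration.integrable_bound)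
    show "integrable M (\<lambda>w. (X s w)\<^sup>2 + (X t w)\<^sup>2)" using int st by simp
    show "(\<lambda>w. X s w * X t w) \<in> borel_measurable M" using st by measurable
    have "\<bar>x * y\<bar> \<le> x\<^sup>2 + y\<^sup>2" for x y :: real
    proof -
      have "2 * (\<bar>x\<bar> * \<bar>y\<bar>) \<le> x\<^sup>2 + y\<^sup>2"
        using sum_squares_bound[of "\<bar>x\<bar>" "\<bar>y\<bar>"] by simp
      moreover have "0 \<le> \<bar>x\<bar> * \<bar>y\<bar>" by simp
      ultimately show ?thesis unfolding abs_mult by linarith
    qed
    then show "AE w in M. norm (X s w * X t w) \<le> norm ((X s w)\<^sup>2 + (X t w)\<^sup>2)"
      by (intro AE_I2) simp
  qed
  have "(CLINT w|M. iexp (\<Sum>t\<in>F. a t * X t w)) = of_real (exp (- (\<Sum>s\<in>F. \<Sum>t\<in>F. a s * a t * c s t) / 2))"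
    if F: "finite F" "F \<subseteq> T" for F and a :: "_ \<Rightarrow> real"
  proof -
    define Y where "Y w = (\<Sum>t\<in>F. a t * X t w)" for w
    have Y[measurable]: "Y \<in> borel_measurable M" unfolding Y_def using F by (intro borel_measurable_sum borel_measurable_times borel_measurable_const meas) auto
    obtain \<mu> \<sigma> where ms: "0 \<le> \<sigma>" "distr M borel Y = normal_law \<mu> \<sigma>"
      using law[OF F, of a] unfolding Y_def by auto
    have "\<mu> = (\<integral>w. Y w \<partial>M)"
      using normal_law_facts(2)[OF ms(1), of \<mu>] unfolding ms(2)[symmetric] by (simp add: integral_distr)
    also have "\<dots> = 0" unfolding Y_def using F int(1) mean
      by (subst Bochner_Integration.integral_sum) (auto intro!: sum.neutral)
    finally have mu: "\<mu> = 0" .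
    have "\<sigma>\<^sup>2 = (\<integral>w. (Y w)\<^sup>2 \<partial>M)"
      using normal_law_facts(4)[OF ms(1)] unfolding ms(2)[symmetric, unfolded mu] by (simp add: integral_distr)
    also have "\<dots> = (\<integral>w. (\<Sum>s\<in>F. \<Sum>t\<in>F. a s * a t * (X s w * X t w)) \<partial>M)"
      unfolding Y_def power2_eq_square sum_product by (intro Bochner_Integration.integral_cong refl sum.cong) (simp add: mult_ac)
    also have "\<dots> = (\<Sum>s\<in>F. \<Sum>t\<in>F. a s * a t * (\<integral>w. X s w * X t w \<partial>M))"
    proof -
      have i: "integrable M (\<lambda>w. a s * a t * (X s w * X t w))" if "s \<in> F" "t \<in> F" for s t
        using int2 F that by (intro integrable_mult_right) auto
      have "(\<integral>w. (\<Sum>s\<in>F. \<Sum>t\<in>F. a s * a t * (X s w * X t w)) \<partial>M)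
          = (\<Sum>s\<in>F. (\<integral>w. (\<Sum>t\<in>F. a s * a t * (X s w * X t w)) \<partial>M))"
        using i by (intro Bochner_Integration.integral_sum Bochner_Integration.integrable_sum) auto
      also have "\<dots> = (\<Sum>s\<in>F. \<Sum>t\<in>F. (\<integral>w. a s * a t * (X s w * X t w) \<partial>M))"
        using i by (intro sum.cong refl Bochner_Integration.integral_sum) auto
      finally show ?thesis by simp
    qed
    also have "\<dots> = (\<Sum>s\<in>F. \<Sum>t\<in>F. a s * a t * c s t)"
      using F cov by (intro sum.cong refl) auto
    finally have s: "\<sigma>\<^sup>2 = (\<Sum>s\<in>F. \<Sum>t\<in>F. a s * a t * c s t)" .
    have "(CLINT w|M. iexp (Y w)) = (CLINT x|distr M borel Y. iexp x)"
      by (simp add: integral_distr)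
    then show ?thesis unfolding ms(2) mu normal_law_facts(5)[OF ms(1)] s by (simp add: Y_def)
  qed
  then show ?thesis unfolding gaussian_char_def using meas prob_space_axioms by blast
qed

section \<open>Characteristic functions determine finite-dimensional laws\<close>

lemma weighted_distr:
  fixes X w :: "'a \<Rightarrow> real"
  assumes X[measurable]: "X \<in> borel_measurable M" and w[measurable]: "w \<in> borel_measurable M"
    and nonneg: "\<And>x. 0 \<le> w x" and int: "integrable M w" and m: "0 < m" "(\<integral>x. w x \<partial>M) = m"
  defines "P \<equiv> distr (density M (\<lambda>x. ennreal (w x / m))) borel X"
  shows "real_distribution P" "char P u = (1 / m) *\<^sub>R (CLINT x|M. w x *\<^sub>R iexp (u * X x))"
    "A \<in> sets borel \<Longrightarrow> (\<integral>x. indicator A x \<partial>P) = (\<integral>x. w x * indicator A (X x) \<partial>M) / m"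
proof -
  have "prob_space (density M (\<lambda>x. ennreal (w x / m)))"
  proof
    have "(\<integral>\<^sup>+ x. ennreal (w x / m) \<partial>M) = ennreal (\<integral>x. w x / m \<partial>M)"
      using int nonneg m by (intro nn_integral_eq_integral) auto
    then show "emeasure (density M (\<lambda>x. ennreal (w x / m))) (space (density M (\<lambda>x. ennreal (w x / m)))) = 1"
      using m by (simp add: emeasure_density cong: nn_integral_cong)
  qed
  then show "real_distribution P" unfolding P_def
    by (intro prob_space.real_distribution_distr) simp_all
  have "char P u = (CLINT x|density M (\<lambda>x. ennreal (w x / m)). iexp (u * X x))"
    unfolding char_def P_def by (subst integral_distr) simp_all
  also have "\<dots> = (CLINT x|M. (w x / m) *\<^sub>R iexp (u * X x))"
    using nonneg m by (subst integral_density) simp_all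
  also have "\<dots> = (CLINT x|M. (1 / m) *\<^sub>R (w x *\<^sub>R iexp (u * X x)))" by simp
  finally show "char P u = (1 / m) *\<^sub>R (CLINT x|M. w x *\<^sub>R iexp (u * X x))"
    by (simp only: integral_scaleR_right)
  show "(\<integral>x. indicator A x \<partial>P) = (\<integral>x. w x * indicator A (X x) \<partial>M) / m" if "A \<in> sets borel"
    unfolding P_def using nonneg m that
    by (subst integral_distr, simp, simp, subst integral_density) simp_all
qed

text \<open>Levy uniqueness for the laws of X and Y under the weighted measures, after normalisation
  to probability measures. The argument u = 0 shows that both total masses agree; mass 0 cannot be
  normalised, but then both weights vanish almost everywhere.\<close>

lemma weighted_char_unique:
  fixes X w :: "'a \<Rightarrow> real" and Y v :: "'b \<Rightarrow> real"
  assumes X[measurable]: "X \<in> borel_measurable M" and w[measurable]: "w \<in> borel_measurable M"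
    and Y[measurable]: "Y \<in> borel_measurable N" and v[measurable]: "v \<in> borel_measurable N"
    and nonneg: "\<And>x. 0 \<le> w x" "\<And>y. 0 \<le> v y"
    and int: "integrable M w" "integrable N v"
    and eq: "\<And>u. (CLINT x|M. w x *\<^sub>R iexp (u * X x)) = (CLINT y|N. v y *\<^sub>R iexp (u * Y y))"
    and A[measurable]: "A \<in> sets borel"
  shows "(\<integral>x. w x * indicator A (X x) \<partial>M) = (\<integral>y. v y * indicator A (Y y) \<partial>N)"
proof -
  define m where "m = (\<integral>x. w x \<partial>M)"
  have "complex_of_real m = of_real (\<integral>y. v y \<partial>N)"
    using eq[of 0] by (simp add: m_def scaleR_conv_of_real)
  then have m2: "m = (\<integral>y. v y \<partial>N)" by (simp only: of_real_eq_iff)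
  show ?thesis
  proof (cases "m = 0")
    case True
    then have "AE x in M. w x = 0" "AE y in N. v y = 0"
      using integral_nonneg_eq_0_iff_AE[OF int(1)] integral_nonneg_eq_0_iff_AE[OF int(2)] nonneg m_def m2 by auto
    then have "(\<integral>x. w x * indicator A (X x) \<partial>M) = (\<integral>x. 0 \<partial>M)" "(\<integral>y. v y * indicator A (Y y) \<partial>N) = (\<integral>y. 0 \<partial>N)"
      by (intro integral_cong_AE; auto)+
    then show ?thesis by simp
  next
    case False
    then have m: "m > 0" unfolding m_def using nonneg
      by (metis Bochner_Integration.integral_nonneg less_eq_real_def)
    note P = weighted_distr[OF X w nonneg(1) int(1) m m_def[symmetric]]
      and Q = weighted_distr[OF Y v nonneg(2) int(2) m m2[symmetric]]
    have "distr (density M (\<lambda>x. ennreal (w x / m))) borel X = distr (density N (\<lambda>y. ennreal (v y / m))) borel Y"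
      by (rule Levy_uniqueness[OF P(1) Q(1)], rule ext) (simp only: P(2) Q(2) eq)
    then show ?thesis using P(3)[OF A] Q(3)[OF A] m by simp
  qed
qed

text \<open>The coefficients 0, 1 and \<open>-1\<close> are left in so that the three terms are instances of one induction
  hypothesis in the next lemma.\<close>

lemma (in prob_space) cos_weight:
  fixes p X \<theta> :: "'a \<Rightarrow> real"
  assumes [measurable]: "p \<in> borel_measurable M" "X \<in> borel_measurable M" "\<theta> \<in> borel_measurable M"
    and p: "\<And>x. 0 \<le> p x" "\<And>x. p x \<le> 1"
  shows "\<And>r. r \<in> borel_measurable M \<Longrightarrow> (\<And>x. \<bar>r x\<bar> \<le> 2) \<Longrightarrow> integrable M (\<lambda>x. p x * r x)"
    and "(CLINT x|M. (p x * (1 + cos (\<theta> x + \<phi>))) *\<^sub>R iexp (u * X x))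
      = (CLINT x|M. p x *\<^sub>R iexp (u * X x + 0 * \<theta> x)) +
        (iexp \<phi> / 2 * (CLINT x|M. p x *\<^sub>R iexp (u * X x + 1 * \<theta> x))
         + iexp (- \<phi>) / 2 * (CLINT x|M. p x *\<^sub>R iexp (u * X x + (-1) * \<theta> x)))" (is "?char")
    and "A \<in> sets borel \<Longrightarrow> (\<integral>x. p x * (1 + cos (\<theta> x + \<phi>)) * indicator A (X x) \<partial>M)
      = (\<integral>x. p x * indicator A (X x) \<partial>M) + (\<integral>x. p x * (indicator A (X x) * cos (\<theta> x + \<phi>)) \<partial>M)"
    and "A \<in> sets borel \<Longrightarrow> (CLINT x|M. (p x * indicator A (X x)) *\<^sub>R iexp (\<theta> x))
      = of_real (\<integral>x. p x * (indicator A (X x) * cos (\<theta> x + 0)) \<partial>M)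
        + \<i> * of_real (\<integral>x. p x * (indicator A (X x) * cos (\<theta> x + (- pi / 2))) \<partial>M)"
proof -
  show int: "integrable M (\<lambda>x. p x * r x)" if [measurable]: "r \<in> borel_measurable M" and "\<And>x. \<bar>r x\<bar> \<le> 2" for r
  proof (rule integrable_const_bound[of _ 2])
    show "AE x in M. norm (p x * r x) \<le> 2"
      using mult_mono[OF p(2) that(2)] p(1) by (intro AE_I2) (simp add: abs_mult)
  qed measurable
  have bnd: "\<bar>indicator S z * cos (w::real)\<bar> \<le> 2" "\<bar>indicator S z :: real\<bar> \<le> 2" for S :: "real set" and z w
    by (auto simp: indicator_def intro: order_trans[OF abs_cos_le_one])
  have expand: "(r * (1 + cos (z + \<phi>))) *\<^sub>R iexp v
      = r *\<^sub>R iexp (v + 0 * z) + (iexp \<phi> / 2 * (r *\<^sub>R iexp (v + 1 * z)) + iexp (- \<phi>) / 2 * (r *\<^sub>R iexp (v + (-1) * z)))"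
    for r z v :: real
  proof -
    have "complex_of_real (cos (z + \<phi>)) = (iexp (z + \<phi>) + iexp (- (z + \<phi>))) / 2"
      by (simp add: cos_of_real[symmetric] cos_exp_eq algebra_simps)
    then have c: "complex_of_real (1 + cos (z + \<phi>)) = 1 + (iexp (z + \<phi>) + iexp (- (z + \<phi>))) / 2" by simp
    have "iexp \<phi> * iexp (v + 1 * z) = iexp (z + \<phi>) * iexp v"
      "iexp (- \<phi>) * iexp (v + (-1) * z) = iexp (- (z + \<phi>)) * iexp v"
      by (simp_all add: exp_add[symmetric] algebra_simps)
    then have "iexp \<phi> / 2 * (of_real r * iexp (v + 1 * z)) = of_real r / 2 * (iexp (z + \<phi>) * iexp v)"
      "iexp (- \<phi>) / 2 * (of_real r * iexp (v + (-1) * z)) = of_real r / 2 * (iexp (- (z + \<phi>)) * iexp v)"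
      by (simp_all only: times_divide_eq_left times_divide_eq_right mult.left_commute)
    then show ?thesis
      unfolding scaleR_conv_of_real of_real_mult[of r] c by (simp only:) (simp add: field_simps)
  qed
  have i: "integrable M (\<lambda>x. p x *\<^sub>R iexp (u * X x + s * \<theta> x))" for s
    by (rule integrable_const_bound[of _ 1]) (use p in auto)
  have j: "integrable M (\<lambda>x. c * (p x *\<^sub>R iexp (u * X x + s * \<theta> x)))" for c s
    by (intro integrable_mult_right i)
  show ?char unfolding expand
    by (simp only: Bochner_Integration.integral_add Bochner_Integration.integrable_add integral_mult_right_zero i j)
  assume [measurable]: "A \<in> sets borel"
  show "(\<integral>x. p x * (1 + cos (\<theta> x + \<phi>)) * indicator A (X x) \<partial>M)
      = (\<integral>x. p x * indicator A (X x) \<partial>M) + (\<integral>x. p x * (indicator A (X x) * cos (\<theta> x + \<phi>)) \<partial>M)"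
    by (subst Bochner_Integration.integral_add[symmetric]; (intro int bnd, measurable)?) (simp add: algebra_simps)
  \<comment> \<open>The phases 0 and -pi/2 turn the cosine into the real and the imaginary part of
    the exponential.\<close>
  have polar: "(r * s) *\<^sub>R iexp z = of_real (r * (s * cos (z + 0))) + \<i> * of_real (r * (s * cos (z + (- pi / 2))))" for r s z :: real
    by (simp add: scaleR_conv_of_real cis_conv_exp[symmetric] complex_eq_iff cos_diff)
  show "(CLINT x|M. (p x * indicator A (X x)) *\<^sub>R iexp (\<theta> x))
      = of_real (\<integral>x. p x * (indicator A (X x) * cos (\<theta> x + 0)) \<partial>M)
        + \<i> * of_real (\<integral>x. p x * (indicator A (X x) * cos (\<theta> x + (- pi / 2))) \<partial>M)"
    unfolding polar integral_complex_of_real[symmetric] integral_mult_right_zero[symmetric]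
    by (rule Bochner_Integration.integral_add) (intro integrable_mult_right integrable_of_real int bnd; measurable)+
qed

text \<open>Cramer-Wold: the coordinates are passed from the exponential to indicators one at a time; the weight
  \<open>1 + cos\<close> is nonnegative, so that Levy's uniqueness theorem applies to it.\<close>

lemma char_eq_imp_indicator_eq:
  fixes X :: "'i \<Rightarrow> 'a \<Rightarrow> real" and Y :: "'i \<Rightarrow> 'b \<Rightarrow> real"
  assumes "prob_space M" "prob_space N" and I: "finite I"
    and X[measurable]: "\<And>i. i \<in> I \<Longrightarrow> X i \<in> borel_measurable M"
    and Y[measurable]: "\<And>i. i \<in> I \<Longrightarrow> Y i \<in> borel_measurable N"
    and char_eq: "\<And>a. (CLINT x|M. iexp (\<Sum>i\<in>I. a i * X i x)) = (CLINT y|N. iexp (\<Sum>i\<in>I. a i * Y i y))"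
    and J: "J \<subseteq> I" and A: "\<And>j. j \<in> J \<Longrightarrow> A j \<in> sets borel"
  shows "(CLINT x|M. (\<Prod>j\<in>J. indicator (A j) (X j x)) *\<^sub>R iexp (\<Sum>i\<in>I - J. a i * X i x))
       = (CLINT y|N. (\<Prod>j\<in>J. indicator (A j) (Y j y)) *\<^sub>R iexp (\<Sum>i\<in>I - J. a i * Y i y))"
proof -
  interpret M: prob_space M by fact
  interpret N: prob_space N by fact
  have "finite J" using J I by (rule finite_subset)
  then show ?thesis using J A
  proof (induction J arbitrary: a rule: finite_induct)
    case empty
    then show ?case using char_eq[of a] by simp
  next
    case (insert k J)
    have k: "k \<in> I" "k \<notin> J" and JI: "J \<subseteq> I" and Ak[measurable]: "A k \<in> sets borel" and AJ: "\<And>j. j \<in> J \<Longrightarrow> A j \<in> sets borel"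
      using insert by auto
    define K where "K = I - insert k J"
    have K: "finite K" "k \<notin> K" "K \<subseteq> I" "I - J = insert k K" using I k by (auto simp: K_def)
    define p where "p x = (\<Prod>j\<in>J. indicator (A j) (X j x) :: real)" for x
    define q where "q y = (\<Prod>j\<in>J. indicator (A j) (Y j y) :: real)" for y
    define \<theta> where "\<theta> x = (\<Sum>i\<in>K. a i * X i x)" for x
    define \<eta> where "\<eta> y = (\<Sum>i\<in>K. a i * Y i y)" for y
    have [measurable]: "X k \<in> borel_measurable M" "Y k \<in> borel_measurable N" using X Y k by auto
    have [measurable]: "p \<in> borel_measurable M"
      unfolding p_def using JI AJ by (intro borel_measurable_prod borel_measurable_indicator' X) auto
    have [measurable]: "q \<in> borel_measurable N"
      unfolding q_def using JI AJ by (intro borel_measurable_prod borel_measurable_indicator' Y) auto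
    have [measurable]: "\<theta> \<in> borel_measurable M"
      unfolding \<theta>_def using K by (intro borel_measurable_sum borel_measurable_times X) auto
    have [measurable]: "\<eta> \<in> borel_measurable N"
      unfolding \<eta>_def using K by (intro borel_measurable_sum borel_measurable_times Y) auto
    have p: "0 \<le> p x" "p x \<le> 1" for x unfolding p_def by (auto intro!: prod_nonneg prod_le_1)
    have q: "0 \<le> q x" "q x \<le> 1" for x unfolding q_def by (auto intro!: prod_nonneg prod_le_1)
    \<comment> \<open>The coefficients are u at the coordinate k and s times the old ones elsewhere;
      the values s = 0, 1, -1 are the three terms of the cosine weight.\<close>
    have IH: "(CLINT x|M. p x *\<^sub>R iexp (u * X k x + s * \<theta> x)) = (CLINT y|N. q y *\<^sub>R iexp (u * Y k y + s * \<eta> y))" for u s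
    proof -
      have "(\<Sum>i\<in>I - J. ((\<lambda>i. s * a i)(k := u)) i * Z i) = u * Z k + s * (\<Sum>i\<in>K. a i * Z i)" for Z :: "'i \<Rightarrow> real"
      proof -
        have "(\<Sum>i\<in>K. ((\<lambda>i. s * a i)(k := u)) i * Z i) = (\<Sum>i\<in>K. s * (a i * Z i))"
          using K(2) by (intro sum.cong) auto
        then show ?thesis using K(1,2) unfolding K(4) by (simp add: sum_distrib_left)
      qed
      then show ?thesis
        using insert.IH[OF JI AJ, of "(\<lambda>i. s * a i)(k := u)"] unfolding p_def q_def \<theta>_def \<eta>_def by (simp only:)
    qed
    note wM = M.cos_weight[of p "X k" \<theta>, OF _ _ _ p] and wN = N.cos_weight[of q "Y k" \<eta>, OF _ _ _ q]
    have base: "(\<integral>x. p x * indicator (A k) (X k x) \<partial>M) = (\<integral>y. q y * indicator (A k) (Y k y) \<partial>N)"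
      by (rule weighted_char_unique) (use IH[of _ 0] p q wM(1)[of "\<lambda>_. 1"] wN(1)[of "\<lambda>_. 1"] in auto)
    have cosw: "(\<integral>x. p x * (1 + cos (\<theta> x + \<phi>)) * indicator (A k) (X k x) \<partial>M)
        = (\<integral>y. q y * (1 + cos (\<eta> y + \<phi>)) * indicator (A k) (Y k y) \<partial>N)" for \<phi>
    proof (rule weighted_char_unique)
      have c: "0 \<le> 1 + cos z" "\<bar>1 + cos z\<bar> \<le> 2" for z :: real
        using cos_ge_minus_one[of z] cos_le_one[of z] by linarith+
      show "0 \<le> p x * (1 + cos (\<theta> x + \<phi>))" "0 \<le> q y * (1 + cos (\<eta> y + \<phi>))" for x y
        using p q c by (auto intro!: mult_nonneg_nonneg)
      show "integrable M (\<lambda>x. p x * (1 + cos (\<theta> x + \<phi>)))" "integrable N (\<lambda>y. q y * (1 + cos (\<eta> y + \<phi>)))"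
        using c by (auto intro!: wM(1) wN(1))
      show "(CLINT x|M. (p x * (1 + cos (\<theta> x + \<phi>))) *\<^sub>R iexp (u * X k x))
        = (CLINT y|N. (q y * (1 + cos (\<eta> y + \<phi>))) *\<^sub>R iexp (u * Y k y))" for u
        by (subst wM(2) wN(2), (simp; fail)+)+ (simp only: IH)
    qed measurable
    \<comment> \<open>Subtracting the identity for the weight without cosine leaves the signed
      weight, to which uniqueness of probability laws could not be applied directly.\<close>
    have cosw': "(\<integral>x. p x * (indicator (A k) (X k x) * cos (\<theta> x + \<phi>)) \<partial>M)
        = (\<integral>y. q y * (indicator (A k) (Y k y) * cos (\<eta> y + \<phi>)) \<partial>N)" for \<phi>
      using cosw[of \<phi>] base wM(3)[OF _ _ _ Ak, of \<phi>] wN(3)[OF _ _ _ Ak, of \<phi>] by simp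
    have "(CLINT x|M. (p x * indicator (A k) (X k x)) *\<^sub>R iexp (\<theta> x))
        = (CLINT x|N. (q x * indicator (A k) (Y k x)) *\<^sub>R iexp (\<eta> x))"
      using wM(4)[OF _ _ _ Ak] wN(4)[OF _ _ _ Ak] cosw'[of 0] cosw'[of "- pi / 2"] by simp
    then show ?case using insert.hyps unfolding p_def q_def \<theta>_def \<eta>_def K_def[symmetric] by (simp add: mult.commute)
  qed
qed

text \<open>Once every coordinate of a finite set has been passed to an indicator, the identity is
  about probabilities of measurable rectangles, and these determine a probability measure on the
  product, also for uncountable index sets.\<close>

lemma char_eq_imp_distr_eq:
  fixes X :: "'i \<Rightarrow> 'a \<Rightarrow> real" and Y :: "'i \<Rightarrow> 'b \<Rightarrow> real"
  assumes M: "prob_space M" and N: "prob_space N"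
    and X: "\<And>i. i \<in> I \<Longrightarrow> X i \<in> borel_measurable M"
    and Y: "\<And>i. i \<in> I \<Longrightarrow> Y i \<in> borel_measurable N"
    and char_eq: "\<And>F a. finite F \<Longrightarrow> F \<subseteq> I \<Longrightarrow>
      (CLINT x|M. iexp (\<Sum>i\<in>F. a i * X i x)) = (CLINT y|N. iexp (\<Sum>i\<in>F. a i * Y i y))"
  shows "distr M (real_PiM I) (\<lambda>x. \<lambda>i\<in>I. X i x) = distr N (real_PiM I) (\<lambda>y. \<lambda>i\<in>I. Y i y)"
proof -
  have mX: "(\<lambda>x. \<lambda>i\<in>I. X i x) \<in> M \<rightarrow>\<^sub>M real_PiM I" by (intro measurable_restrict X)
  have mY: "(\<lambda>x. \<lambda>i\<in>I. Y i x) \<in> N \<rightarrow>\<^sub>M real_PiM I" by (intro measurable_restrict Y)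
  have cyl: "measure (distr P (real_PiM I) (\<lambda>x. \<lambda>i\<in>I. Z i x)) (prod_emb I (\<lambda>_. borel) J (Pi\<^sub>E J A))
      = (\<integral>x. (\<Prod>j\<in>J. indicator (A j) (Z j x)) \<partial>P)"
    if P: "prob_space P" and Z: "\<And>i. i \<in> I \<Longrightarrow> Z i \<in> borel_measurable P"
      and J: "finite J" "J \<subseteq> I" "\<And>i. i \<in> J \<Longrightarrow> A i \<in> sets borel" for P :: "'p measure" and Z :: "'i \<Rightarrow> 'p \<Rightarrow> real" and J A
  proof -
    have mZ: "(\<lambda>x. \<lambda>i\<in>I. Z i x) \<in> P \<rightarrow>\<^sub>M real_PiM I" by (intro measurable_restrict Z)
    have E: "prod_emb I (\<lambda>_. borel) J (Pi\<^sub>E J A) \<in> sets (real_PiM I)"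
      using J by (intro sets_PiM_I) auto
    have ind: "(\<Prod>j\<in>J. indicator (A j) (Z j x) :: real) = indicator (prod_emb I (\<lambda>_. borel) J (Pi\<^sub>E J A)) (\<lambda>i\<in>I. Z i x)" for x
    proof -
      have "(\<lambda>i\<in>I. Z i x) \<in> prod_emb I (\<lambda>_. borel) J (Pi\<^sub>E J A) \<longleftrightarrow> (\<forall>j\<in>J. Z j x \<in> A j)"
        using J(2) by (auto simp: prod_emb_def subset_iff PiE_iff)
      then show ?thesis using J(1) by (auto simp: indicator_def prod_eq_1_iff)
    qed
    show ?thesis unfolding ind
      using integral_distr[OF mZ, of "indicator (prod_emb I (\<lambda>_. borel) J (Pi\<^sub>E J A)) :: _ \<Rightarrow> real"] E by simp
  qed
  interpret MX: prob_space "distr M (real_PiM I) (\<lambda>x. \<lambda>i\<in>I. X i x)"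
    by (rule prob_space.prob_space_distr[OF M mX])
  interpret NY: prob_space "distr N (real_PiM I) (\<lambda>x. \<lambda>i\<in>I. Y i x)"
    by (rule prob_space.prob_space_distr[OF N mY])
  show ?thesis
  proof (rule measure_eqI_PiM_infinite)
    fix A :: "'i \<Rightarrow> real set" and J assume J: "finite J" "J \<subseteq> I" "\<And>i. i \<in> J \<Longrightarrow> A i \<in> sets borel"
    \<comment> \<open>The index set is J itself, so the exponent is an empty sum and its
      coefficients may be \<open>undefined\<close>.\<close>
    have "complex_of_real (\<integral>x. (\<Prod>j\<in>J. indicator (A j) (X j x)) \<partial>M) = of_real (\<integral>x. (\<Prod>j\<in>J. indicator (A j) (Y j x)) \<partial>N)"
      using char_eq_imp_indicator_eq[OF M N J(1), of X Y J A undefined] X Y J char_eq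
      by (auto simp: subset_iff scaleR_conv_of_real simp del: of_real_prod)
    then have "(\<integral>x. (\<Prod>j\<in>J. indicator (A j) (X j x)) \<partial>M) = (\<integral>x. (\<Prod>j\<in>J. indicator (A j) (Y j x)) \<partial>N :: real)"
      by (simp only: of_real_eq_iff)
    then show "emeasure (distr M (real_PiM I) (\<lambda>x. \<lambda>i\<in>I. X i x)) (prod_emb I (\<lambda>_. borel) J (Pi\<^sub>E J A))
        = emeasure (distr N (real_PiM I) (\<lambda>x. \<lambda>i\<in>I. Y i x)) (prod_emb I (\<lambda>_. borel) J (Pi\<^sub>E J A))"
      unfolding MX.emeasure_eq_measure NY.emeasure_eq_measure
      using cyl[OF M X J] cyl[OF N Y J] by simp
  qed (simp_all, unfold_locales)
qed


section \<open>Linear images and independent sums of Gaussian processes\<close>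

lemma gaussian_char_distr_eq:
  assumes "gaussian_char M T c X" "gaussian_char N T c Y"
  shows "distr M (real_PiM T) (\<lambda>x. \<lambda>t\<in>T. X t x) = distr N (real_PiM T) (\<lambda>y. \<lambda>t\<in>T. Y t y)"
  using gaussian_charD[OF assms(1)] gaussian_charD[OF assms(2)]
  by (intro char_eq_imp_distr_eq) auto

text \<open>Different indices may be sent to the same time by \<tau>, for instance a time t that is
  itself a grid point; b collects the coefficients over each fibre.\<close>

lemma gaussian_char_reindex:
  assumes G: "gaussian_char M T c X" and S: "finite S" "\<tau> ` S \<subseteq> T"
  shows "(CLINT w|M. iexp (\<Sum>s\<in>S. a s * X (\<tau> s) w))
    = of_real (exp (- (\<Sum>s\<in>S. \<Sum>s'\<in>S. a s * a s' * c (\<tau> s) (\<tau> s')) / 2))"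
proof -
  define b where "b t = (\<Sum>s | s \<in> S \<and> \<tau> s = t. a s)" for t
  have *: "(\<Sum>s\<in>S. a s * g (\<tau> s)) = (\<Sum>t\<in>\<tau> ` S. b t * g t)" for g :: "_ \<Rightarrow> real"
    unfolding b_def sum_distrib_right
    by (subst sum.image_gen[OF S(1), of _ \<tau>]) (auto intro!: sum.cong)
  have "(\<Sum>s\<in>S. \<Sum>s'\<in>S. a s * a s' * c (\<tau> s) (\<tau> s')) = (\<Sum>s\<in>S. a s * (\<Sum>s'\<in>S. a s' * c (\<tau> s) (\<tau> s')))"
    by (simp add: sum_distrib_left mult_ac)
  also have "\<dots> = (\<Sum>s\<in>\<tau> ` S. b s * (\<Sum>t\<in>\<tau> ` S. b t * c s t))"
    unfolding *[of "\<lambda>t. c (\<tau> _) t"] by (rule *)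
  also have "\<dots> = (\<Sum>s\<in>\<tau> ` S. \<Sum>t\<in>\<tau> ` S. b s * b t * c s t)"
    by (simp add: sum_distrib_left mult_ac)
  finally have "(\<Sum>s\<in>S. \<Sum>s'\<in>S. a s * a s' * c (\<tau> s) (\<tau> s')) = (\<Sum>s\<in>\<tau> ` S. \<Sum>t\<in>\<tau> ` S. b s * b t * c s t)" .
  moreover have "(\<Sum>s\<in>S. a s * X (\<tau> s) w) = (\<Sum>t\<in>\<tau> ` S. b t * X t w)" for w
    by (rule *)
  ultimately show ?thesis
    using gaussian_charD(3)[OF G, of "\<tau> ` S" b] S by (simp only: finite_imageI)
qed

text \<open>A combination of combinations is one combination over the pairs in
  \<open>Sigma F S\<close>. Every new variable has its own index set and its own times, which covers
  increments, predictions and prediction errors alike.\<close>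

lemma gaussian_char_linear:
  assumes G: "gaussian_char M T c X"
    and S: "\<And>j. j \<in> U \<Longrightarrow> finite (S j)" "\<And>j s. j \<in> U \<Longrightarrow> s \<in> S j \<Longrightarrow> \<tau> j s \<in> T"
  shows "gaussian_char M U (\<lambda>j k. \<Sum>s\<in>S j. \<Sum>s'\<in>S k. A j s * A k s' * c (\<tau> j s) (\<tau> k s'))
     (\<lambda>j w. \<Sum>s\<in>S j. A j s * X (\<tau> j s) w)"
  unfolding gaussian_char_def
proof (intro conjI ballI allI impI)
  show "prob_space M" by (rule gaussian_charD(1)[OF G])
  show "(\<lambda>w. \<Sum>s\<in>S j. A j s * X (\<tau> j s) w) \<in> borel_measurable M" if "j \<in> U" for j
    using gaussian_charD(2)[OF G] S that by (intro borel_measurable_sum borel_measurable_times) auto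
  fix F and a :: "_ \<Rightarrow> real" assume F: "finite F" "F \<subseteq> U"
  have fin: "\<forall>j\<in>F. finite (S j)" using F S by auto
  have sg: "(\<Sum>p\<in>Sigma F S. f p) = (\<Sum>j\<in>F. \<Sum>s\<in>S j. f (j, s))" for f :: "_ \<Rightarrow> real"
    using sum.Sigma[OF F(1) fin, of "\<lambda>j s. f (j, s)"] by simp
  have 1: "(\<Sum>j\<in>F. a j * (\<Sum>s\<in>S j. A j s * X (\<tau> j s) w)) = (\<Sum>p\<in>Sigma F S. (a (fst p) * A (fst p) (snd p)) * X (\<tau> (fst p) (snd p)) w)" for w
    by (simp only: sg fst_conv snd_conv sum_distrib_left mult.assoc)
  have "(\<Sum>p\<in>Sigma F S. \<Sum>q\<in>Sigma F S. (a (fst p) * A (fst p) (snd p)) * (a (fst q) * A (fst q) (snd q)) * c (\<tau> (fst p) (snd p)) (\<tau> (fst q) (snd q)))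
     = (\<Sum>j\<in>F. \<Sum>s\<in>S j. \<Sum>k\<in>F. \<Sum>s'\<in>S k. (a j * A j s) * (a k * A k s') * c (\<tau> j s) (\<tau> k s'))"
    by (simp only: sg fst_conv snd_conv)
  also have "\<dots> = (\<Sum>j\<in>F. \<Sum>k\<in>F. a j * a k * (\<Sum>s\<in>S j. \<Sum>s'\<in>S k. A j s * A k s' * c (\<tau> j s) (\<tau> k s')))"
    unfolding sum_distrib_left by (intro sum.cong refl, subst sum.swap, intro sum.cong refl) (simp add: mult_ac)
  finally have 2: "(\<Sum>p\<in>Sigma F S. \<Sum>q\<in>Sigma F S. (a (fst p) * A (fst p) (snd p)) * (a (fst q) * A (fst q) (snd q)) * c (\<tau> (fst p) (snd p)) (\<tau> (fst q) (snd q)))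
     = (\<Sum>j\<in>F. \<Sum>k\<in>F. a j * a k * (\<Sum>s\<in>S j. \<Sum>s'\<in>S k. A j s * A k s' * c (\<tau> j s) (\<tau> k s')))" .
  show "(CLINT w|M. iexp (\<Sum>j\<in>F. a j * (\<Sum>s\<in>S j. A j s * X (\<tau> j s) w)))
    = of_real (exp (- (\<Sum>j\<in>F. \<Sum>k\<in>F. a j * a k * (\<Sum>s\<in>S j. \<Sum>s'\<in>S k. A j s * A k s' * c (\<tau> j s) (\<tau> k s'))) / 2))"
    unfolding 1 2[symmetric]
  proof (rule gaussian_char_reindex[OF G])
    show "finite (Sigma F S)" using F fin by auto
    show "(\<lambda>p. \<tau> (fst p) (snd p)) ` Sigma F S \<subseteq> T" using F S by auto
  qed
qed

lemma gaussian_char_cov_cong: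
  assumes "gaussian_char M T c X" "\<And>s t. s \<in> T \<Longrightarrow> t \<in> T \<Longrightarrow> c s t = d s t"
    and "\<And>t w. t \<in> T \<Longrightarrow> X t w = Y t w"
  shows "gaussian_char M T d Y"
proof -
  have X: "X t = Y t" if "t \<in> T" for t using assms(3)[OF that] by auto
  have 1: "(\<Sum>t\<in>F. a t * X t w) = (\<Sum>t\<in>F. a t * Y t w)" if "F \<subseteq> T" for F a w
    using that assms(3) by (intro sum.cong) auto
  have 2: "(\<Sum>s\<in>F. \<Sum>t\<in>F. a s * a t * c s t) = (\<Sum>s\<in>F. \<Sum>t\<in>F. a s * a t * d s t)" if "F \<subseteq> T" for F a
    using that assms(2) by (intro sum.cong refl) auto
  show ?thesis using assms(1) X unfolding gaussian_char_def by (simp add: 1[symmetric] 2[symmetric])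
qed

lemma gaussian_char_add_indep:
  fixes X :: "'t \<Rightarrow> 'a \<Rightarrow> real" and Y :: "'t \<Rightarrow> 'b \<Rightarrow> real"
  assumes X: "gaussian_char M T c X" and Y: "gaussian_char N T d Y"
  shows "gaussian_char (M \<Otimes>\<^sub>M N) T (\<lambda>s t. c s t + d s t) (\<lambda>t w. X t (fst w) + Y t (snd w))"
proof -
  interpret M: prob_space M using gaussian_charD[OF X] by simp
  interpret N: prob_space N using gaussian_charD[OF Y] by simp
  interpret P: pair_prob_space M N ..
  have mX[measurable]: "t \<in> T \<Longrightarrow> X t \<in> borel_measurable M" and mY[measurable]: "t \<in> T \<Longrightarrow> Y t \<in> borel_measurable N" for t
    using gaussian_charD(2)[OF X] gaussian_charD(2)[OF Y] by auto
  show ?thesis unfolding gaussian_char_def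
  proof (intro conjI ballI allI impI)
    show "prob_space (M \<Otimes>\<^sub>M N)" by unfold_locales
    show "(\<lambda>w. X t (fst w) + Y t (snd w)) \<in> borel_measurable (M \<Otimes>\<^sub>M N)" if "t \<in> T" for t
      using that by measurable
    fix F and a :: "'t \<Rightarrow> real" assume F: "finite F" "F \<subseteq> T"
    define x where "x w = (\<Sum>t\<in>F. a t * X t w)" for w
    define y where "y w = (\<Sum>t\<in>F. a t * Y t w)" for w
    have [measurable]: "x \<in> borel_measurable M" unfolding x_def using F
      by (intro borel_measurable_sum borel_measurable_times mX) auto
    have [measurable]: "y \<in> borel_measurable N" unfolding y_def using F
      by (intro borel_measurable_sum borel_measurable_times mY) auto
    have xy: "(\<Sum>t\<in>F. a t * (X t (fst w) + Y t (snd w))) = x (fst w) + y (snd w)" for w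
      by (simp add: x_def y_def sum.distrib distrib_left)
    have "(CLINT w|M \<Otimes>\<^sub>M N. iexp (x (fst w) + y (snd w))) = (CLINT w|M. CLINT w'|N. iexp (x w + y w'))"
      by (subst P.integral_fst'[symmetric]) (auto intro!: P.P.integrable_const_bound[of _ 1])
    also have "\<dots> = (CLINT w|M. CLINT w'|N. iexp (x w) * iexp (y w'))"
      by (simp add: exp_add distrib_left)
    also have "\<dots> = (CLINT w|M. iexp (x w)) * (CLINT w'|N. iexp (y w'))" by simp
    also have "\<dots> = of_real (exp (- (\<Sum>s\<in>F. \<Sum>t\<in>F. a s * a t * (c s t + d s t)) / 2))"
      unfolding x_def y_def gaussian_charD(3)[OF X F] gaussian_charD(3)[OF Y F]
      by (simp add: sum.distrib distrib_left exp_add[symmetric] add_divide_distrib flip: of_real_mult)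
    finally show "(CLINT w|M \<Otimes>\<^sub>M N. iexp (\<Sum>t\<in>F. a t * (X t (fst w) + Y t (snd w))))
      = of_real (exp (- (\<Sum>s\<in>F. \<Sum>t\<in>F. a s * a t * (c s t + d s t)) / 2))" unfolding xy .
  qed
qed

text \<open>A process of rank one: the direction that is removed from a Gaussian vector is put back
  in this form, driven by a single standard normal variable.\<close>

lemma gaussian_char_std_normal:
  fixes h :: "'t \<Rightarrow> real"
  shows "gaussian_char std_normal_distribution T (\<lambda>s t. h s * h t) (\<lambda>t u. h t * u)"
  unfolding gaussian_char_def
proof (intro conjI ballI allI impI)
  show "prob_space std_normal_distribution" using real_dist_normal_dist real_distribution_def by blast
  fix F :: "'t set" and a :: "'t \<Rightarrow> real" assume F: "finite F"
  have "(CLINT u|std_normal_distribution. iexp (\<Sum>t\<in>F. a t * (h t * u)))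
      = char std_normal_distribution (\<Sum>t\<in>F. a t * h t)"
    by (simp only: char_def sum_distrib_right mult.assoc)
  also have "\<dots> = of_real (exp (- (\<Sum>s\<in>F. \<Sum>t\<in>F. a s * a t * (h s * h t)) / 2))"
    unfolding char_std_normal_distribution power2_eq_square sum_product by (simp add: mult_ac)
  finally show "(CLINT u|std_normal_distribution. iexp (\<Sum>t\<in>F. a t * (h t * u)))
      = of_real (exp (- (\<Sum>s\<in>F. \<Sum>t\<in>F. a s * a t * (h s * h t)) / 2))" .
qed simp

section \<open>The Borel sets of the continuous functions\<close>

lemma mdist_C01_le:
  assumes "f \<in> mspace C01" "g \<in> mspace C01"
  shows "mdist C01 f g \<le> r \<longleftrightarrow> (\<forall>t\<in>{0..1}. \<bar>f t - g t\<bar> \<le> r)"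
  using cfunspace_mdist_le[of f "top_of_set {0..1::real}" euclidean_metric g r] assms
  by (simp add: C01_def dist_real_def)

text \<open>Closed balls are used because a bound on the distance by r is directly a bound at every
  t; halving the radius passes between open and closed balls.\<close>

lemma openin_C01:
  "openin (mtopology_of C01) U \<longleftrightarrow> U \<subseteq> mspace C01 \<and>
     (\<forall>f\<in>U. \<exists>r>0. \<forall>g\<in>mspace C01. (\<forall>t\<in>{0..1}. \<bar>f t - g t\<bar> \<le> r) \<longrightarrow> g \<in> U)"
proof -
  interpret Metric_space "mspace C01" "mdist C01" by simp
  have *: "(\<exists>r>0. mball f r \<subseteq> U) \<longleftrightarrow> (\<exists>r>0. \<forall>g\<in>mspace C01. (\<forall>t\<in>{0..1}. \<bar>f t - g t\<bar> \<le> r) \<longrightarrow> g \<in> U)"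
    if f: "f \<in> mspace C01" for f
  proof safe
    fix r :: real assume r: "r > 0" "mball f r \<subseteq> U"
    have "g \<in> U" if g: "g \<in> mspace C01" "\<forall>t\<in>{0..1}. \<bar>f t - g t\<bar> \<le> r / 2" for g
    proof -
      have "mdist C01 f g \<le> r / 2" using mdist_C01_le[OF f g(1)] g(2) by blast
      then have "g \<in> mball f r" using r f g by (simp add: in_mball)
      then show ?thesis using r by blast
    qed
    then show "\<exists>r>0. \<forall>g\<in>mspace C01. (\<forall>t\<in>{0..1}. \<bar>f t - g t\<bar> \<le> r) \<longrightarrow> g \<in> U"
      using r by (intro exI[of _ "r / 2"]) auto
  next
    fix r :: real assume r: "r > 0" "\<forall>g\<in>mspace C01. (\<forall>t\<in>{0..1}. \<bar>f t - g t\<bar> \<le> r) \<longrightarrow> g \<in> U"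
    have "mball f r \<subseteq> U"
    proof
      fix g assume "g \<in> mball f r"
      then have g: "g \<in> mspace C01" "mdist C01 f g \<le> r" by (auto simp: in_mball)
      then show "g \<in> U" using r(2) mdist_C01_le[OF f g(1), of r] by blast
    qed
    then show "\<exists>r>0. mball f r \<subseteq> U" using r by blast
  qed
  show ?thesis
    unfolding mtopology_of_def openin_mtopology
    by (rule conj_cong[OF refl], unfold Ball_def, rule all_cong1, rule imp_cong[OF refl], rule *[unfolded Ball_def], blast)
qed

lemma measurable_eval_C01 [measurable]:
  assumes t: "t \<in> {0..1}"
  shows "(\<lambda>f. f t) \<in> borel_measurable borel_C01"
proof (rule borel_measurableI)
  have open_subset: "{U. openin (mtopology_of C01) U} \<subseteq> Pow (mspace C01)"
    unfolding openin_C01 by blast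
  fix V :: "real set" assume V: "open V"
  have "openin (mtopology_of C01) ((\<lambda>f. f t) -` V \<inter> mspace C01)"
    unfolding openin_C01
  proof (intro conjI ballI)
    fix f assume f: "f \<in> (\<lambda>f. f t) -` V \<inter> mspace C01"
    then obtain e where e: "e > 0" "\<And>y. dist y (f t) < e \<Longrightarrow> y \<in> V"
      using V unfolding open_dist by blast
    show "\<exists>r>0. \<forall>g\<in>mspace C01. (\<forall>t\<in>{0..1}. \<bar>f t - g t\<bar> \<le> r) \<longrightarrow> g \<in> (\<lambda>f. f t) -` V \<inter> mspace C01"
    proof (intro exI[of _ "e / 2"] conjI ballI impI)
      fix g assume g: "g \<in> mspace C01" "\<forall>t\<in>{0..1}. \<bar>f t - g t\<bar> \<le> e / 2"
      have "\<bar>f t - g t\<bar> \<le> e / 2" using g(2) t by blast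
      then have "dist (g t) (f t) < e" using e(1) unfolding dist_real_def by linarith
      then show "g \<in> (\<lambda>f. f t) -` V \<inter> mspace C01" using e(2) g(1) by blast
    qed (use e in auto)
  qed auto
  then show "(\<lambda>f. f t) -` V \<inter> space borel_C01 \<in> sets borel_C01"
    using sigma_sets.Basic[of _ "{U. openin (mtopology_of C01) U}" "mspace C01"] open_subset
    by (simp add: borel_C01_def space_measure_of_conv sets_measure_of_conv)
qed

section \<open>A countable dense set of paths and the sigma-algebra of evaluations\<close>

definition bernstein_rat :: "nat \<Rightarrow> rat list \<Rightarrow> real \<Rightarrow> real" where
  "bernstein_rat n q = (\<lambda>t\<in>{0..1}. \<Sum>k\<le>n. of_rat (q ! k) * Bernstein n k t)"

lemma bernstein_rat_in_C01: "bernstein_rat n q \<in> mspace C01"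
proof -
  have "continuous_on {0..1} (\<lambda>t. \<Sum>k\<le>n. of_rat (q ! k) * Bernstein n k t)"
    unfolding Bernstein_def by (intro continuous_intros)
  then have "continuous_on {0..1} (bernstein_rat n q)"
    by (rule continuous_on_eq) (simp add: bernstein_rat_def)
  then show ?thesis by (simp add: mspace_C01 bernstein_rat_def)
qed

text \<open>One half of e is spent on Bernstein's approximation, the other on rounding its
  coefficients to rationals; Bernstein polynomials are nonnegative and sum to 1, so rounding errors
  are averaged and not added up. Degree and coefficient list form a countable type.\<close>

lemma bernstein_rat_dense:
  assumes f: "f \<in> mspace C01" and e: "0 < e"
  obtains n q where "\<forall>t\<in>{0..1}. \<bar>f t - bernstein_rat n q t\<bar> \<le> e"
proof -
  have "continuous_on {0..1} f" using f by (simp add: mspace_C01)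
  from Bernstein_Weierstrass[OF this half_gt_zero[OF e]]
  obtain n where n: "\<And>x. x \<in> {0..1} \<Longrightarrow> \<bar>f x - (\<Sum>k\<le>n. f (k/n) * Bernstein n k x)\<bar> < e / 2"
    by blast
  have "\<exists>r::rat. \<bar>f (k/n) - of_rat r\<bar> \<le> e / 2" for k :: nat
  proof -
    obtain r where "f (k/n) < of_rat r" "of_rat r < f (k/n) + e / 2"
      using of_rat_dense[of "f (k/n)" "f (k/n) + e/2"] e by auto
    then show ?thesis by (intro exI[of _ r]) auto
  qed
  then obtain r where r: "\<And>k::nat. \<bar>f (k/n) - of_rat (r k :: rat)\<bar> \<le> e / 2" by metis
  have "\<bar>f t - bernstein_rat n (map r [0..<Suc n]) t\<bar> \<le> e" if t: "t \<in> {0..1}" for t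
  proof -
    have "bernstein_rat n (map r [0..<Suc n]) t = (\<Sum>k\<le>n. of_rat (r k) * Bernstein n k t)"
      unfolding bernstein_rat_def using t by (auto intro!: sum.cong simp del: upt_Suc)
    then have "\<bar>(\<Sum>k\<le>n. f (k/n) * Bernstein n k t) - bernstein_rat n (map r [0..<Suc n]) t\<bar>
      = \<bar>\<Sum>k\<le>n. (f (k/n) - of_rat (r k)) * Bernstein n k t\<bar>"
      by (simp add: sum_subtractf left_diff_distrib)
    also have "\<dots> \<le> (\<Sum>k\<le>n. \<bar>(f (k/n) - of_rat (r k)) * Bernstein n k t\<bar>)" by (rule sum_abs)
    also have "\<dots> \<le> (\<Sum>k\<le>n. e / 2 * Bernstein n k t)"
    proof (rule sum_mono)
      fix k
      have B: "0 \<le> Bernstein n k t" using t by (intro Bernstein_nonneg) auto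
      show "\<bar>(f (k/n) - of_rat (r k)) * Bernstein n k t\<bar> \<le> e / 2 * Bernstein n k t"
        using mult_right_mono[OF r[of k] B] B by (simp add: abs_mult)
    qed
    also have "\<dots> = e / 2" by (simp only: sum_distrib_left[symmetric] sum_Bernstein mult_1_right)
    finally show ?thesis using n[OF t] by linarith
  qed
  then show thesis using that by blast
qed

text \<open>Continuity and density of the rationals. It makes a closed ball a countable intersection
  of conditions on single evaluations.\<close>

lemma rational_sup_C01:
  assumes "f \<in> mspace C01" "g \<in> mspace C01"
  shows "(\<forall>t\<in>{0<..<1} \<inter> \<rat>. \<bar>f t - g t\<bar> \<le> r) \<longleftrightarrow> (\<forall>t\<in>{0..1}. \<bar>f t - g t\<bar> \<le> r)"
proof
  have cl: "closure ({0<..<1} \<inter> \<rat>) = {0..1::real}"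
    by (subst closure_open_Int_superset) (auto simp: Rats_closure_real)
  assume "\<forall>t\<in>{0<..<1} \<inter> \<rat>. \<bar>f t - g t\<bar> \<le> r"
  moreover have "continuous_on {0..1} (\<lambda>t. \<bar>f t - g t\<bar>)"
    using assms by (auto simp: mspace_C01 intro!: continuous_intros)
  ultimately show "\<forall>t\<in>{0..1}. \<bar>f t - g t\<bar> \<le> r"
    using continuous_le_on_closure[of "{0<..<1} \<inter> \<rat>" "\<lambda>t. \<bar>f t - g t\<bar>" _ r] unfolding cl by blast
qed auto

text \<open>Open sets are countable unions of balls with rational radius around the polynomials
  \<open>bernstein_rat\<close>, and these balls are measurable for the evaluations; conversely
  evaluations are continuous. Total variation bounds proved in the product space thereby carry over
  to path space.\<close>

lemma sets_borel_C01:
  "sets borel_C01 = sets (restrict_space (real_PiM {0..1}) (mspace C01))"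
proof
  let ?R = "restrict_space (real_PiM {0..1}) (mspace C01) :: (real \<Rightarrow> real) measure"
  have sp: "mspace C01 \<subseteq> space (real_PiM {0..1})"
    by (auto simp: mspace_C01 space_PiM PiE_def)
  then have spR: "space ?R = mspace C01" by (auto simp: space_restrict_space)
  have ball: "{f \<in> mspace C01. \<forall>t\<in>{0..1}. \<bar>f t - p t\<bar> \<le> r} \<in> sets ?R" if p: "p \<in> mspace C01" for p r
  proof -
    have ev: "(\<lambda>f. f t) \<in> borel_measurable ?R" if "t \<in> {0..1}" for t
      using that by (intro measurable_restrict_space1 measurable_component_singleton)
    have "1 / 2 \<in> {0<..<1::real} \<inter> \<rat>" by simp
    then have "{f \<in> mspace C01. \<forall>t\<in>{0..1}. \<bar>f t - p t\<bar> \<le> r}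
        = (\<Inter>t\<in>{0<..<1} \<inter> \<rat>. {f \<in> space ?R. \<bar>f t - p t\<bar> \<le> r})"
      using rational_sup_C01[OF _ p] unfolding spR by blast
    also have "\<dots> \<in> sets ?R"
    proof (rule sets.countable_INT')
      show "countable ({0<..<1} \<inter> \<rat> :: real set)" by (intro countable_Int2 countable_rat)
      show "{0<..<1} \<inter> \<rat> \<noteq> ({} :: real set)" using \<open>1 / 2 \<in> _\<close> by blast
      show "(\<lambda>t. {f \<in> space ?R. \<bar>f t - p t\<bar> \<le> r}) ` ({0<..<1} \<inter> \<rat>) \<subseteq> sets ?R"
      proof safe
        fix t :: real assume "t \<in> {0<..<1}" "t \<in> \<rat>"
        then have [measurable]: "(\<lambda>f. f t) \<in> borel_measurable ?R" by (intro ev) auto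
        show "{f \<in> space ?R. \<bar>f t - p t\<bar> \<le> r} \<in> sets ?R" by measurable
      qed
    qed
    finally show ?thesis .
  qed
  have "U \<in> sets ?R" if U: "openin (mtopology_of C01) U" for U
  proof -
    define cb where "cb x = (case x of (n, q, r) \<Rightarrow> {f \<in> mspace C01. \<forall>t\<in>{0..1}. \<bar>f t - bernstein_rat n q t\<bar> \<le> of_rat r})"
      for x :: "nat \<times> rat list \<times> rat"
    have "U = (\<Union>x\<in>{x. cb x \<subseteq> U}. cb x)"
    proof
      show "U \<subseteq> (\<Union>x\<in>{x. cb x \<subseteq> U}. cb x)"
      proof
        fix f assume f: "f \<in> U"
        then have fC: "f \<in> mspace C01" using U unfolding openin_C01 by blast
        obtain e where e: "e > 0" "\<And>g. g \<in> mspace C01 \<Longrightarrow> \<forall>t\<in>{0..1}. \<bar>f t - g t\<bar> \<le> e \<Longrightarrow> g \<in> U"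
          using U f unfolding openin_C01 by blast
        \<comment> \<open>With r < e/2, a ball of radius r around a centre that is r-close to f
          contains f and stays inside the e-ball around f.\<close>
        obtain r :: rat where r: "0 < real_of_rat r" "real_of_rat r < e / 2"
          using of_rat_dense[of 0 "e / 2"] e by auto
        obtain n q where nq: "\<forall>t\<in>{0..1}. \<bar>f t - bernstein_rat n q t\<bar> \<le> of_rat r"
          using bernstein_rat_dense[OF fC r(1)] by blast
        have "cb (n, q, r) \<subseteq> U"
        proof
          fix g assume g: "g \<in> cb (n, q, r)"
          have "\<bar>f t - g t\<bar> \<le> e" if "t \<in> {0..1}" for t
          proof -
            have "\<bar>f t - bernstein_rat n q t\<bar> \<le> of_rat r" "\<bar>g t - bernstein_rat n q t\<bar> \<le> of_rat r"
              using nq g that by (auto simp: cb_def)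
            then show ?thesis using r by linarith
          qed
          then show "g \<in> U" using g by (intro e(2)) (auto simp: cb_def)
        qed
        moreover have "f \<in> cb (n, q, r)" using fC nq by (simp add: cb_def)
        ultimately show "f \<in> (\<Union>x\<in>{x. cb x \<subseteq> U}. cb x)" by blast
      qed
    qed auto
    moreover have "cb x \<in> sets ?R" for x
      unfolding cb_def by (cases x) (auto intro!: ball bernstein_rat_in_C01)
    ultimately show ?thesis by (metis (no_types, lifting) sets.countable_UN' uncountable_def countableI_type image_subset_iff)
  qed
  then have "sigma_sets (space ?R) {U. openin (mtopology_of C01) U} \<subseteq> sets ?R"
    by (intro sets.sigma_sets_subset) auto
  moreover have "{U. openin (mtopology_of C01) U} \<subseteq> Pow (mspace C01)"
    unfolding openin_C01 by blast
  ultimately show "sets borel_C01 \<subseteq> sets ?R" unfolding spR borel_C01_def by (simp add: sets_measure_of)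
  have "(\<lambda>f. \<lambda>t\<in>{0..1}. f t) \<in> borel_C01 \<rightarrow>\<^sub>M real_PiM {0..1}"
    by (intro measurable_restrict measurable_eval_C01)
  moreover have "(\<lambda>t\<in>{0..1}. f t) = f" if "f \<in> space borel_C01" for f
    using that by (simp add: space_borel_C01 extensional_restrict)
  ultimately have id: "(\<lambda>f. f) \<in> borel_C01 \<rightarrow>\<^sub>M real_PiM {0..1}"
    by (simp cong: measurable_cong)
  have space: "space borel_C01 = mspace C01" by (simp add: space_borel_C01 mspace_C01)
  show "sets ?R \<subseteq> sets borel_C01"
  proof
    fix A assume "A \<in> sets ?R"
    then obtain A' where A': "A' \<in> sets (real_PiM {0..1})" "A = mspace C01 \<inter> A'"
      by (auto simp: sets_restrict_space)
    have "(\<lambda>f. f) -` A' \<inter> space borel_C01 \<in> sets borel_C01" by (rule measurable_sets[OF id A'(1)])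
    then show "A \<in> sets borel_C01" using A'(2) space by (simp add: Int_commute)
  qed
qed

text \<open>The continuous functions are not an event of the uncountable product, so an event of
  paths is handled through some event A' of the product with the same trace.\<close>

lemma sets_borel_C01_E:
  assumes "A \<in> sets borel_C01"
  obtains A' where "A' \<in> sets (real_PiM {0..1})" "A = space borel_C01 \<inter> A'"
  using assms unfolding sets_borel_C01 by (auto simp: sets_restrict_space space_borel_C01 mspace_C01)

lemma measurable_borel_C01I:
  assumes space: "\<And>w. w \<in> space M \<Longrightarrow> g w \<in> extensional {0..1}"
    "\<And>w. w \<in> space M \<Longrightarrow> continuous_on {0..1} (g w)"
    and eval: "\<And>t. t \<in> {0..1} \<Longrightarrow> (\<lambda>w. g w t) \<in> borel_measurable M"
  shows "g \<in> M \<rightarrow>\<^sub>M borel_C01"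
proof (rule measurableI)
  show sp: "g w \<in> space borel_C01" if "w \<in> space M" for w
    using space that by (simp add: space_borel_C01)
  have "(\<lambda>w. \<lambda>t\<in>{0..1}. g w t) \<in> M \<rightarrow>\<^sub>M real_PiM {0..1}"
    by (intro measurable_restrict eval)
  moreover have "(\<lambda>t\<in>{0..1}. g w t) = g w" if "w \<in> space M" for w
    using space(1)[OF that] by (rule extensional_restrict)
  ultimately have m: "g \<in> M \<rightarrow>\<^sub>M real_PiM {0..1}"
    by (simp cong: measurable_cong)
  fix A assume "A \<in> sets borel_C01"
  then obtain A' where A': "A' \<in> sets (real_PiM {0..1})" "A = space borel_C01 \<inter> A'"
    by (rule sets_borel_C01_E)
  have "g -` A \<inter> space M = g -` A' \<inter> space M" using sp A'(2) by auto
  then show "g -` A \<inter> space M \<in> sets M" using measurable_sets[OF m A'(1)] by simp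
qed

section \<open>Gaussian shifts in total variation\<close>

text \<open>The difference is largest for the set where the original density dominates the shifted
  one, the half-line up to s/2. There it equals the probability of an interval of length s, and the
  density is at most 1.\<close>

lemma std_normal_shift_le:
  assumes s: "0 \<le> s" and A[measurable]: "A \<in> sets borel"
  shows "measure std_normal_distribution A - measure std_normal_distribution {u. u + s \<in> A} \<le> s"
proof -
  let ?\<phi> = std_normal_density
  have int: "integrable lborel (\<lambda>u. ?\<phi> (u + c) * indicator S u)" if [measurable]: "S \<in> sets borel" for c S
  proof (rule Bochner_Integration.integrable_bound)
    show "integrable lborel (\<lambda>u. ?\<phi> (u + c))"
      using lborel_integrable_real_affine[of ?\<phi> 1 c] by (simp add: add.commute)
  qed (auto simp: indicator_def)
  have meas: "measure std_normal_distribution S = (\<integral>u. ?\<phi> u * indicator S u \<partial>lborel)" if [measurable]: "S \<in> sets borel" for S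
  proof -
    have "measure std_normal_distribution S = (\<integral>u. indicator S u \<partial>std_normal_distribution)" by simp
    also have "\<dots> = (\<integral>u. ?\<phi> u * indicator S u \<partial>lborel)"
      by (subst integral_density) auto
    finally show ?thesis .
  qed
  have shift: "measure std_normal_distribution {u. u + s \<in> S} = (\<integral>u. ?\<phi> (u - s) * indicator S u \<partial>lborel)"
    if [measurable]: "S \<in> sets borel" for S
  proof -
    have "measure std_normal_distribution {u. u + s \<in> S} = (\<integral>u. ?\<phi> u * indicator {u. u + s \<in> S} u \<partial>lborel)"
      by (rule meas) measurable
    also have "\<dots> = (\<integral>u. ?\<phi> (- s + 1 * u) * indicator {u. u + s \<in> S} (- s + 1 * u) \<partial>lborel)"
      by (subst lborel_integral_real_affine[of 1 _ "- s"]) simp_all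
    also have "\<dots> = (\<integral>u. ?\<phi> (u - s) * indicator S u \<partial>lborel)"
      by (intro Bochner_Integration.integral_cong) (auto simp: indicator_def)
    finally show ?thesis .
  qed
  define L where "L = {..s/2}"
  have [measurable]: "L \<in> sets borel" by (simp add: L_def)
  have sgn: "?\<phi> (u - s) \<le> ?\<phi> u \<longleftrightarrow> u \<le> s / 2 \<or> s = 0" for u
  proof -
    have "?\<phi> (u - s) \<le> ?\<phi> u \<longleftrightarrow> 0 \<le> s * (s - 2 * u)"
      by (simp add: normal_density_def field_simps power2_eq_square)
    then show ?thesis using s by (auto simp: zero_le_mult_iff)
  qed
  have "measure std_normal_distribution A - measure std_normal_distribution {u. u + s \<in> A}
      = (\<integral>u. ?\<phi> u * indicator A u - ?\<phi> (u - s) * indicator A u \<partial>lborel)"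
    unfolding meas[OF A] shift[OF A] using int[of A 0] int[of A "- s"]
    by (subst Bochner_Integration.integral_diff) auto
  also have "\<dots> \<le> (\<integral>u. ?\<phi> u * indicator L u - ?\<phi> (u - s) * indicator L u \<partial>lborel)"
  proof (rule integral_mono)
    fix u :: real
    show "?\<phi> u * indicator A u - ?\<phi> (u - s) * indicator A u \<le> ?\<phi> u * indicator L u - ?\<phi> (u - s) * indicator L u"
      using sgn[of u] by (auto simp: indicator_def L_def)
  qed (use int[of _ 0] int[of _ "- s"] in auto)
  also have "\<dots> = measure std_normal_distribution L - measure std_normal_distribution {u. u + s \<in> L}"
    unfolding meas[OF \<open>L \<in> _\<close>] shift[OF \<open>L \<in> _\<close>] using int[of L 0] int[of L "- s"]
    by (subst Bochner_Integration.integral_diff) auto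
  also have "{u. u + s \<in> L} = {..- s/2}" by (auto simp: L_def)
  also have "measure std_normal_distribution L - measure std_normal_distribution {..- s/2}
      = (\<integral>u. ?\<phi> u * indicator L u - ?\<phi> u * indicator {..- s/2} u \<partial>lborel)"
    unfolding meas[OF \<open>L \<in> _\<close>] using meas[of "{..- s/2}"] int[of L 0] int[of "{..-s/2}" 0]
    by (subst Bochner_Integration.integral_diff) auto
  also have "\<dots> \<le> (\<integral>u. indicator {- s/2..s/2} u \<partial>lborel)"
  proof (rule integral_mono)
    have "1 \<le> sqrt (2 * pi)" using pi_gt3 by simp
    then have "?\<phi> u \<le> 1" for u
      unfolding std_normal_density_def by (intro mult_le_one) (auto simp: field_simps)
    then show "?\<phi> u * indicator L u - ?\<phi> u * indicator {..- s/2} u \<le> indicator {- s/2..s/2} u" for u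
      using s by (auto simp: indicator_def L_def)
    show "integrable lborel (indicator {- s/2..s/2} :: real \<Rightarrow> real)"
      by (rule integrable_real_indicator) (use s in simp_all)
  qed (use int[of L 0] int[of "{..-s/2}" 0] in auto)
  also have "\<dots> = s" using s by simp
  finally show ?thesis .
qed

lemma std_normal_shift_tv:
  assumes s: "0 \<le> s" and A[measurable]: "A \<in> sets borel"
  shows "\<bar>measure std_normal_distribution A - measure std_normal_distribution {u. u + s \<in> A}\<bar> \<le> s"
proof -
  interpret real_distribution std_normal_distribution by (rule real_dist_normal_dist)
  have "measure std_normal_distribution (- A) = 1 - measure std_normal_distribution A"
    using prob_compl[of A] by (simp add: Compl_eq_Diff_UNIV)
  moreover have "measure std_normal_distribution {u. u + s \<in> - A} = 1 - measure std_normal_distribution {u. u + s \<in> A}"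
  proof -
    have "{u. u + s \<in> A} \<in> events" by simp
    from prob_compl[OF this] show ?thesis by (simp add: Compl_eq_Diff_UNIV[symmetric] Collect_neg_eq)
  qed
  ultimately show ?thesis using std_normal_shift_le[OF s, of A] std_normal_shift_le[OF s, of "- A"] by simp
qed

lemma pair_measure_section:
  assumes M: "prob_space M" and N: "prob_space N" and D: "D \<in> sets (M \<Otimes>\<^sub>M N)"
  shows "integrable M (\<lambda>x. measure N (Pair x -` D))"
    and "measure (M \<Otimes>\<^sub>M N) D = (\<integral>x. measure N (Pair x -` D) \<partial>M)"
proof -
  interpret M: prob_space M by fact
  interpret N: prob_space N by fact
  interpret P: pair_prob_space M N ..
  have [measurable]: "(\<lambda>x. measure N (Pair x -` D)) \<in> borel_measurable M"
    unfolding measure_def using N.measurable_emeasure_Pair[OF D] by measurable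
  show i: "integrable M (\<lambda>x. measure N (Pair x -` D))"
    by (rule M.integrable_const_bound[of _ 1]) auto
  have "ennreal (measure (M \<Otimes>\<^sub>M N) D) = (\<integral>\<^sup>+x. ennreal (measure N (Pair x -` D)) \<partial>M)"
    using N.emeasure_pair_measure_alt[OF D] by (simp add: P.emeasure_eq_measure N.emeasure_eq_measure)
  also have "\<dots> = ennreal (\<integral>x. measure N (Pair x -` D) \<partial>M)"
    by (intro nn_integral_eq_integral i) auto
  finally show "measure (M \<Otimes>\<^sub>M N) D = (\<integral>x. measure N (Pair x -` D) \<partial>M)"
    by (simp add: Bochner_Integration.integral_nonneg)
qed

text \<open>Both products share the first factor, so a bound that holds conditionally on the first
  coordinate survives integration. The two events may differ, as needed when a shift is moved into
  the event.\<close>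

lemma pair_measure_tv:
  assumes M: "prob_space M" and N: "prob_space N" and N': "prob_space N'"
    and D: "D \<in> sets (M \<Otimes>\<^sub>M N)" and E: "E \<in> sets (M \<Otimes>\<^sub>M N')"
    and le: "\<And>x. x \<in> space M \<Longrightarrow> \<bar>measure N (Pair x -` D) - measure N' (Pair x -` E)\<bar> \<le> \<epsilon>"
  shows "\<bar>measure (M \<Otimes>\<^sub>M N) D - measure (M \<Otimes>\<^sub>M N') E\<bar> \<le> \<epsilon>"
proof -
  interpret M: prob_space M by fact
  note m = pair_measure_section[OF M N D] pair_measure_section[OF M N' E]
  have "measure (M \<Otimes>\<^sub>M N) D - measure (M \<Otimes>\<^sub>M N') E = (\<integral>x. measure N (Pair x -` D) - measure N' (Pair x -` E) \<partial>M)"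
    using m by simp
  also have "\<bar>\<dots>\<bar> \<le> (\<integral>x. \<bar>measure N (Pair x -` D) - measure N' (Pair x -` E)\<bar> \<partial>M)"
    by (rule integral_abs_bound)
  also have "\<dots> \<le> (\<integral>x. \<epsilon> \<partial>M)"
    using m le by (intro integral_mono) auto
  finally show ?thesis by (simp add: M.prob_space)
qed

text \<open>A characteristic function has modulus at most 1, so the exponent cannot be
  positive.\<close>

lemma gaussian_char_psd:
  assumes G: "gaussian_char M T c X" and F: "finite F" "F \<subseteq> T"
  shows "0 \<le> (\<Sum>s\<in>F. \<Sum>t\<in>F. a s * a t * c s t)"
proof -
  interpret prob_space M by (rule gaussian_charD(1)[OF G])
  have "norm (CLINT w|M. iexp (\<Sum>t\<in>F. a t * X t w)) \<le> (\<integral>w. norm (iexp (\<Sum>t\<in>F. a t * X t w)) \<partial>M)"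
    by (rule integral_norm_bound)
  also have "\<dots> = 1" by (simp only: norm_exp_i_times) (simp add: prob_space)
  finally show ?thesis unfolding gaussian_charD(3)[OF G F] by simp
qed

text \<open>Splitting off the direction of the Gaussian variable \<open>Z = \<Sum>t\<in>F. \<alpha> t * X t\<close>, whose covariance with
  \<open>X\<close> is \<open>h\<close>, turns the shift by \<open>h\<close> into a shift of one standard normal variable.\<close>

lemma gaussian_shift_tv_finite:
  fixes c :: "'t \<Rightarrow> 't \<Rightarrow> real"
  assumes G: "gaussian_char M F c X" and F: "finite F"
    and sym: "\<And>s t. c s t = c t s"
    and h: "\<And>t. t \<in> F \<Longrightarrow> (\<Sum>u\<in>F. \<alpha> u * c t u) = h t"
    and A: "A \<in> sets (real_PiM F)"
  shows "\<bar>process_prob M F X A - process_prob M F (\<lambda>t w. X t w + h t) A\<bar>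
    \<le> sqrt (\<Sum>t\<in>F. \<alpha> t * h t)"
proof -
  define q where "q = (\<Sum>t\<in>F. \<alpha> t * h t)"
  have q: "(\<Sum>s\<in>F. \<Sum>t\<in>F. \<alpha> s * \<alpha> t * c s t) = q"
    unfolding q_def using h by (intro sum.cong refl) (simp add: sum_distrib_left[symmetric] mult.assoc)
  have q0: "0 \<le> q" using gaussian_char_psd[OF G F, of \<alpha>] q by simp
  interpret M: prob_space M by (rule gaussian_charD(1)[OF G])
  show ?thesis
  proof (cases "q = 0")
    case True
    \<comment> \<open>If Z has variance 0 it is uncorrelated with everything, so h vanishes and
      there is no shift. The argument perturbs \<alpha> by r times the unit vector of t.\<close>
    have "h t = 0" if t: "t \<in> F" for t
    proof (rule psd_null_orthogonal)
      fix r :: real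
      define b where "b = (\<lambda>u. \<alpha> u + r * (if u = t then 1 else 0))"
      have e: "(\<Sum>u\<in>F. b u * g u) = (\<Sum>u\<in>F. \<alpha> u * g u) + r * g t" for g
      proof -
        have "(\<Sum>u\<in>F. r * (if u = t then 1 else 0) * g u) = (\<Sum>u\<in>F. if u = t then r * g u else 0)"
          by (intro sum.cong) auto
        then show ?thesis using F t by (simp add: b_def distrib_right sum.distrib)
      qed
      have "(\<Sum>s\<in>F. \<Sum>u\<in>F. b s * b u * c s u) = (\<Sum>s\<in>F. b s * (\<Sum>u\<in>F. b u * c s u))"
        by (simp add: sum_distrib_left mult_ac)
      also have "\<dots> = (\<Sum>s\<in>F. b s * (h s + r * c s t))"
        using h by (intro sum.cong refl arg_cong[of _ _ "\<lambda>z. _ * z"]) (simp add: e)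
      also have "\<dots> = (\<Sum>u\<in>F. \<alpha> u * (h u + r * c u t)) + r * (h t + r * c t t)" by (rule e)
      also have "(\<Sum>u\<in>F. \<alpha> u * (h u + r * c u t)) = q + r * (\<Sum>u\<in>F. \<alpha> u * c t u)"
        unfolding q_def sum_distrib_left sum.distrib[symmetric]
        by (intro sum.cong refl) (simp add: sym[of _ t] algebra_simps)
      finally have "(\<Sum>s\<in>F. \<Sum>u\<in>F. b s * b u * c s u) = q + 2 * r * h t + r\<^sup>2 * c t t"
        using h[OF t] by (simp add: power2_eq_square algebra_simps)
      then show "0 \<le> q + 2 * r * h t + r\<^sup>2 * c t t" using gaussian_char_psd[OF G F, of b] by simp
    qed (rule True)
    then have "(\<lambda>t\<in>F. X t w + h t) = (\<lambda>t\<in>F. X t w)" for w by auto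
    then show ?thesis using q0 by (simp add: q_def)
  next
    case False
    define s where "s = sqrt q"
    have s: "s > 0" "s * s = q" using False q0 by (auto simp: s_def)
    have [measurable]: "X t \<in> borel_measurable M" if "t \<in> F" for t
      by (rule gaussian_charD(2)[OF G that])
    \<comment> \<open>The residual of X after regression on Z: q is the variance of Z and h t its
      covariance with X t, so the covariance drops by h t * h t' / q.\<close>
    define R where "R t w = X t w - h t / q * (\<Sum>u\<in>F. \<alpha> u * X u w)" for t w
    have Rm[measurable]: "R t \<in> borel_measurable M" if "t \<in> F" for t
      using that unfolding R_def by measurable
    have GR: "gaussian_char M F (\<lambda>t t'. c t t' - h t / s * (h t' / s)) R"
    proof (rule gaussian_char_cov_cong)
      \<comment> \<open>\<open>None\<close> stands for the variable X t itself with coefficient 1,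
        \<open>Some u\<close> for the terms of the subtracted multiple of Z.\<close>
      let ?S = "insert None (Some ` F)"
      let ?A = "\<lambda>t u. case u of None \<Rightarrow> 1 | Some u \<Rightarrow> - (h t / q * \<alpha> u)"
      let ?\<tau> = "\<lambda>t u. case u of None \<Rightarrow> t | Some u \<Rightarrow> u"
      show "gaussian_char M F (\<lambda>j k. \<Sum>u\<in>?S. \<Sum>v\<in>?S. ?A j u * ?A k v * c (?\<tau> j u) (?\<tau> k v))
          (\<lambda>j w. \<Sum>u\<in>?S. ?A j u * X (?\<tau> j u) w)"
        using F by (intro gaussian_char_linear[OF G]) auto
      have sp: "(\<Sum>u\<in>?S. f u) = f None + (\<Sum>u\<in>F. f (Some u))" for f :: "'t option \<Rightarrow> real"
        using F by (subst sum.insert) (auto simp: sum.reindex)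
      show "(\<Sum>u\<in>?S. ?A t u * X (?\<tau> t u) w) = R t w" for t w
        unfolding sp R_def by (simp add: sum_negf sum_distrib_left mult.assoc)
      fix t t' assume t: "t \<in> F" "t' \<in> F"
      have e1: "h t / s * (h t' / s) = h t * h t' / q" by (simp add: s(2)[symmetric])
      have a: "(\<Sum>v\<in>F. - (h t' / q * \<alpha> v) * c z v) = - (h t' / q * h z)" if "z \<in> F" for z
        unfolding h[OF that, symmetric] by (simp add: sum_negf sum_distrib_left mult.assoc)
      have "(\<Sum>u\<in>?S. \<Sum>v\<in>?S. ?A t u * ?A t' v * c (?\<tau> t u) (?\<tau> t' v))
        = (\<Sum>u\<in>?S. ?A t u * (\<Sum>v\<in>?S. ?A t' v * c (?\<tau> t u) (?\<tau> t' v)))"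
        by (simp add: sum_distrib_left mult.assoc)
      also have "\<dots> = (\<Sum>u\<in>?S. ?A t u * (c (?\<tau> t u) t' + - (h t' / q * h (?\<tau> t u))))"
        using a t by (intro sum.cong refl arg_cong[of _ _ "\<lambda>x. _ * x"]) (auto simp: sp)
      also have "\<dots> = c t t' - h t' / q * h t + (\<Sum>u\<in>F. - (h t / q * \<alpha> u) * (c u t' + - (h t' / q * h u)))"
        by (simp add: sp)
      also have "(\<Sum>u\<in>F. - (h t / q * \<alpha> u) * (c u t' + - (h t' / q * h u)))
          = - (h t / q) * (\<Sum>u\<in>F. \<alpha> u * c t' u) + h t / q * (h t' / q) * q"
      proof -
        have "(\<Sum>u\<in>F. - (h t / q * \<alpha> u) * (c u t' + - (h t' / q * h u)))
            = (\<Sum>u\<in>F. - (h t / q) * (\<alpha> u * c t' u) + h t / q * (h t' / q) * (\<alpha> u * h u))"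
          by (intro sum.cong refl) (simp add: sym[of _ t'] algebra_simps)
        then show ?thesis unfolding sum.distrib sum_distrib_left[symmetric] q_def[symmetric] .
      qed
      also have "(\<Sum>u\<in>F. \<alpha> u * c t' u) = h t'" using h t by simp
      also have e2: "h t / q * (h t' / q) * q = h t * h t' / q" using False by simp
      finally show "(\<Sum>u\<in>?S. \<Sum>v\<in>?S. ?A t u * ?A t' v * c (?\<tau> t u) (?\<tau> t' v))
          = c t t' - h t / s * (h t' / s)"
        unfolding e1 by simp
    qed
    \<comment> \<open>A copy of X in law: the removed part is replaced by an independent one. Adding
      h to Y means moving the standard normal variable by s, the standard deviation of Z.\<close>
    define Y where "Y t p = R t (fst p) + h t / s * snd p" for t and p :: "'a \<times> real"
    let ?P = "M \<Otimes>\<^sub>M std_normal_distribution"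
    have N: "prob_space std_normal_distribution" using real_dist_normal_dist real_distribution_def by blast
    have GY: "gaussian_char ?P F c Y"
      using gaussian_char_add_indep[OF GR gaussian_char_std_normal[of F "\<lambda>t. h t / s"]]
      by (rule gaussian_char_cov_cong) (auto simp: Y_def)
    let ?B = "real_PiM F"
    have mX[measurable]: "(\<lambda>w. \<lambda>t\<in>F. X t w) \<in> M \<rightarrow>\<^sub>M ?B" by (intro measurable_restrict gaussian_charD(2)[OF G])
    have mY[measurable]: "(\<lambda>w. \<lambda>t\<in>F. Y t w) \<in> ?P \<rightarrow>\<^sub>M ?B" by (intro measurable_restrict gaussian_charD(2)[OF GY])
    have eq: "process_prob M F X S = process_prob ?P F Y S"
      if S: "S \<in> sets ?B" for S
      using arg_cong[OF gaussian_char_distr_eq[OF G GY], of "\<lambda>D. measure D S"] S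
      by (simp add: measure_distr_Collect)
    define S where "S = {x \<in> space ?B. (\<lambda>t\<in>F. x t + h t) \<in> A}"
    have sh: "(\<lambda>x. \<lambda>t\<in>F. x t + h t) \<in> ?B \<rightarrow>\<^sub>M ?B" by measurable
    have S: "S \<in> sets ?B" unfolding S_def by (rule measurable_sets_Collect[OF sh A])
    have spB: "(\<lambda>t\<in>F. x t) \<in> space ?B" for x by (simp add: space_PiM)
    have iS: "(\<lambda>t\<in>F. x t) \<in> S \<longleftrightarrow> (\<lambda>t\<in>F. x t + h t) \<in> A" for x
      using spB[of x] unfolding S_def by (simp cong: restrict_cong)
    have Ysh: "(\<lambda>t\<in>F. Y t (w, u) + h t) = (\<lambda>t\<in>F. Y t (w, u + s))" for w u
      using s by (auto simp: Y_def field_simps)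
    have "\<bar>process_prob ?P F Y A - process_prob ?P F Y S\<bar> \<le> s"
    proof (rule pair_measure_tv[OF M.prob_space_axioms N N])
      show D: "{p\<in>space ?P. (\<lambda>t\<in>F. Y t p) \<in> A} \<in> sets ?P" "{p\<in>space ?P. (\<lambda>t\<in>F. Y t p) \<in> S} \<in> sets ?P"
        by (rule measurable_sets_Collect[OF mY A], rule measurable_sets_Collect[OF mY S])
      fix w assume w: "w \<in> space M"
      define C where "C = {u. (\<lambda>t\<in>F. Y t (w, u)) \<in> A}"
      have C1: "Pair w -` {p\<in>space ?P. (\<lambda>t\<in>F. Y t p) \<in> A} = C"
        using w by (auto simp: C_def space_pair_measure)
      have C2: "Pair w -` {p\<in>space ?P. (\<lambda>t\<in>F. Y t p) \<in> S} = {u. u + s \<in> C}"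
        using w by (auto simp: C_def space_pair_measure iS Ysh)
      have "C \<in> sets borel" using sets_Pair1[OF D(1), of w] unfolding C1 by simp
      then show "\<bar>measure std_normal_distribution (Pair w -` {p\<in>space ?P. (\<lambda>t\<in>F. Y t p) \<in> A})
          - measure std_normal_distribution (Pair w -` {p\<in>space ?P. (\<lambda>t\<in>F. Y t p) \<in> S})\<bar> \<le> s"
        unfolding C1 C2 using s by (intro std_normal_shift_tv) auto
    qed
    then show ?thesis using eq[OF A] eq[OF S] unfolding iS s_def q_def by simp
  qed
qed


section \<open>Approximation of events by finite-dimensional cylinders\<close>

definition cylinder_sets :: "'t set \<Rightarrow> ('t \<Rightarrow> real) set set" where
  "cylinder_sets T = {prod_emb T (\<lambda>_. borel) F A |F A. finite F \<and> F \<subseteq> T \<and> A \<in> sets (real_PiM F)}"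

lemma cylinder_sets_sets: "cylinder_sets T \<subseteq> sets (real_PiM T)"
  unfolding cylinder_sets_def by (auto intro!: measurable_prod_emb)

lemma cylinder_sets_compl:
  assumes "C \<in> cylinder_sets T"
  shows "space (real_PiM T) - C \<in> cylinder_sets T"
proof -
  obtain F A where FA: "C = prod_emb T (\<lambda>_. borel) F A" "finite F" "F \<subseteq> T" "A \<in> sets (real_PiM F)"
    using assms unfolding cylinder_sets_def by blast
  have "space (real_PiM T) - C = prod_emb T (\<lambda>_. borel) F (space (real_PiM F) - A)"
    unfolding FA(1) prod_emb_def using FA(3) by (auto simp: space_PiM PiE_def)
  then show ?thesis unfolding cylinder_sets_def using FA by blast
qed

lemma cylinder_sets_Un:
  assumes "C \<in> cylinder_sets T" "D \<in> cylinder_sets T"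
  shows "C \<union> D \<in> cylinder_sets T"
proof -
  obtain F A where FA: "C = prod_emb T (\<lambda>_. borel) F A" "finite F" "F \<subseteq> T" "A \<in> sets (real_PiM F)"
    using assms(1) unfolding cylinder_sets_def by blast
  obtain G B where GB: "D = prod_emb T (\<lambda>_. borel) G B" "finite G" "G \<subseteq> T" "B \<in> sets (real_PiM G)"
    using assms(2) unfolding cylinder_sets_def by blast
  let ?A = "prod_emb (F \<union> G) (\<lambda>_. borel) F A" and ?B = "prod_emb (F \<union> G) (\<lambda>_. borel) G B"
  have "C \<union> D = prod_emb T (\<lambda>_. borel) (F \<union> G) (?A \<union> ?B)"
    unfolding FA(1) GB(1) using FA GB by (simp add: prod_emb_trans)
  moreover have "?A \<union> ?B \<in> sets (real_PiM (F \<union> G))"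
    using FA GB by (intro sets.Un measurable_prod_emb) auto
  ultimately show ?thesis unfolding cylinder_sets_def using FA GB by blast
qed

lemma cylinder_sets_empty: "{} \<in> cylinder_sets T"
  unfolding cylinder_sets_def by (intro CollectI exI[of _ "{}"]) (auto simp: prod_emb_def)

lemma cylinder_sets_finite_UN:
  fixes n :: nat
  assumes "\<And>i. C i \<in> cylinder_sets T"
  shows "(\<Union>i<n. C i) \<in> cylinder_sets T"
  by (induction n) (auto simp: lessThan_Suc cylinder_sets_empty intro!: cylinder_sets_Un assms)

lemma measure_UN_tail:
  fixes A :: "nat \<Rightarrow> 'a set"
  assumes M: "finite_measure M" and A: "range A \<subseteq> sets M"
  shows "(\<lambda>n. measure M ((\<Union>i. A i) - (\<Union>i<n. A i))) \<longlonglongrightarrow> 0"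
proof -
  interpret finite_measure M by fact
  have m: "(\<Union>i. A i) \<in> sets M" "\<And>n. (\<Union>i<n. A i) \<in> sets M" using A by auto
  have "(\<lambda>n. measure M (\<Union>i<n. A i)) \<longlonglongrightarrow> measure M (\<Union>n. \<Union>i<n. A i)"
    using m by (intro finite_Lim_measure_incseq) (fastforce simp: incseq_def)+
  moreover have "(\<Union>n. \<Union>i<n. A i) = (\<Union>i. A i)" by auto
  ultimately have "(\<lambda>n. measure M (\<Union>i. A i) - measure M (\<Union>i<n. A i)) \<longlonglongrightarrow> measure M (\<Union>i. A i) - measure M (\<Union>i. A i)"
    by (intro tendsto_intros) simp
  moreover have "measure M ((\<Union>i. A i) - (\<Union>i<n. A i)) = measure M (\<Union>i. A i) - measure M (\<Union>i<n. A i)" for n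
    using m by (intro finite_measure_Diff) auto
  ultimately show ?thesis by simp
qed

text \<open>Induction over the generation of the sigma-algebra, with one cylinder serving both
  measures at once. Complements keep the symmetric difference; for a countable union the tail takes
  half of the error and finitely many approximants share the rest.\<close>

lemma cylinder_approx:
  assumes M: "finite_measure M" "sets M = sets (real_PiM T)"
    and N: "finite_measure N" "sets N = sets (real_PiM T)"
    and A: "A \<in> sets (real_PiM T)" and e: "0 < e"
  shows "\<exists>C\<in>cylinder_sets T. measure M (sym_diff A C) < e \<and> measure N (sym_diff A C) < e"
proof -
  interpret M: finite_measure M by fact
  interpret N: finite_measure N by fact
  let ?B = "real_PiM T"
  have cyl: "C \<in> cylinder_sets T \<Longrightarrow> C \<in> sets ?B" for C using cylinder_sets_sets by blast
  have A': "A \<in> sigma_sets (\<Pi>\<^sub>E i\<in>T. space borel) (prod_algebra T (\<lambda>_. borel :: real measure))"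
    using A by (simp add: sets_PiM)
  have sub: "sigma_sets (\<Pi>\<^sub>E i\<in>T. space borel) (prod_algebra T (\<lambda>_. borel :: real measure)) = sets ?B"
    by (simp add: sets_PiM)
  show ?thesis using A' e
  proof (induction arbitrary: e rule: sigma_sets.induct)
    case (Basic a)
    then obtain J E where "a = prod_emb T (\<lambda>_. borel) J (Pi\<^sub>E J E)" "finite J" "J \<subseteq> T" "\<And>i. i \<in> J \<Longrightarrow> E i \<in> sets borel"
      by (auto elim!: prod_algebraE)
    then have "a \<in> cylinder_sets T" unfolding cylinder_sets_def by (blast intro: sets_PiM_I_finite)
    then show ?case using Basic by (intro bexI[of _ a]) auto
  next
    case Empty
    then show ?case using cylinder_sets_empty by (intro bexI[of _ "{}"]) auto
  next
    case (Compl a)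
    then obtain C where C: "C \<in> cylinder_sets T" "measure M (sym_diff a C) < e" "measure N (sym_diff a C) < e" by blast
    have "a \<subseteq> space ?B" "C \<subseteq> space ?B"
      using Compl.hyps cyl[OF C(1)] sub sets.sets_into_space by blast+
    then have "sym_diff ((\<Pi>\<^sub>E i\<in>T. space borel) - a) (space ?B - C) = sym_diff a C"
      by (auto simp: space_PiM)
    then show ?case using C cylinder_sets_compl[OF C(1)] by (intro bexI[of _ "space ?B - C"]) simp_all
  next
    case (Union a)
    have a: "a i \<in> sets ?B" for i using Union.hyps sub by blast
    have "eventually (\<lambda>n. measure M ((\<Union>i. a i) - (\<Union>i<n. a i)) < e / 2) sequentially"
      using measure_UN_tail[OF M(1), of a] a M(2) Union.prems by (intro order_tendstoD(2)) auto
    moreover have "eventually (\<lambda>n. measure N ((\<Union>i. a i) - (\<Union>i<n. a i)) < e / 2) sequentially"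
      using measure_UN_tail[OF N(1), of a] a N(2) Union.prems by (intro order_tendstoD(2)) auto
    ultimately have "eventually (\<lambda>n. measure M ((\<Union>i. a i) - (\<Union>i<n. a i)) < e / 2 \<and> measure N ((\<Union>i. a i) - (\<Union>i<n. a i)) < e / 2) sequentially"
      by (rule eventually_conj)
    then obtain n where n: "measure M ((\<Union>i. a i) - (\<Union>i<n. a i)) < e / 2" "measure N ((\<Union>i. a i) - (\<Union>i<n. a i)) < e / 2"
      by (auto simp: eventually_sequentially)
    \<comment> \<open>The n approximants together cost at most e/2; \<open>real n + 1\<close> keeps
      the quotient defined for n = 0.\<close>
    define d where "d = e / (2 * (real n + 1))"
    have d: "0 < d" using Union.prems by (simp add: d_def)
    have nd: "real n * d \<le> e / 2" using Union.prems by (simp add: d_def field_simps)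
    obtain C where C: "\<And>i. C i \<in> cylinder_sets T" "\<And>i. measure M (sym_diff (a i) (C i)) < d" "\<And>i. measure N (sym_diff (a i) (C i)) < d"
      using Union.IH[OF d] by metis
    define D where "D = (\<Union>i<n. C i)"
    have Dc: "D \<in> cylinder_sets T" unfolding D_def by (rule cylinder_sets_finite_UN[OF C(1)])
    have sb: "sym_diff (\<Union>i. a i) D \<subseteq> ((\<Union>i. a i) - (\<Union>i<n. a i)) \<union> (\<Union>i<n. sym_diff (a i) (C i))"
      unfolding D_def by blast
    have bound: "measure P (sym_diff (\<Union>i. a i) D) < e"
      if P: "finite_measure P" "sets P = sets ?B" and t: "measure P ((\<Union>i. a i) - (\<Union>i<n. a i)) < e / 2"
        and Cd: "\<And>i. measure P (sym_diff (a i) (C i)) < d" for P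
    proof -
      interpret P: finite_measure P by fact
      have ms: "(\<Union>i. a i) - (\<Union>i<n. a i) \<in> sets P" "sym_diff (a i) (C i) \<in> sets P" for i
        unfolding P(2) using a cyl[OF C(1)] by auto
      have "measure P (sym_diff (\<Union>i. a i) D) \<le> measure P (((\<Union>i. a i) - (\<Union>i<n. a i)) \<union> (\<Union>i<n. sym_diff (a i) (C i)))"
        using ms by (intro P.finite_measure_mono sb) auto
      also have "\<dots> \<le> measure P ((\<Union>i. a i) - (\<Union>i<n. a i)) + measure P (\<Union>i<n. sym_diff (a i) (C i))"
        using ms by (intro measure_Un_le) auto
      also have "measure P (\<Union>i<n. sym_diff (a i) (C i)) \<le> (\<Sum>i<n. measure P (sym_diff (a i) (C i)))"
        using ms by (intro P.finite_measure_subadditive_finite) auto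
      also have "\<dots> \<le> (\<Sum>i<n. d)" using Cd by (intro sum_mono less_imp_le)
      also have "\<dots> \<le> e / 2" using nd by simp
      finally show ?thesis using t by simp
    qed
    show ?case using Dc bound[OF M n(1) C(2)] bound[OF N n(2) C(3)] by blast
  qed
qed

lemma measure_sym_diff_le:
  assumes "finite_measure M" "A \<in> sets M" "C \<in> sets M"
  shows "\<bar>measure M A - measure M C\<bar> \<le> measure M (sym_diff A C)"
proof -
  interpret finite_measure M by fact
  have "measure M A \<le> measure M (C \<union> sym_diff A C)" "measure M C \<le> measure M (A \<union> sym_diff A C)"
    using assms by (auto intro!: finite_measure_mono)
  moreover have "measure M (C \<union> sym_diff A C) \<le> measure M C + measure M (sym_diff A C)"
    "measure M (A \<union> sym_diff A C) \<le> measure M A + measure M (sym_diff A C)"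
    using assms by (auto intro!: measure_Un_le)
  ultimately show ?thesis by linarith
qed

text \<open>Replacing A by a cylinder costs less than e/2 under each measure, and e is
  arbitrary.\<close>

lemma PiM_tv_from_cylinders:
  assumes M: "finite_measure M" "sets M = sets (real_PiM T)"
    and N: "finite_measure N" "sets N = sets (real_PiM T)"
    and cyl: "\<And>C. C \<in> cylinder_sets T \<Longrightarrow> \<bar>measure M C - measure N C\<bar> \<le> \<epsilon>"
    and A: "A \<in> sets (real_PiM T)"
  shows "\<bar>measure M A - measure N A\<bar> \<le> \<epsilon>"
proof (rule field_le_epsilon)
  fix e :: real assume e: "0 < e"
  then have "0 < e / 2" by simp
  from cylinder_approx[OF M N A this] obtain C where C: "C \<in> cylinder_sets T"
    "measure M (sym_diff A C) < e / 2" "measure N (sym_diff A C) < e / 2" by blast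
  have "C \<in> sets (real_PiM T)" using C(1) cylinder_sets_sets by blast
  then have "\<bar>measure M A - measure M C\<bar> \<le> measure M (sym_diff A C)" "\<bar>measure N A - measure N C\<bar> \<le> measure N (sym_diff A C)"
    using A M N by (auto intro!: measure_sym_diff_le)
  then show "\<bar>measure M A - measure N A\<bar> \<le> \<epsilon> + e" using cyl[OF C(1)] C(2,3) by linarith
qed


section \<open>Interpolation in a reproducing kernel Hilbert space and Gaussian shifts\<close>

definition kernel_comb :: "'t set \<Rightarrow> ('t \<Rightarrow> 't \<Rightarrow> real) \<Rightarrow> 't set \<Rightarrow> ('t \<Rightarrow> real) \<Rightarrow> 't \<Rightarrow> real" where
  "kernel_comb T K F a = (\<lambda>t\<in>T. \<Sum>u\<in>F. a u * K t u)"

lemma function_hilbert_spaceD: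
  assumes "function_hilbert_space T V ip"
  shows "\<And>f. f \<in> V \<Longrightarrow> f \<in> extensional T" "(\<lambda>t\<in>T. 0) \<in> V"
    "\<And>f g. f \<in> V \<Longrightarrow> g \<in> V \<Longrightarrow> (\<lambda>t\<in>T. f t + g t) \<in> V"
    "\<And>c f. f \<in> V \<Longrightarrow> (\<lambda>t\<in>T. c * f t) \<in> V"
    "\<And>f g. f \<in> V \<Longrightarrow> g \<in> V \<Longrightarrow> ip f g = ip g f"
    "\<And>f g h. f \<in> V \<Longrightarrow> g \<in> V \<Longrightarrow> h \<in> V \<Longrightarrow> ip (\<lambda>t\<in>T. f t + g t) h = ip f h + ip g h"
    "\<And>c f g. f \<in> V \<Longrightarrow> g \<in> V \<Longrightarrow> ip (\<lambda>t\<in>T. c * f t) g = c * ip f g"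
    "\<And>f. f \<in> V \<Longrightarrow> 0 \<le> ip f f" "\<And>f. f \<in> V \<Longrightarrow> ip f f = 0 \<Longrightarrow> f = (\<lambda>t\<in>T. 0)"
proof -
  note * = assms[unfolded function_hilbert_space_def, THEN conjunct1]
    assms[unfolded function_hilbert_space_def, THEN conjunct2]
  show "\<And>f. f \<in> V \<Longrightarrow> f \<in> extensional T" using *(1) by blast
  note * = *(2)[THEN conjunct1] *(2)[THEN conjunct2]
  show "(\<lambda>t\<in>T. 0) \<in> V" by (rule *(1))
  note * = *(2)[THEN conjunct1, rule_format] *(2)[THEN conjunct2]
  show "\<And>f g. f \<in> V \<Longrightarrow> g \<in> V \<Longrightarrow> (\<lambda>t\<in>T. f t + g t) \<in> V" by (rule *(1))
  note * = *(2)[THEN conjunct1, rule_format] *(2)[THEN conjunct2]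
  show "\<And>c f. f \<in> V \<Longrightarrow> (\<lambda>t\<in>T. c * f t) \<in> V" by (rule *(1))
  note * = *(2)[THEN conjunct1, rule_format] *(2)[THEN conjunct2]
  show "\<And>f g. f \<in> V \<Longrightarrow> g \<in> V \<Longrightarrow> ip f g = ip g f" by (rule *(1))
  note * = *(2)[THEN conjunct1, rule_format] *(2)[THEN conjunct2]
  show "\<And>f g h. f \<in> V \<Longrightarrow> g \<in> V \<Longrightarrow> h \<in> V \<Longrightarrow> ip (\<lambda>t\<in>T. f t + g t) h = ip f h + ip g h"
    by (rule *(1))
  note * = *(2)[THEN conjunct1, rule_format] *(2)[THEN conjunct2]
  show "\<And>c f g. f \<in> V \<Longrightarrow> g \<in> V \<Longrightarrow> ip (\<lambda>t\<in>T. c * f t) g = c * ip f g" by (rule *(1))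
  note * = *(2)[THEN conjunct1, rule_format] *(2)[THEN conjunct2]
  show "\<And>f. f \<in> V \<Longrightarrow> 0 \<le> ip f f" by (rule *(1))
  show "\<And>f. f \<in> V \<Longrightarrow> ip f f = 0 \<Longrightarrow> f = (\<lambda>t\<in>T. 0)" by (rule *(2)[THEN conjunct1, rule_format])
qed

lemma is_rkhsD:
  assumes "is_rkhs T K V ip"
  shows "function_hilbert_space T V ip" "\<And>t. t \<in> T \<Longrightarrow> (\<lambda>s\<in>T. K s t) \<in> V"
    "\<And>f t. f \<in> V \<Longrightarrow> t \<in> T \<Longrightarrow> ip f (\<lambda>s\<in>T. K s t) = f t"
  using assms unfolding is_rkhs_def by simp_all

lemma hilbert_zero_left:
  assumes "function_hilbert_space T V ip" "g \<in> V"
  shows "ip (\<lambda>t\<in>T. 0) g = 0"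
proof -
  have "(\<lambda>t\<in>T. 0 * (\<lambda>t\<in>T. 0 :: real) t) = (\<lambda>t\<in>T. 0)" by auto
  then show ?thesis
    using function_hilbert_spaceD(7)[OF assms(1) function_hilbert_spaceD(2)[OF assms(1)] assms(2), of 0] by simp
qed

lemma kernel_comb_in_rkhs:
  assumes R: "is_rkhs T K V ip" and F: "finite F" "F \<subseteq> T"
  shows "kernel_comb T K F a \<in> V" and "\<And>g. g \<in> V \<Longrightarrow> ip (kernel_comb T K F a) g = (\<Sum>u\<in>F. a u * g u)"
proof -
  note fh = is_rkhsD(1)[OF R]
  note fh' = function_hilbert_spaceD[OF fh]
  have "kernel_comb T K F a \<in> V \<and> (\<forall>g\<in>V. ip (kernel_comb T K F a) g = (\<Sum>u\<in>F. a u * g u))"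
    using F
  proof (induction F rule: finite_induct)
    case empty
    have "kernel_comb T K {} a = (\<lambda>t\<in>T. 0)" by (simp add: kernel_comb_def)
    then show ?case using fh'(2) hilbert_zero_left[OF fh] by (metis sum.empty)
  next
    case (insert u F)
    define k where "k = (\<lambda>s\<in>T. K s u)"
    have u: "u \<in> T" using insert by simp
    have k: "k \<in> V" unfolding k_def by (rule is_rkhsD(2)[OF R u])
    have kg: "ip k g = g u" if "g \<in> V" for g
      using fh'(5)[OF k that] is_rkhsD(3)[OF R that u] by (simp add: k_def)
    define k' where "k' = (\<lambda>t\<in>T. a u * k t)"
    have k': "k' \<in> V" unfolding k'_def by (rule fh'(4)[OF k])
    have k'g: "ip k' g = a u * g u" if "g \<in> V" for g
      unfolding k'_def using fh'(7)[OF k that] kg[OF that] by simp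
    have e: "kernel_comb T K (insert u F) a = (\<lambda>t\<in>T. k' t + kernel_comb T K F a t)"
      unfolding kernel_comb_def k'_def k_def using insert.hyps by (intro restrict_ext) simp
    have IH: "kernel_comb T K F a \<in> V" "\<And>g. g \<in> V \<Longrightarrow> ip (kernel_comb T K F a) g = (\<Sum>u\<in>F. a u * g u)"
      using insert by auto
    have "kernel_comb T K (insert u F) a \<in> V" unfolding e by (rule fh'(3)[OF k' IH(1)])
    moreover have "ip (kernel_comb T K (insert u F) a) g = (\<Sum>u\<in>insert u F. a u * g u)" if g: "g \<in> V" for g
    proof -
      have "ip (\<lambda>t\<in>T. k' t + kernel_comb T K F a t) g = ip k' g + ip (kernel_comb T K F a) g"
        by (rule fh'(6)[OF k' IH(1) g])
      then show ?thesis unfolding e using k'g[OF g] IH(2)[OF g] insert.hyps by simp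
    qed
    ultimately show ?case by blast
  qed
  then show "kernel_comb T K F a \<in> V" "\<And>g. g \<in> V \<Longrightarrow> ip (kernel_comb T K F a) g = (\<Sum>u\<in>F. a u * g u)"
    by blast+
qed

lemma ip_kernel_comb_self:
  assumes R: "is_rkhs T K V ip" and F: "finite F" "F \<subseteq> T"
  shows "ip (kernel_comb T K F a) (kernel_comb T K F a) = (\<Sum>s\<in>F. \<Sum>t\<in>F. a s * a t * K s t)"
proof -
  have "ip (kernel_comb T K F a) (kernel_comb T K F a) = (\<Sum>u\<in>F. a u * kernel_comb T K F a u)"
    by (rule kernel_comb_in_rkhs(2)[OF R F kernel_comb_in_rkhs(1)[OF R F]])
  also have "\<dots> = (\<Sum>s\<in>F. \<Sum>t\<in>F. a s * a t * K s t)"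
    unfolding kernel_comb_def sum_distrib_left using F(2) by (intro sum.cong refl) (auto simp: sum_distrib_left mult.assoc)
  finally show ?thesis .
qed

text \<open>An element vanishing on \<open>F\<close> is orthogonal to the kernel combinations over \<open>F\<close>.\<close>

lemma ip_vanishing_plus_comb:
  fixes a :: "'t \<Rightarrow> real"
  assumes R: "is_rkhs T K V ip" and F: "finite F" "F \<subseteq> T"
    and d: "d \<in> V" "\<And>u. u \<in> F \<Longrightarrow> d u = 0"
  defines "g \<equiv> (\<lambda>t\<in>T. d t + kernel_comb T K F a t)"
  shows "ip d d \<le> ip g g"
proof -
  note fh = function_hilbert_spaceD[OF is_rkhsD(1)[OF R]]
  define p where "p = kernel_comb T K F a"
  have p: "p \<in> V" unfolding p_def by (rule kernel_comb_in_rkhs(1)[OF R F])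
  have g: "g \<in> V" "g = (\<lambda>t\<in>T. d t + p t)" unfolding g_def p_def[symmetric] using fh(3)[OF d(1) p] by auto
  have "ip p d = (\<Sum>u\<in>F. a u * d u)" unfolding p_def by (rule kernel_comb_in_rkhs(2)[OF R F d(1)])
  then have pd: "ip p d = 0" "ip d p = 0" using d p fh(5) by auto
  have add: "ip g f = ip d f + ip p f" if "f \<in> V" for f
    unfolding g(2) by (rule fh(6)[OF d(1) p that])
  have "ip g g = ip d g + ip p g" by (rule add[OF g(1)])
  also have "\<dots> = ip g d + ip g p" using fh(5) d(1) p g(1) by simp
  also have "\<dots> = ip d d + ip p p" using add[OF d(1)] add[OF p] pd by simp
  finally show ?thesis using fh(8)[OF p] by simp
qed

text \<open>A null vector of the kernel matrix gives a kernel combination of norm 0, whose inner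
  product with h is 0; so the interpolation system is solvable. The remainder vanishes on F and is
  orthogonal to the interpolant, whose squared norm, the sum in the second claim, is therefore at
  most that of h.\<close>

lemma rkhs_interpolation:
  assumes R: "is_rkhs T K V ip" and F: "finite F" "F \<subseteq> T" and h: "h \<in> V"
    and sym: "\<And>s t. K s t = K t s"
  obtains \<alpha> where "\<And>t. t \<in> F \<Longrightarrow> (\<Sum>u\<in>F. \<alpha> u * K t u) = h t" "(\<Sum>t\<in>F. \<alpha> t * h t) \<le> ip h h"
proof -
  note fhs = is_rkhsD(1)[OF R]
  note fh = function_hilbert_spaceD[OF fhs]
  note kc = kernel_comb_in_rkhs[OF R F] and kk = ip_kernel_comb_self[OF R F]
  have "\<exists>\<alpha>. \<forall>i\<in>F. (\<Sum>j\<in>F. \<alpha> j * K i j) = h i"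
  proof (rule psd_linear_solve[OF F(1) sym])
    show "0 \<le> (\<Sum>i\<in>F. \<Sum>j\<in>F. x i * x j * K i j)" for x
      unfolding kk[symmetric] by (rule fh(8)[OF kc(1)])
    fix x assume "(\<Sum>i\<in>F. \<Sum>j\<in>F. x i * x j * K i j) = 0"
    then have "kernel_comb T K F x = (\<lambda>t\<in>T. 0)"
      unfolding kk[symmetric] by (rule fh(9)[OF kc(1)])
    then show "(\<Sum>i\<in>F. x i * h i) = 0"
      using kc(2)[OF h, of x] hilbert_zero_left[OF fhs h] by simp
  qed
  then obtain \<alpha> where a: "\<And>t. t \<in> F \<Longrightarrow> (\<Sum>u\<in>F. \<alpha> u * K t u) = h t" by blast
  define p where "p = kernel_comb T K F \<alpha>"
  have p: "p \<in> V" unfolding p_def by (rule kc)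
  have pu: "p u = h u" if "u \<in> F" for u using a that F(2) by (auto simp: p_def kernel_comb_def)
  define d where "d = (\<lambda>t\<in>T. h t + (\<lambda>t\<in>T. -1 * p t) t)"
  have d: "d \<in> V" unfolding d_def by (intro fh(3) fh(4) h p)
  have d0: "d u = 0" if "u \<in> F" for u using pu that F(2) by (auto simp: d_def)
  have "h t = (\<lambda>t\<in>T. d t + p t) t" for t
    using fh(1)[OF h] by (cases "t \<in> T") (auto simp: d_def extensional_def)
  then have hdp: "h = (\<lambda>t\<in>T. d t + p t)" by (rule ext)
  have pp: "ip p p = (\<Sum>t\<in>F. \<alpha> t * h t)" unfolding p_def kk
    using a by (simp add: sum_distrib_left[symmetric] mult.assoc)
  have pd: "ip p d = 0" unfolding p_def kc(2)[OF d] using d0 by simp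
  have add: "ip h f = ip d f + ip p f" if "f \<in> V" for f
    by (subst hdp) (rule fh(6)[OF d p that])
  have "ip h h = ip h d + ip h p" using add[OF h] fh(5) d p h by simp
  also have "\<dots> = ip d d + ip p p" using add[OF d] add[OF p] pd fh(5)[OF d p] by simp
  finally have "(\<Sum>t\<in>F. \<alpha> t * h t) \<le> ip h h" using fh(8)[OF d] pp by simp
  then show ?thesis using that[of \<alpha>] a by auto
qed

text \<open>On finitely many coordinates the cost is the norm of the interpolant of h. The bound by
  the norm of h does not depend on the coordinates, so it passes from cylinders to all
  events.\<close>

lemma gaussian_shift_tv:
  assumes G: "gaussian_char M T K X" and R: "is_rkhs T K V ip" and sym: "\<And>s t. K s t = K t s"
    and h: "h \<in> V" and A: "A \<in> sets (real_PiM T)"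
  shows "\<bar>process_prob M T X A - process_prob M T (\<lambda>t w. X t w + h t) A\<bar>
    \<le> hilbert_norm ip h"
proof -
  interpret M: prob_space M by (rule gaussian_charD(1)[OF G])
  let ?B = "real_PiM T"
  have X: "t \<in> T \<Longrightarrow> X t \<in> borel_measurable M" for t by (rule gaussian_charD(2)[OF G])
  have mX: "(\<lambda>w. \<lambda>t\<in>T. X t w) \<in> M \<rightarrow>\<^sub>M ?B" "(\<lambda>w. \<lambda>t\<in>T. X t w + h t) \<in> M \<rightarrow>\<^sub>M ?B"
    using X by (auto intro!: measurable_restrict borel_measurable_add)
  define P where "P = distr M ?B (\<lambda>w. \<lambda>t\<in>T. X t w)"
  define Q where "Q = distr M ?B (\<lambda>w. \<lambda>t\<in>T. X t w + h t)"
  have PQ: "finite_measure P" "finite_measure Q"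
    unfolding P_def Q_def by (intro M.finite_measure_distr mX)+
  have m: "measure P S = process_prob M T X S"
    "measure Q S = process_prob M T (\<lambda>t w. X t w + h t) S" if "S \<in> sets ?B" for S
    unfolding P_def Q_def using that mX by (simp_all add: measure_distr_Collect)
  have "\<bar>measure P A - measure Q A\<bar> \<le> hilbert_norm ip h"
  proof (rule PiM_tv_from_cylinders[OF PQ(1) _ PQ(2) _ _ A])
    fix C assume C: "C \<in> cylinder_sets T"
    then obtain F S where FS: "C = prod_emb T (\<lambda>_. borel) F S" "finite F" "F \<subseteq> T" "S \<in> sets (real_PiM F)"
      unfolding cylinder_sets_def by blast
    obtain \<alpha> where a: "\<And>t. t \<in> F \<Longrightarrow> (\<Sum>u\<in>F. \<alpha> u * K t u) = h t" "(\<Sum>t\<in>F. \<alpha> t * h t) \<le> ip h h"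
      using rkhs_interpolation[OF R FS(2,3) h sym] by blast
    have in_C: "(\<lambda>t\<in>T. x t) \<in> C \<longleftrightarrow> (\<lambda>t\<in>F. x t) \<in> S" for x
      using FS(3) unfolding FS(1) by (auto simp: prod_emb_def restrict_restrict Int_absorb1)
    have CB: "C \<in> sets ?B" using C cylinder_sets_sets by blast
    have "\<bar>measure P C - measure Q C\<bar> \<le> sqrt (\<Sum>t\<in>F. \<alpha> t * h t)"
      unfolding m[OF CB] in_C
      by (rule gaussian_shift_tv_finite[OF gaussian_char_mono[OF G FS(3)] FS(2) sym a(1) FS(4)])
    also have "\<dots> \<le> hilbert_norm ip h" unfolding hilbert_norm_def using a(2) by simp
    finally show "\<bar>measure P C - measure Q C\<bar> \<le> hilbert_norm ip h" .
  qed (simp_all add: P_def Q_def)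
  then show ?thesis unfolding m[OF A] .
qed

section \<open>Fractional Brownian motion on a grid\<close>

lemma fbm_cov_sym: "fbm_cov H s t = fbm_cov H t s"
  by (simp add: fbm_cov_def abs_minus_commute)

lemma fbm_cov_zero: "fbm_cov H 0 t = 0" "fbm_cov H t 0 = 0"
  by (simp_all add: fbm_cov_def)

lemma fbm_cov_scale:
  assumes "0 < c"
  shows "c powr (2 * H) * fbm_cov H (s / c) (t / c) = fbm_cov H s t"
proof -
  have "\<bar>x / c\<bar> powr (2 * H) = \<bar>x\<bar> powr (2 * H) / c powr (2 * H)" for x
    using assms by (simp add: powr_divide)
  moreover have "t / c - s / c = (t - s) / c" by (simp add: diff_divide_distrib)
  ultimately show ?thesis using assms unfolding fbm_cov_def by (simp add: field_simps)
qed

lemma fbm_increment_cov: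
  assumes n: "1 \<le> n"
  shows "real n powr (2 * H) *
     ((fbm_cov H (real i / n) (real j / n) - fbm_cov H (real i / n) ((real j - 1) / n))
    - (fbm_cov H ((real i - 1) / n) (real j / n) - fbm_cov H ((real i - 1) / n) ((real j - 1) / n)))
    = fgn_autocov H (int j - int i)"
proof -
  have "real n > 0" using n by simp
  note sc = fbm_cov_scale[OF this]
  show ?thesis unfolding right_diff_distrib sc
    by (simp add: fbm_cov_def fgn_autocov_def algebra_simps)
qed

lemma gaussian_char_increments:
  assumes G: "gaussian_char M T (fbm_cov H) B" and T: "{0..1} \<subseteq> T" and n: "1 \<le> n"
  shows "gaussian_char M {1..n} (\<lambda>i j. fgn_autocov H (int j - int i))
     (\<lambda>i w. real n powr H * (B (real i / n) w - B ((real i - 1) / n) w))"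
proof (rule gaussian_char_cov_cong)
  \<comment> \<open>The two end points of a grid interval are indexed by booleans.\<close>
  let ?A = "\<lambda>i b. if b then real n powr H else - (real n powr H)"
  let ?\<tau> = "\<lambda>i b. if b then real i / n else (real i - 1) / n"
  show "gaussian_char M {1..n} (\<lambda>j k. \<Sum>s\<in>(UNIV :: bool set). \<Sum>s'\<in>UNIV. ?A j s * ?A k s' * fbm_cov H (?\<tau> j s) (?\<tau> k s'))
     (\<lambda>j w. \<Sum>s\<in>UNIV. ?A j s * B (?\<tau> j s) w)"
  proof (rule gaussian_char_linear[OF G])
    fix j :: nat and s assume "j \<in> {1..n}"
    then have "?\<tau> j s \<in> {0..1}" by (auto simp: field_simps)
    then show "?\<tau> j s \<in> T" using T by blast
  qed simp
  fix i j :: nat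
  have p: "real n powr (2 * H) = real n powr H * real n powr H"
    by (simp add: powr_add[symmetric])
  show "(\<Sum>s\<in>(UNIV :: bool set). \<Sum>s'\<in>UNIV. ?A i s * ?A j s' * fbm_cov H (?\<tau> i s) (?\<tau> j s')) = fgn_autocov H (int j - int i)"
    unfolding fbm_increment_cov[OF n, symmetric] p by (simp add: UNIV_bool algebra_simps)
qed (simp add: UNIV_bool algebra_simps)

lemma summation_by_parts:
  fixes x g :: "nat \<Rightarrow> real"
  assumes "g 0 = 0"
  shows "(\<Sum>j=1..n. x j * g j) = (\<Sum>i=1..n. (\<Sum>j=i..n. x j) * (g i - g (i - 1)))"
proof (induction n)
  case (Suc n)
  have tel: "(\<Sum>i=1..m. g i - g (i - 1)) = g m" for m
    by (induction m) (auto simp: assms)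
  have "(\<Sum>i=1..Suc n. (\<Sum>j=i..Suc n. x j) * (g i - g (i - 1)))
      = (\<Sum>i=1..Suc n. ((if i \<le> n then \<Sum>j=i..n. x j else 0) + x (Suc n)) * (g i - g (i - 1)))"
    by (intro sum.cong refl) (auto simp: not_le)
  also have "\<dots> = (\<Sum>i=1..Suc n. (if i \<le> n then \<Sum>j=i..n. x j else 0) * (g i - g (i - 1))) + x (Suc n) * (\<Sum>i=1..Suc n. g i - g (i - 1))"
    by (simp only: distrib_right sum.distrib sum_distrib_left)
  also have "(\<Sum>i=1..Suc n. (if i \<le> n then \<Sum>j=i..n. x j else 0) * (g i - g (i - 1)))
      = (\<Sum>i=1..n. (\<Sum>j=i..n. x j) * (g i - g (i - 1)))"
    by simp
  finally show ?case using Suc by (simp only: tel) simp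
qed simp

text \<open>Abel summation in both arguments, possible without boundary term because the covariance
  vanishes at time 0. Grid values become increments and coefficients become their tail sums, so the
  spectral bound for the noise also controls the grid covariance.\<close>

lemma fbm_grid_quadratic_form:
  fixes x :: "nat \<Rightarrow> real"
  assumes n: "1 \<le> n"
  defines "b \<equiv> \<lambda>i. \<Sum>j=i..n. x j"
  shows "real n powr (2 * H) * (\<Sum>i=1..n. \<Sum>j=1..n. x i * x j * fbm_cov H (real i / n) (real j / n))
    = (\<Sum>i=1..n. \<Sum>j=1..n. b i * b j * fgn_autocov H (int j - int i))"
proof -
  define K where "K i j = fbm_cov H (real i / n) (real j / n)" for i j :: nat
  define \<Delta> where "\<Delta> i j = (K i j - K i (j - 1)) - (K (i - 1) j - K (i - 1) (j - 1))" for i j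
  have "real n powr (2 * H) * (\<Sum>i=1..n. \<Sum>j=1..n. x i * x j * K i j)
      = real n powr (2 * H) * (\<Sum>i=1..n. x i * (\<Sum>j=1..n. x j * K i j))"
    by (simp add: sum_distrib_left mult_ac)
  also have "\<dots> = real n powr (2 * H) * (\<Sum>i=1..n. x i * (\<Sum>j=1..n. b j * (K i j - K i (j - 1))))"
    unfolding b_def by (subst summation_by_parts) (auto simp: fbm_cov_zero K_def)
  also have "(\<Sum>i=1..n. x i * (\<Sum>j=1..n. b j * (K i j - K i (j - 1))))
    = (\<Sum>i=1..n. b i * ((\<Sum>j=1..n. b j * (K i j - K i (j - 1))) - (\<Sum>j=1..n. b j * (K (i - 1) j - K (i - 1) (j - 1)))))"
    unfolding b_def by (rule summation_by_parts) (simp add: fbm_cov_zero K_def)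
  also have "\<dots> = (\<Sum>i=1..n. \<Sum>j=1..n. b i * b j * \<Delta> i j)"
    unfolding sum_subtractf[symmetric] sum_distrib_left \<Delta>_def by (intro sum.cong refl) (simp add: algebra_simps)
  also have "real n powr (2 * H) * \<dots> = (\<Sum>i=1..n. \<Sum>j=1..n. b i * b j * fgn_autocov H (int j - int i))"
    unfolding sum_distrib_left
  proof (intro sum.cong refl)
    fix i j assume "i \<in> {1..n}" "j \<in> {1..n}"
    then have "real n powr (2 * H) * \<Delta> i j = fgn_autocov H (int j - int i)"
      using fbm_increment_cov[OF n, of H i j] by (simp add: \<Delta>_def K_def of_nat_diff)
    then show "real n powr (2 * H) * (b i * b j * \<Delta> i j) = b i * b j * fgn_autocov H (int j - int i)"
      by (simp add: mult.left_commute)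
  qed
  finally show ?thesis by (simp only: K_def)
qed

lemma fgn_quadratic_form_nonneg:
  fixes b :: "nat \<Rightarrow> real"
  assumes H: "0 < H" "H < 1" and n: "1 \<le> n"
  shows "0 \<le> (\<Sum>i=1..n. \<Sum>j=1..n. b i * b j * fgn_autocov H (int j - int i))"
proof -
  have "0 \<le> (\<Sum>i=1..n. (b i)\<^sup>2)" by (intro sum_nonneg) simp
  also note fgn_quadratic_form_lower_bound[OF n H, of b]
  finally show ?thesis using fgn_bound_pos[OF H, of n] by (meson mult_pos_neg not_le)
qed

text \<open>If the form vanishes, the spectral bound kills all tail sums of x, and x is recovered
  from their differences.\<close>

lemma fbm_grid_positive_definite:
  fixes x :: "nat \<Rightarrow> real"
  assumes H: "0 < H" "H < 1" and n: "1 \<le> n"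
  shows "0 \<le> (\<Sum>i=1..n. \<Sum>j=1..n. x i * x j * fbm_cov H (real i / n) (real j / n))"
    and "(\<Sum>i=1..n. \<Sum>j=1..n. x i * x j * fbm_cov H (real i / n) (real j / n)) = 0 \<Longrightarrow> j \<in> {1..n} \<Longrightarrow> x j = 0"
proof -
  define b where "b i = (\<Sum>j=i..n. x j)" for i
  note qf = fbm_grid_quadratic_form[OF n, of H x, folded b_def]
  show "0 \<le> (\<Sum>i=1..n. \<Sum>j=1..n. x i * x j * fbm_cov H (real i / n) (real j / n))"
    using fgn_quadratic_form_nonneg[OF H n, of b] qf[symmetric] n by (simp add: zero_le_mult_iff)
  assume zero: "(\<Sum>i=1..n. \<Sum>j=1..n. x i * x j * fbm_cov H (real i / n) (real j / n)) = 0" and j: "j \<in> {1..n}"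
  have "(\<Sum>i=1..n. (b i)\<^sup>2) \<le> 0"
    using fgn_quadratic_form_lower_bound[OF n H, of b] qf zero by simp
  then have "(\<Sum>i=1..n. (b i)\<^sup>2) = 0" by (meson order_antisym sum_nonneg zero_le_power2)
  then have b0: "b i = 0" if "i \<in> {1..n}" for i using that by (subst (asm) sum_nonneg_eq_0_iff) auto
  \<comment> \<open>For j = n this tail sum is empty.\<close>
  have "b (Suc j) = 0" using b0[of "Suc j"] by (cases "j = n") (use j in \<open>auto simp: b_def\<close>)
  moreover have "b j = x j + b (Suc j)" unfolding b_def using j by (simp add: sum.atLeast_Suc_atMost)
  ultimately show "x j = 0" using b0[OF j] by simp
qed

lemma continuous_on_fbm_cov [continuous_intros]:
  assumes "0 < H"
  shows "continuous_on S (\<lambda>t. fbm_cov H t s)"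
  unfolding fbm_cov_def using assms by (intro continuous_intros continuous_on_powr') auto

text \<open>The matrix \<alpha> is the inverse of the grid covariance, and L consists of the
  cardinal functions of the span of the kernels at the grid points. The last property is the system
  of kriging equations: predicting by L gives the right covariance with every grid value.\<close>

lemma fbm_grid_basis:
  assumes H: "0 < H" "H < 1" and n: "1 \<le> n"
  obtains \<alpha> :: "nat \<Rightarrow> nat \<Rightarrow> real" and L :: "nat \<Rightarrow> real \<Rightarrow> real"
  where "\<And>j t. L j t = (\<Sum>l=1..n. \<alpha> j l * fbm_cov H t (real l / n))"
    and "\<And>i j. i \<in> {1..n} \<Longrightarrow> j \<in> {1..n} \<Longrightarrow> L j (real i / n) = (if i = j then 1 else 0)"
    and "\<And>t m. m \<in> {1..n} \<Longrightarrow> (\<Sum>j=1..n. L j t * fbm_cov H (real j / n) (real m / n)) = fbm_cov H t (real m / n)"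
proof -
  define K where "K i j = fbm_cov H (real i / n) (real j / n)" for i j :: nat
  have Ksym: "K i j = K j i" for i j by (simp add: K_def fbm_cov_sym)
  have psd: "0 \<le> (\<Sum>i=1..n. \<Sum>j=1..n. x i * x j * K i j)" for x
    unfolding K_def by (rule fbm_grid_positive_definite(1)[OF H n])
  have "\<exists>\<alpha>. \<forall>i\<in>{1..n}. (\<Sum>l=1..n. \<alpha> l * K i l) = (if i = j then 1 else 0)" for j
  proof (rule psd_linear_solve[OF _ Ksym psd])
    fix x assume "(\<Sum>i=1..n. \<Sum>j=1..n. x i * x j * K i j) = 0"
    then have "x i = 0" if "i \<in> {1..n}" for i
      using fbm_grid_positive_definite(2)[OF H n _ that, of x] by (simp add: K_def)
    then show "(\<Sum>i=1..n. x i * (if i = j then 1 else 0)) = 0" by (intro sum.neutral) simp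
  qed simp
  then obtain \<alpha> where \<alpha>: "\<And>i j. i \<in> {1..n} \<Longrightarrow> (\<Sum>l=1..n. \<alpha> j l * K i l) = (if i = j then 1 else 0)"
    by metis
  \<comment> \<open>\<alpha> was only found as a one-sided inverse, row by row; its symmetry lets
    the kriging equations, which sum over the first index, use the same equation.\<close>
  have \<alpha>sym: "\<alpha> j l = \<alpha> l j" if "j \<in> {1..n}" "l \<in> {1..n}" for j l
  proof -
    have *: "\<alpha> j l = (\<Sum>i=1..n. \<Sum>k=1..n. \<alpha> j i * \<alpha> l k * K i k)" if "l \<in> {1..n}" for j l
    proof -
      have "(\<Sum>i=1..n. \<Sum>k=1..n. \<alpha> j i * \<alpha> l k * K i k) = (\<Sum>i=1..n. \<alpha> j i * (if i = l then 1 else 0))"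
        using \<alpha> by (intro sum.cong refl) (simp add: sum_distrib_left[symmetric] mult.assoc)
      also have "\<dots> = \<alpha> j l" using that by (simp add: if_distrib[of "\<lambda>x. _ * x"] cong: if_cong)
      finally show ?thesis by simp
    qed
    have "\<alpha> j l = (\<Sum>i=1..n. \<Sum>k=1..n. \<alpha> j i * \<alpha> l k * K i k)" by (rule *[OF that(2)])
    also have "\<dots> = (\<Sum>k=1..n. \<Sum>i=1..n. \<alpha> l k * \<alpha> j i * K k i)"
      by (subst sum.swap) (simp add: Ksym mult_ac)
    also have "\<dots> = \<alpha> l j" by (rule *[OF that(1), symmetric])
    finally show ?thesis .
  qed
  define L where "L j t = (\<Sum>l=1..n. \<alpha> j l * fbm_cov H t (real l / n))" for j t
  show ?thesis
  proof (rule that[of L \<alpha>])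
    show "L j (real i / n) = (if i = j then 1 else 0)" if "i \<in> {1..n}" "j \<in> {1..n}" for i j
      using \<alpha>[OF that(1), of j] by (simp add: L_def K_def)
    show "(\<Sum>j=1..n. L j t * fbm_cov H (real j / n) (real m / n)) = fbm_cov H t (real m / n)" if m: "m \<in> {1..n}" for t m
    proof -
      have "(\<Sum>j=1..n. L j t * K j m) = (\<Sum>j=1..n. \<Sum>l=1..n. fbm_cov H t (real l / n) * (\<alpha> l j * K m j))"
        unfolding L_def sum_distrib_right
      proof (intro sum.cong refl)
        fix j l assume "j \<in> {1..n}" "l \<in> {1..n}"
        then show "\<alpha> j l * fbm_cov H t (real l / n) * K j m = fbm_cov H t (real l / n) * (\<alpha> l j * K m j)"
          using \<alpha>sym[of j l] Ksym[of j m] by simp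
      qed
      also have "\<dots> = (\<Sum>l=1..n. fbm_cov H t (real l / n) * (\<Sum>j=1..n. \<alpha> l j * K m j))"
        by (subst sum.swap) (simp add: sum_distrib_left)
      also have "\<dots> = fbm_cov H t (real m / n)"
        using m by (simp only: \<alpha>[OF m]) (simp add: if_distrib[of "\<lambda>x. _ * x"] cong: if_cong)
      finally show ?thesis by (simp add: K_def)
    qed
  qed (simp add: L_def)
qed

section \<open>Laws, kernels and kriging\<close>

lemma measurable_affine_PiM:
  "(\<lambda>x. \<lambda>t\<in>T. m t + \<sigma> * x t) \<in> real_PiM T \<rightarrow>\<^sub>M real_PiM T"
  by (intro measurable_restrict borel_measurable_add borel_measurable_times measurable_component_singleton) simp_all

lemma gaussian_char_affine_law_eq:
  assumes G: "gaussian_char M T c X" and G': "gaussian_char M' T c X'"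
    and A: "A \<in> sets (real_PiM T)"
  shows "process_prob M T (\<lambda>t w. m t + \<sigma> * X t w) A = process_prob M' T (\<lambda>t w. m t + \<sigma> * X' t w) A"
proof -
  let ?B = "real_PiM T"
  define S where "S = {x \<in> space ?B. (\<lambda>t\<in>T. m t + \<sigma> * x t) \<in> A}"
  have S: "S \<in> sets ?B"
    unfolding S_def by (rule measurable_sets_Collect[OF measurable_affine_PiM A])
  have iS: "(\<lambda>t\<in>T. x t) \<in> S \<longleftrightarrow> (\<lambda>t\<in>T. m t + \<sigma> * x t) \<in> A" for x
    unfolding S_def by (simp add: space_PiM cong: restrict_cong)
  have "(\<lambda>w. \<lambda>t\<in>T. X t w) \<in> M \<rightarrow>\<^sub>M ?B" "(\<lambda>w. \<lambda>t\<in>T. X' t w) \<in> M' \<rightarrow>\<^sub>M ?B"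
    using gaussian_charD(2)[OF G] gaussian_charD(2)[OF G'] by (auto intro!: measurable_restrict)
  then show ?thesis
    using arg_cong[OF gaussian_char_distr_eq[OF G G'], of "\<lambda>D. measure D S"] S
    unfolding iS[symmetric] by (simp add: measure_distr_Collect)
qed

text \<open>The Gaussian shift bound is the square root of q, the quadratic form of the inverse
  covariance at h. Cauchy-Schwarz and the eigenvalue bound give q^2 \<le> \<kappa> * q * |h|^2, from
  which one factor q is cancelled.\<close>

lemma regression_shift_tv:
  assumes H: "0 < H" "H < 1" and n: "1 \<le> n"
    and G: "gaussian_char M {1..n} (\<lambda>i j. fgn_autocov H (int j - int i)) N"
    and A: "A \<in> sets (borel_Rn n)"
  shows "\<bar>process_prob M {1..n} (\<lambda>i w. a i + N i w) A - process_prob M {1..n} (\<lambda>i w. b i + N i w) A\<bar>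
    \<le> sqrt (fgn_bound H n * (\<Sum>i=1..n. (b i - a i)\<^sup>2))"
proof -
  define \<gamma> where "\<gamma> i j = fgn_autocov H (int j - int i)" for i j
  define h where "h i = b i - a i" for i
  define \<kappa> where "\<kappa> = fgn_bound H n"
  have \<kappa>: "0 < \<kappa>" unfolding \<kappa>_def by (rule fgn_bound_pos[OF H])
  have sym: "\<gamma> i j = \<gamma> j i" for i j
  proof -
    have "\<bar>real_of_int (int j - int i) + 1\<bar> = \<bar>real_of_int (int i - int j) - 1\<bar>"
      "\<bar>real_of_int (int j - int i)\<bar> = \<bar>real_of_int (int i - int j)\<bar>"
      "\<bar>real_of_int (int j - int i) - 1\<bar> = \<bar>real_of_int (int i - int j) + 1\<bar>" by linarith+
    then show ?thesis unfolding \<gamma>_def fgn_autocov_def by simp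
  qed
  have lb: "(\<Sum>i=1..n. (x i)\<^sup>2) \<le> \<kappa> * (\<Sum>i=1..n. \<Sum>j=1..n. x i * x j * \<gamma> i j)" for x
    unfolding \<kappa>_def \<gamma>_def by (rule fgn_quadratic_form_lower_bound[OF n H])
  have "\<exists>\<alpha>. \<forall>i\<in>{1..n}. (\<Sum>j=1..n. \<alpha> j * \<gamma> i j) = h i"
  proof (rule psd_linear_solve[OF _ sym])
    show "0 \<le> (\<Sum>i=1..n. \<Sum>j=1..n. x i * x j * \<gamma> i j)" for x
      unfolding \<gamma>_def by (rule fgn_quadratic_form_nonneg[OF H n])
    fix x assume "(\<Sum>i=1..n. \<Sum>j=1..n. x i * x j * \<gamma> i j) = 0"
    then have "(\<Sum>i=1..n. (x i)\<^sup>2) \<le> 0" using lb[of x] by simp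
    then have "(\<Sum>i=1..n. (x i)\<^sup>2) = 0" by (meson order_antisym sum_nonneg zero_le_power2)
    then have "\<forall>i\<in>{1..n}. x i = 0" by (subst (asm) sum_nonneg_eq_0_iff) auto
    then show "(\<Sum>i=1..n. x i * h i) = 0" by (intro sum.neutral) simp
  qed simp
  then obtain \<alpha> where \<alpha>: "\<And>i. i \<in> {1..n} \<Longrightarrow> (\<Sum>j=1..n. \<alpha> j * \<gamma> i j) = h i" by blast
  define q where "q = (\<Sum>i=1..n. \<alpha> i * h i)"
  have "(\<Sum>i=1..n. \<Sum>j=1..n. \<alpha> i * \<alpha> j * \<gamma> i j) = (\<Sum>i=1..n. \<alpha> i * (\<Sum>j=1..n. \<alpha> j * \<gamma> i j))"
    by (simp add: sum_distrib_left mult.assoc)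
  also have "\<dots> = q" unfolding q_def by (intro sum.cong refl arg_cong[of _ _ "\<lambda>z. _ * z"] \<alpha>)
  finally have \<alpha>q: "(\<Sum>i=1..n. (\<alpha> i)\<^sup>2) \<le> \<kappa> * q" using lb[of \<alpha>] by simp
  have "0 \<le> \<kappa> * q" by (rule order_trans[OF _ \<alpha>q]) (intro sum_nonneg, simp)
  then have q0: "0 \<le> q" using \<kappa> by (simp add: zero_le_mult_iff)
  have "q\<^sup>2 \<le> (\<Sum>i=1..n. (\<alpha> i)\<^sup>2) * (\<Sum>i=1..n. (h i)\<^sup>2)" unfolding q_def by (rule Cauchy_Schwarz_ineq_sum)
  also have "\<dots> \<le> \<kappa> * q * (\<Sum>i=1..n. (h i)\<^sup>2)" by (intro mult_right_mono \<alpha>q sum_nonneg) simp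
  finally have "q * q \<le> q * (\<kappa> * (\<Sum>i=1..n. (h i)\<^sup>2))" by (simp add: power2_eq_square mult_ac)
  moreover have "0 \<le> \<kappa> * (\<Sum>i=1..n. (h i)\<^sup>2)" using \<kappa> by (intro mult_nonneg_nonneg sum_nonneg) auto
  ultimately have q: "q \<le> \<kappa> * (\<Sum>i=1..n. (h i)\<^sup>2)"
    using q0 by (cases "q = 0") (auto simp: mult_le_cancel_left)
  define S where "S = {x \<in> space (borel_Rn n). (\<lambda>i\<in>{1..n}. a i + 1 * x i) \<in> A}"
  have S: "S \<in> sets (borel_Rn n)"
    unfolding S_def by (rule measurable_sets_Collect[OF measurable_affine_PiM A])
  have iS: "(\<lambda>i\<in>{1..n}. x i) \<in> S \<longleftrightarrow> (\<lambda>i\<in>{1..n}. a i + x i) \<in> A" for x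
    unfolding S_def by (simp add: space_PiM cong: restrict_cong)
  have "\<bar>process_prob M {1..n} N S - process_prob M {1..n} (\<lambda>i w. N i w + h i) S\<bar> \<le> sqrt q"
    unfolding q_def by (rule gaussian_shift_tv_finite[OF G[folded \<gamma>_def] _ sym \<alpha> S]) auto
  moreover have "a i + (N i w + h i) = b i + N i w" for i w by (simp add: h_def)
  ultimately have "\<bar>process_prob M {1..n} (\<lambda>i w. a i + N i w) A - process_prob M {1..n} (\<lambda>i w. b i + N i w) A\<bar> \<le> sqrt q"
    unfolding iS by simp
  also have "\<dots> \<le> sqrt (\<kappa> * (\<Sum>i=1..n. (h i)\<^sup>2))" using q by simp
  finally show ?thesis by (simp add: \<kappa>_def h_def)
qed

section \<open>Markov kernels driven by independent randomness\<close>

lemma tv_dist_leI: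
  assumes "\<And>A. A \<in> sets P \<Longrightarrow> \<bar>measure P A - measure Q A\<bar> \<le> \<epsilon>"
  shows "tv_dist P Q \<le> ennreal \<epsilon>"
  unfolding tv_dist_def using assms by (intro SUP_least ennreal_leI)

lemma distr_kernel:
  assumes W: "prob_space W" and \<Phi>: "(\<lambda>(x, w). \<Phi> x w) \<in> X \<Otimes>\<^sub>M W \<rightarrow>\<^sub>M Z"
  shows "(\<lambda>x. distr W Z (\<Phi> x)) \<in> X \<rightarrow>\<^sub>M prob_algebra Z"
  using W by (intro measurable_distr_prob_space2[OF _ \<Phi>] measurable_const) (simp add: space_prob_algebra)

text \<open>A kernel that feeds the observation and an independent w into \<Phi> becomes an event of
  a product. The randomness W is the first factor, so that two observation laws can be compared
  conditionally on it.\<close>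

lemma measure_bind_distr_kernel:
  assumes P: "prob_space P" "sets P = sets X" and W: "prob_space W"
    and \<Phi>: "(\<lambda>(x, w). \<Phi> x w) \<in> X \<Otimes>\<^sub>M W \<rightarrow>\<^sub>M Z" and A: "A \<in> sets Z"
  shows "measure (P \<bind> (\<lambda>x. distr W Z (\<Phi> x))) A = measure (W \<Otimes>\<^sub>M P) {p\<in>space (W \<Otimes>\<^sub>M P). \<Phi> (snd p) (fst p) \<in> A}"
    and "{p\<in>space (W \<Otimes>\<^sub>M P). \<Phi> (snd p) (fst p) \<in> A} \<in> sets (W \<Otimes>\<^sub>M P)"
proof -
  interpret P: prob_space P by fact
  interpret W: prob_space W by fact
  interpret WP: pair_prob_space W P ..
  let ?D = "{p\<in>space (W \<Otimes>\<^sub>M P). \<Phi> (snd p) (fst p) \<in> A}"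
  have spP: "space P = space X" by (rule sets_eq_imp_space_eq[OF P(2)])
  have \<Phi>P: "(\<lambda>(x, w). \<Phi> x w) \<in> P \<Otimes>\<^sub>M W \<rightarrow>\<^sub>M Z"
    using \<Phi> by (simp add: P(2) cong: measurable_cong_sets sets_pair_measure_cong)
  have sw: "(\<lambda>p. \<Phi> (snd p) (fst p)) \<in> W \<Otimes>\<^sub>M P \<rightarrow>\<^sub>M Z"
    using measurable_compose[OF measurable_pair_swap' \<Phi>P] by (simp add: case_prod_unfold)
  show D: "?D \<in> sets (W \<Otimes>\<^sub>M P)" by (rule measurable_sets_Collect[OF sw A])
  have k: "(\<lambda>x. distr W Z (\<Phi> x)) \<in> P \<rightarrow>\<^sub>M subprob_algebra Z"
    using measurable_prob_algebraD[OF distr_kernel[OF W \<Phi>P]] .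
  have "emeasure (P \<bind> (\<lambda>x. distr W Z (\<Phi> x))) A = (\<integral>\<^sup>+x. emeasure (distr W Z (\<Phi> x)) A \<partial>P)"
    by (rule emeasure_bind[OF P.not_empty k A])
  also have "\<dots> = (\<integral>\<^sup>+x. emeasure W ((\<lambda>w. (w, x)) -` ?D) \<partial>P)"
  proof (rule nn_integral_cong)
    fix x assume x: "x \<in> space P"
    have "\<Phi> x \<in> W \<rightarrow>\<^sub>M Z" using measurable_compose[OF measurable_Pair1'[OF x] \<Phi>P] by simp
    then have "emeasure (distr W Z (\<Phi> x)) A = emeasure W (\<Phi> x -` A \<inter> space W)" using A by (rule emeasure_distr)
    also have "\<Phi> x -` A \<inter> space W = (\<lambda>w. (w, x)) -` ?D" using x by (auto simp: space_pair_measure)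
    finally show "emeasure (distr W Z (\<Phi> x)) A = emeasure W ((\<lambda>w. (w, x)) -` ?D)" .
  qed
  also have "\<dots> = emeasure (W \<Otimes>\<^sub>M P) ?D" by (rule WP.emeasure_pair_measure_alt2[OF D, symmetric])
  finally show "measure (P \<bind> (\<lambda>x. distr W Z (\<Phi> x))) A = measure (W \<Otimes>\<^sub>M P) ?D" by (simp add: measure_def)
qed

text \<open>The data processing inequality: for fixed randomness w, the output event is an event of
  the observation, where the bound applies.\<close>

lemma bind_distr_kernel_tv:
  assumes P: "prob_space P" "sets P = sets X" and Q: "prob_space Q" "sets Q = sets X" and W: "prob_space W"
    and \<Phi>: "(\<lambda>(x, w). \<Phi> x w) \<in> X \<Otimes>\<^sub>M W \<rightarrow>\<^sub>M Z" and A: "A \<in> sets Z"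
    and le: "\<And>S. S \<in> sets X \<Longrightarrow> \<bar>measure P S - measure Q S\<bar> \<le> \<epsilon>"
  shows "\<bar>measure (P \<bind> (\<lambda>x. distr W Z (\<Phi> x))) A - measure (Q \<bind> (\<lambda>x. distr W Z (\<Phi> x))) A\<bar> \<le> \<epsilon>"
proof -
  note p = measure_bind_distr_kernel[OF P W \<Phi> A] and q = measure_bind_distr_kernel[OF Q W \<Phi> A]
  have "space P = space Q" using P(2) Q(2) by (intro sets_eq_imp_space_eq) simp
  then have "space (W \<Otimes>\<^sub>M P) = space (W \<Otimes>\<^sub>M Q)" by (simp add: space_pair_measure)
  moreover have "Pair w -` {p\<in>space (W \<Otimes>\<^sub>M P). \<Phi> (snd p) (fst p) \<in> A} \<in> sets X" for w
    using sets_Pair1[OF p(2)] P(2) by simp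
  ultimately show ?thesis unfolding p(1) q(1)
    by (intro pair_measure_tv[OF W P(1) Q(1) p(2) q(2)]) (simp add: le)
qed

section \<open>Gaussian laws on path space and kriging\<close>

lemma C01_path_measurable:
  assumes X: "\<And>t. t \<in> {0..1} \<Longrightarrow> X t \<in> borel_measurable M"
    and cont: "\<And>w. w \<in> space M \<Longrightarrow> continuous_on {0..1} (\<lambda>t. X t w)" "continuous_on {0..1} m"
  shows "(\<lambda>w. \<lambda>t\<in>{0..1}. m t + \<sigma> * X t w) \<in> M \<rightarrow>\<^sub>M borel_C01"
proof (rule measurable_borel_C01I)
  show "continuous_on {0..1} (\<lambda>t\<in>{0..1}. m t + \<sigma> * X t w)" if "w \<in> space M" for w
  proof -
    have "continuous_on {0..1} (\<lambda>t. m t + \<sigma> * X t w)" using cont(1)[OF that] cont(2) by (intro continuous_intros)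
    then show ?thesis by (rule continuous_on_eq) simp
  qed
qed (use X in auto)

lemma C01_path_event:
  assumes "continuous_on {0..1} x" "A = space borel_C01 \<inter> A'"
  shows "(\<lambda>t\<in>{0..1}. x t) \<in> A \<longleftrightarrow> (\<lambda>t\<in>{0..1}. x t) \<in> A'"
proof -
  have "continuous_on {0..1} (\<lambda>t\<in>{0..1}. x t)" using assms(1) by (rule continuous_on_eq) simp
  then show ?thesis using assms(2) by (simp add: space_borel_C01)
qed

lemma C01_law_eq:
  assumes G: "gaussian_char M {0..1} c X" and G': "gaussian_char M' {0..1} c X'"
    and cont: "\<And>w. w \<in> space M \<Longrightarrow> continuous_on {0..1} (\<lambda>t. X t w)"
      "\<And>w. w \<in> space M' \<Longrightarrow> continuous_on {0..1} (\<lambda>t. X' t w)" "continuous_on {0..1} m"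
    and A: "A \<in> sets borel_C01"
  shows "process_prob M {0..1} (\<lambda>t w. m t + \<sigma> * X t w) A
    = process_prob M' {0..1} (\<lambda>t w. m t + \<sigma> * X' t w) A"
proof -
  obtain A' where A': "A' \<in> sets (real_PiM {0..1})" "A = space borel_C01 \<inter> A'"
    using A by (rule sets_borel_C01_E)
  have "{w\<in>space M. (\<lambda>t\<in>{0..1}. m t + \<sigma> * X t w) \<in> A} = {w\<in>space M. (\<lambda>t\<in>{0..1}. m t + \<sigma> * X t w) \<in> A'}"
    by (intro Collect_cong conj_cong refl C01_path_event A'(2) continuous_intros cont)
  moreover have "{w\<in>space M'. (\<lambda>t\<in>{0..1}. m t + \<sigma> * X' t w) \<in> A} = {w\<in>space M'. (\<lambda>t\<in>{0..1}. m t + \<sigma> * X' t w) \<in> A'}"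
    by (intro Collect_cong conj_cong refl C01_path_event A'(2) continuous_intros cont)
  ultimately show ?thesis using gaussian_char_affine_law_eq[OF G G' A'(1)] by simp
qed

text \<open>Before scaling by \<sigma>, a change of mean is a shift of X by (m' - m) / \<sigma>.
  With \<sigma> = n^(H-1) this is the origin of the factor n^(1-H) in (ii).\<close>

lemma C01_shift_tv:
  assumes G: "gaussian_char M {0..1} K X" and R: "is_rkhs {0..1} K V ip" and sym: "\<And>s t. K s t = K t s"
    and cont: "\<And>w. w \<in> space M \<Longrightarrow> continuous_on {0..1} (\<lambda>t. X t w)"
      "continuous_on {0..1} m" "continuous_on {0..1} m'"
    and d: "(\<lambda>t\<in>{0..1}. m' t - m t) \<in> V" and \<sigma>: "0 < \<sigma>" and A: "A \<in> sets borel_C01"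
  shows "\<bar>process_prob M {0..1} (\<lambda>t w. m t + \<sigma> * X t w) A
    - process_prob M {0..1} (\<lambda>t w. m' t + \<sigma> * X t w) A\<bar> \<le> hilbert_norm ip (\<lambda>t\<in>{0..1}. m' t - m t) / \<sigma>"
proof -
  let ?B = "real_PiM {0..1}"
  note fh = function_hilbert_spaceD[OF is_rkhsD(1)[OF R]]
  define d' where "d' = (\<lambda>t\<in>{0..1}. m' t - m t)"
  define h where "h = (\<lambda>t\<in>{0..1}. 1 / \<sigma> * d' t)"
  have d': "d' \<in> V" using d by (simp add: d'_def)
  have h: "h \<in> V" unfolding h_def by (rule fh(4)[OF d'])
  have "ip h h = 1 / \<sigma> * ip d' h" using fh(7)[OF d' h, of "1 / \<sigma>"] by (simp add: h_def)
  also have "ip d' h = ip h d'" by (rule fh(5)[OF d' h])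
  also have "\<dots> = 1 / \<sigma> * ip d' d'" using fh(7)[OF d' d', of "1 / \<sigma>"] by (simp add: h_def)
  finally have "hilbert_norm ip h = hilbert_norm ip d' / \<sigma>"
    using \<sigma> by (simp add: hilbert_norm_def real_sqrt_divide)
  moreover obtain A' where A': "A' \<in> sets ?B" "A = space borel_C01 \<inter> A'"
    using A by (rule sets_borel_C01_E)
  define S where "S = {x \<in> space ?B. (\<lambda>t\<in>{0..1}. m t + \<sigma> * x t) \<in> A'}"
  have S: "S \<in> sets ?B"
    unfolding S_def by (rule measurable_sets_Collect[OF measurable_affine_PiM A'(1)])
  have iS: "(\<lambda>t\<in>{0..1}. x t) \<in> S \<longleftrightarrow> (\<lambda>t\<in>{0..1}. m t + \<sigma> * x t) \<in> A'" for x
    unfolding S_def by (simp add: space_PiM cong: restrict_cong)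
  have 1: "{w\<in>space M. (\<lambda>t\<in>{0..1}. m t + \<sigma> * X t w) \<in> A} = {w\<in>space M. (\<lambda>t\<in>{0..1}. X t w) \<in> S}"
    unfolding iS by (intro Collect_cong conj_cong refl C01_path_event A'(2) continuous_intros cont)
  have "(\<lambda>t\<in>{0..1}. m t + \<sigma> * (X t w + h t)) = (\<lambda>t\<in>{0..1}. m' t + \<sigma> * X t w)" for w
    using \<sigma> by (auto simp: h_def d'_def field_simps)
  then have 2: "{w\<in>space M. (\<lambda>t\<in>{0..1}. m' t + \<sigma> * X t w) \<in> A} = {w\<in>space M. (\<lambda>t\<in>{0..1}. X t w + h t) \<in> S}"
    unfolding iS by (simp only:) (intro Collect_cong conj_cong refl C01_path_event A'(2) continuous_intros cont)
  ultimately show ?thesis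
    using gaussian_shift_tv[OF G R sym h S] unfolding 1 2 d'_def by simp
qed

text \<open>The value at time 0 is zero only almost surely. Subtracting it keeps the covariance and
  gives a process that starts at 0 for every outcome, so that increments telescope to grid values
  without null sets.\<close>

lemma centered_fbm:
  assumes "fractional_brownian_motion H W B"
  shows "gaussian_char W {0..1} (fbm_cov H) (\<lambda>t w. B t w - B 0 w)"
    and "gaussian_char W {0..1} (fbm_cov H) B"
    and "w \<in> space W \<Longrightarrow> continuous_on {0..1} (\<lambda>t. B t w)"
proof -
  have G: "gaussian_char W {0..} (fbm_cov H) B"
    using assms by (intro centered_gaussian_process_imp_char) (simp add: fractional_brownian_motion_def)
  show G': "gaussian_char W {0..1} (fbm_cov H) B" by (rule gaussian_char_mono[OF G]) auto
  show "gaussian_char W {0..1} (fbm_cov H) (\<lambda>t w. B t w - B 0 w)"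
  proof (rule gaussian_char_cov_cong)
    let ?A = "\<lambda>t b. if b then 1 else - 1" and ?\<tau> = "\<lambda>t b. if b then t else 0 :: real"
    show "gaussian_char W {0..1} (\<lambda>j k. \<Sum>s\<in>(UNIV :: bool set). \<Sum>s'\<in>UNIV. ?A j s * ?A k s' * fbm_cov H (?\<tau> j s) (?\<tau> k s'))
       (\<lambda>j w. \<Sum>s\<in>UNIV. ?A j s * B (?\<tau> j s) w)"
      by (rule gaussian_char_linear[OF G']) auto
  qed (simp_all add: UNIV_bool fbm_cov_zero)
  assume "w \<in> space W"
  then have "continuous_on {0..} (\<lambda>t. B t w)" using assms by (simp add: fractional_brownian_motion_def)
  then show "continuous_on {0..1} (\<lambda>t. B t w)" by (rule continuous_on_subset) auto
qed

text \<open>Kriging: the best linear prediction of \<open>X\<close> from its values on the grid, plus an independent copy of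
  the prediction error, has the law of \<open>X\<close>.\<close>

lemma kriging_process:
  assumes G: "gaussian_char W {0..1} (fbm_cov H) X" and n: "1 \<le> n"
    and L: "\<And>t m. m \<in> {1..n} \<Longrightarrow> (\<Sum>j=1..n. L j t * fbm_cov H (real j / n) (real m / n)) = fbm_cov H t (real m / n)"
  shows "gaussian_char (W \<Otimes>\<^sub>M W) {0..1} (fbm_cov H)
    (\<lambda>t p. (X t (fst p) - (\<Sum>j=1..n. L j t * X (real j / n) (fst p))) + (\<Sum>j=1..n. L j t * X (real j / n) (snd p)))"
proof -
  let ?K = "fbm_cov H"
  have grid: "real j / n \<in> {0..1}" if "j \<in> {1..n}" for j using that by auto
  \<comment> \<open>By the kriging equations this is at once the covariance of the prediction with X
    and the covariance of the prediction with itself. Hence the error has covariance K - D, and the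
    independent sum has K.\<close>
  define D where "D s t = (\<Sum>j=1..n. L j s * ?K (real j / n) t)" for s t
  have D: "(\<Sum>j=1..n. \<Sum>k=1..n. L j s * L k t * ?K (real j / n) (real k / n)) = D s t" for s t
  proof -
    have "(\<Sum>j=1..n. \<Sum>k=1..n. L j s * L k t * ?K (real j / n) (real k / n))
        = (\<Sum>j=1..n. L j s * (\<Sum>k=1..n. L k t * ?K (real k / n) (real j / n)))"
      by (simp add: sum_distrib_left mult.assoc fbm_cov_sym[of H "real _ / n" "real _ / n"])
    also have "\<dots> = D s t" unfolding D_def
      by (intro sum.cong refl) (simp only: L fbm_cov_sym[of H t])
    finally show ?thesis .
  qed
  have Dsym: "D s t = D t s" for s t
    unfolding D[symmetric] by (subst sum.swap) (simp add: fbm_cov_sym[of H "real _ / n" "real _ / n"] mult_ac)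
  have P: "gaussian_char W {0..1} D (\<lambda>t w. \<Sum>j=1..n. L j t * X (real j / n) w)"
    using gaussian_char_linear[OF G, of "{0..1}" "\<lambda>_. {1..n}" "\<lambda>_ j. real j / n" "\<lambda>t j. L j t"] grid
    unfolding D by simp
  have R: "gaussian_char W {0..1} (\<lambda>s t. ?K s t - D s t) (\<lambda>t w. X t w - (\<Sum>j=1..n. L j t * X (real j / n) w))"
  proof (rule gaussian_char_cov_cong)
    \<comment> \<open>\<open>None\<close> is the variable at time t, \<open>Some j\<close> the
      subtracted prediction term at grid point j.\<close>
    let ?A = "\<lambda>t u. case u of None \<Rightarrow> 1 | Some j \<Rightarrow> - L j t"
    let ?\<tau> = "\<lambda>t u. case u of None \<Rightarrow> t | Some j \<Rightarrow> real j / n"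
    let ?S = "insert None (Some ` {1..n})"
    show "gaussian_char W {0..1} (\<lambda>j k. \<Sum>u\<in>?S. \<Sum>v\<in>?S. ?A j u * ?A k v * ?K (?\<tau> j u) (?\<tau> k v))
        (\<lambda>j w. \<Sum>u\<in>?S. ?A j u * X (?\<tau> j u) w)"
      using grid by (intro gaussian_char_linear[OF G]) auto
    have sp: "(\<Sum>u\<in>?S. f u) = f None + (\<Sum>j=1..n. f (Some j))" for f :: "nat option \<Rightarrow> real"
      by (subst sum.insert) (auto simp: sum.reindex)
    show "(\<Sum>u\<in>?S. ?A t u * X (?\<tau> t u) w) = X t w - (\<Sum>j=1..n. L j t * X (real j / n) w)" for t w
      unfolding sp by (simp add: sum_negf)
    fix s t :: real
    have "(\<Sum>u\<in>?S. \<Sum>v\<in>?S. ?A s u * ?A t v * ?K (?\<tau> s u) (?\<tau> t v))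
        = ?K s t - (\<Sum>k=1..n. L k t * ?K s (real k / n)) - D s t + (\<Sum>j=1..n. \<Sum>k=1..n. L j s * L k t * ?K (real j / n) (real k / n))"
      unfolding sp D_def by (simp add: sum.distrib sum_negf sum_subtractf)
    also have "(\<Sum>k=1..n. L k t * ?K s (real k / n)) = D t s" unfolding D_def by (simp add: fbm_cov_sym[of H s])
    finally show "(\<Sum>u\<in>?S. \<Sum>v\<in>?S. ?A s u * ?A t v * ?K (?\<tau> s u) (?\<tau> t v)) = ?K s t - D s t"
      unfolding D using Dsym[of s t] by simp
  qed
  show ?thesis
    by (rule gaussian_char_cov_cong[OF gaussian_char_add_indep[OF R P]]) simp_all
qed

section \<open>Asymptotic equivalence\<close>

lemma continuous_on_primitive:
  assumes "f absolutely_integrable_on {0..1}"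
  shows "continuous_on {0..1} (primitive f)"
proof -
  have "f integrable_on {0..1}" using assms by (simp add: absolutely_integrable_on_def)
  then have "continuous_on {0..1} (\<lambda>t. integral {0..t} f)" by (rule indefinite_integral_continuous_1)
  then show ?thesis by (rule continuous_on_eq) (simp add: primitive_def)
qed

lemma primitive_increment:
  assumes f: "f absolutely_integrable_on {0..1}" and i: "i \<in> {1..n}"
  shows "primitive f (real i / n) - primitive f ((real i - 1) / n) = integral {(real i - 1) / n..real i / n} f"
proof -
  have b: "0 \<le> (real i - 1) / n" "(real i - 1) / n \<le> real i / n" "real i / n \<le> 1"
    using i by (auto simp: field_simps)
  have "f integrable_on {0..1}" using f by (simp add: absolutely_integrable_on_def)
  then have "f integrable_on {0..real i / n}" by (rule integrable_on_subinterval) (use b in auto)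
  then have "integral {0..(real i - 1) / n} f + integral {(real i - 1) / n..real i / n} f = integral {0..real i / n} f"
    using b by (intro Henstock_Kurzweil_Integration.integral_combine) auto
  moreover have "real i / n \<in> {0..1}" "(real i - 1) / n \<in> {0..1}" using b by auto
  ultimately show ?thesis by (simp add: primitive_def)
qed

text \<open>The interpolation error d vanishes on the grid and differs from any competitor by a
  kernel combination over the grid, to which it is orthogonal. So d has the smallest norm, and it
  lies in the space as soon as one competitor does.\<close>

lemma rkhs_residual:
  fixes \<alpha> \<gamma> :: "nat \<Rightarrow> real"
  assumes R: "is_rkhs {0..1} K V ip" and n: "1 \<le> n"
    and g: "(\<lambda>t\<in>{0..1}. F t - (\<Sum>j=1..n. \<alpha> j * K t (real j / n))) \<in> V" (is "?g \<in> V")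
    and Fh: "\<And>i. i \<in> {1..n} \<Longrightarrow> (\<Sum>j=1..n. \<gamma> j * K (real i / n) (real j / n)) = F (real i / n)"
  defines "d \<equiv> (\<lambda>t\<in>{0..1}. F t - (\<Sum>j=1..n. \<gamma> j * K t (real j / n)))"
  shows "d \<in> V" and "hilbert_norm ip d \<le> hilbert_norm ip ?g"
proof -
  define G where "G = (\<lambda>j. real j / n) ` {1..n}"
  have G: "finite G" "G \<subseteq> {0..1}" unfolding G_def by auto
  have inj: "inj_on (\<lambda>j. real j / n) {1..n}" using n by (auto simp: inj_on_def)
  \<comment> \<open>Translates coefficients indexed by j into coefficients indexed by the points
    j/n.\<close>
  define a where "a \<beta> u = \<beta> (the_inv_into {1..n} (\<lambda>j. real j / n) u)" for \<beta> :: "nat \<Rightarrow> real" and u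
  have comb: "kernel_comb {0..1} K G (a \<beta>) t = (\<Sum>j=1..n. \<beta> j * K t (real j / n))" if "t \<in> {0..1}" for \<beta> t
  proof -
    have "(\<Sum>u\<in>G. a \<beta> u * K t u) = (\<Sum>j=1..n. a \<beta> (real j / n) * K t (real j / n))"
      unfolding G_def by (simp only: sum.reindex[OF inj] comp_def)
    also have "\<dots> = (\<Sum>j=1..n. \<beta> j * K t (real j / n))"
      by (intro sum.cong refl) (simp only: a_def the_inv_into_f_f[OF inj])
    finally show ?thesis using that by (simp add: kernel_comb_def)
  qed
  define \<beta> where "\<beta> j = \<alpha> j - \<gamma> j" for j
  have "d = (\<lambda>t\<in>{0..1}. ?g t + kernel_comb {0..1} K G (a \<beta>) t)"
    unfolding d_def by (intro restrict_ext) (simp add: comb \<beta>_def left_diff_distrib sum_subtractf)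
  then show d: "d \<in> V"
    using function_hilbert_spaceD(3)[OF is_rkhsD(1)[OF R] g kernel_comb_in_rkhs(1)[OF R G]] by simp
  have d0: "d u = 0" if "u \<in> G" for u using that Fh unfolding G_def d_def by auto
  have "?g = (\<lambda>t\<in>{0..1}. d t + kernel_comb {0..1} K G (a (\<lambda>j. \<gamma> j - \<alpha> j)) t)"
    unfolding d_def by (intro restrict_ext) (simp add: comb left_diff_distrib sum_subtractf)
  then have "ip d d \<le> ip ?g ?g"
    using ip_vanishing_plus_comb[OF R G d d0] by simp
  then show "hilbert_norm ip d \<le> hilbert_norm ip ?g" by (simp add: hilbert_norm_def)
qed

section \<open>The two deficiencies for a fixed sample size\<close>

definition sampling_error :: "nat \<Rightarrow> (real \<Rightarrow> real) \<Rightarrow> real" where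
  "sampling_error n f = (\<Sum>i=1..n.
     (real n * integral {(real i - 1) / real n..real i / real n} f - f (real i / real n))\<^sup>2)"

context
  fixes H :: real and n :: nat
    and W1 :: "'w1 measure" and N :: "nat \<Rightarrow> 'w1 \<Rightarrow> real"
    and W2 :: "'w2 measure" and B :: "real \<Rightarrow> 'w2 \<Rightarrow> real"
    and \<Theta> :: "(real \<Rightarrow> real) set"
  assumes H: "0 < H" "H < 1" and n: "1 \<le> n"
    and noise: "fractional_gaussian_noise H W1 N"
    and fbm: "fractional_brownian_motion H W2 B"
    and integrable: "\<And>f. f \<in> \<Theta> \<Longrightarrow> f absolutely_integrable_on {0..1}"
begin

abbreviation increment :: "(real \<Rightarrow> real) \<Rightarrow> nat \<Rightarrow> real" where
  "increment f i \<equiv> real n * (primitive f (real i / n) - primitive f ((real i - 1) / n))"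

lemma noise_char: "gaussian_char W1 {1..n} (\<lambda>i j. fgn_autocov H (int j - int i)) N"
proof (rule gaussian_char_mono)
  show "gaussian_char W1 {1..} (\<lambda>i j. fgn_autocov H (int j - int i)) N"
    using noise unfolding fractional_gaussian_noise_def by (rule centered_gaussian_process_imp_char)
qed auto

lemma regression_law_measurable:
  "(\<lambda>w. \<lambda>i\<in>{1..n}. a i + N i w) \<in> W1 \<rightarrow>\<^sub>M borel_Rn n"
  using gaussian_charD(2)[OF noise_char] by (intro measurable_restrict borel_measurable_add) auto

lemma regression_tv:
  assumes f: "f \<in> \<Theta>" and A: "A \<in> sets (borel_Rn n)"
  shows "\<bar>process_prob W1 {1..n} (\<lambda>i w. increment f i + N i w) A
      - process_prob W1 {1..n} (\<lambda>i w. f (real i / n) + N i w) A\<bar>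
    \<le> sqrt (fgn_bound H n * sampling_error n f)"
proof -
  have "(\<Sum>i=1..n. (f (real i / n) - increment f i)\<^sup>2) = sampling_error n f"
    unfolding sampling_error_def
    by (intro sum.cong refl) (simp add: primitive_increment[OF integrable[OF f]] power2_commute)
  then show ?thesis
    using regression_shift_tv[OF H n noise_char A, of "increment f" "\<lambda>i. f (real i / n)"] by simp
qed

text \<open>A deterministic kernel suffices. The scaled increments of the path carry exactly the law
  of fractional Gaussian noise around the means \<open>increment f\<close>, so the whole error is
  the change of means in \<open>regression_tv\<close>.\<close>

lemma deficiency_continuous_regression:
  assumes \<epsilon>: "\<And>f. f \<in> \<Theta> \<Longrightarrow> sqrt (fgn_bound H n * sampling_error n f) \<le> \<epsilon>"
  shows "deficiency (continuous_experiment H W2 B \<Theta> n) (regression_experiment W1 N \<Theta> n) \<le> ennreal \<epsilon>"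
proof -
  define T where "T y = (\<lambda>i\<in>{1..n}. real n * (y (real i / n) - y ((real i - 1) / n)))" for y :: "real \<Rightarrow> real"
  have grid: "real i / n \<in> {0..1}" "(real i - 1) / n \<in> {0..1}" if "i \<in> {1..n}" for i
    using that by (auto simp: field_simps)
  have T: "T \<in> borel_C01 \<rightarrow>\<^sub>M borel_Rn n"
    unfolding T_def using grid
    by (intro measurable_restrict borel_measurable_times borel_measurable_diff measurable_eval_C01) auto
  have k: "(\<lambda>y. return (borel_Rn n) (T y)) \<in> borel_C01 \<rightarrow>\<^sub>M prob_algebra (borel_Rn n)"
    by (rule measurable_compose[OF T measurable_return_prob_space])
  interpret W2: prob_space W2 using gaussian_charD(1)[OF centered_fbm(2)[OF fbm]] .
  let ?E = "continuous_experiment H W2 B \<Theta> n" and ?G = "regression_experiment W1 N \<Theta> n"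
  have "tv_dist (law ?E f \<bind> (\<lambda>y. return (borel_Rn n) (T y))) (law ?G f) \<le> ennreal \<epsilon>" if f: "f \<in> \<Theta>" for f
  proof -
    define \<phi> where "\<phi> w = (\<lambda>t\<in>{0..1}. primitive f t + real n powr (H - 1) * B t w)" for w
    have \<phi>: "\<phi> \<in> W2 \<rightarrow>\<^sub>M borel_C01"
      unfolding \<phi>_def using gaussian_charD(2)[OF centered_fbm(2)[OF fbm]] centered_fbm(3)[OF fbm] continuous_on_primitive[OF integrable[OF f]]
      by (intro C01_path_measurable) auto
    have E: "law ?E f = distr W2 borel_C01 \<phi>" by (simp add: continuous_experiment_def \<phi>_def[abs_def])
    interpret E: prob_space "distr W2 borel_C01 \<phi>" by (rule W2.prob_space_distr[OF \<phi>])
    have bind: "law ?E f \<bind> (\<lambda>y. return (borel_Rn n) (T y)) = distr W2 (borel_Rn n) (\<lambda>w. T (\<phi> w))"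
      unfolding E using T \<phi> E.not_empty by (subst bind_return_distr') (simp_all add: distr_distr comp_def)
    have T\<phi>: "T (\<phi> w) = (\<lambda>i\<in>{1..n}. increment f i + 1 * (real n powr H * (B (real i / n) w - B ((real i - 1) / n) w)))" for w
    proof -
      define s where "s = real n powr (H - 1)"
      \<comment> \<open>The noise level n^(H-1) is the one for which n times an increment of the
        noise has unit variance.\<close>
      have "real n powr H = real n * s" using n by (simp add: s_def powr_mult_base)
      then have e: "real n * ((p + s * b) - (q + s * c)) = real n * (p - q) + 1 * (real n powr H * (b - c))" for p q b c :: real
        by (simp add: algebra_simps)
      show ?thesis unfolding T_def
      proof (rule restrict_ext)
        fix i assume i: "i \<in> {1..n}"
        show "real n * (\<phi> w (real i / n) - \<phi> w ((real i - 1) / n))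
          = increment f i + 1 * (real n powr H * (B (real i / n) w - B ((real i - 1) / n) w))"
          unfolding \<phi>_def s_def[symmetric] restrict_apply'[OF grid(1)[OF i]] restrict_apply'[OF grid(2)[OF i]] by (rule e)
      qed
    qed
    show ?thesis
    proof (rule tv_dist_leI)
      fix A assume "A \<in> sets (law ?E f \<bind> (\<lambda>y. return (borel_Rn n) (T y)))"
      then have A: "A \<in> sets (borel_Rn n)" unfolding bind by simp
      have "measure (law ?E f \<bind> (\<lambda>y. return (borel_Rn n) (T y))) A = measure W2 {w\<in>space W2. T (\<phi> w) \<in> A}"
        unfolding bind using measurable_compose[OF \<phi> T] A by (simp add: measure_distr_Collect)
      also have "\<dots> = process_prob W1 {1..n} (\<lambda>i w. increment f i + 1 * N i w) A"
        unfolding T\<phi> by (rule gaussian_char_affine_law_eq[OF gaussian_char_increments[OF centered_fbm(2)[OF fbm] order_refl n] noise_char A])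
      finally have 1: "measure (law ?E f \<bind> (\<lambda>y. return (borel_Rn n) (T y))) A
          = process_prob W1 {1..n} (\<lambda>i w. increment f i + N i w) A" by simp
      have 2: "measure (law ?G f) A = process_prob W1 {1..n} (\<lambda>i w. f (real i / n) + N i w) A"
        using regression_law_measurable[of "\<lambda>i. f (real i / n)"] A
        by (simp add: regression_experiment_def measure_distr_Collect)
      show "\<bar>measure (law ?E f \<bind> (\<lambda>y. return (borel_Rn n) (T y))) A - measure (law ?G f) A\<bar> \<le> \<epsilon>"
        unfolding 1 2 using regression_tv[OF f A] \<epsilon>[OF f] by linarith
    qed
  qed
  then have "(SUP f\<in>params ?E. tv_dist (law ?E f \<bind> (\<lambda>y. return (borel_Rn n) (T y))) (law ?G f)) \<le> ennreal \<epsilon>"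
    by (intro SUP_least) (simp add: continuous_experiment_def)
  then show ?thesis unfolding deficiency_def
    by (intro INF_lower2[of "\<lambda>y. return (borel_Rn n) (T y)"]) (use k in \<open>simp_all add: continuous_experiment_def regression_experiment_def\<close>)
qed

text \<open>The error has two sources: \<epsilon> for exchanging point values of f for local
  averages before the kernel acts, and \<delta> for the drift afterwards. A coefficient vector is
  supplied separately for each f, and it serves only as a competitor; the kernel cannot depend on
  it.\<close>

lemma deficiency_regression_continuous:
  assumes R: "is_rkhs {0..1} (fbm_cov H) V ip"
    and \<epsilon>: "\<And>f. f \<in> \<Theta> \<Longrightarrow> sqrt (fgn_bound H n * sampling_error n f) \<le> \<epsilon>"
    and \<delta>: "\<And>f. f \<in> \<Theta> \<Longrightarrow> \<exists>\<alpha>. (\<lambda>t\<in>{0..1}. primitive f t - (\<Sum>j=1..n. \<alpha> j * fbm_cov H t (real j / n))) \<in> V \<and>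
        real n powr (1 - H) * hilbert_norm ip (\<lambda>t\<in>{0..1}. primitive f t - (\<Sum>j=1..n. \<alpha> j * fbm_cov H t (real j / n))) \<le> \<delta>"
  shows "deficiency (regression_experiment W1 N \<Theta> n) (continuous_experiment H W2 B \<Theta> n) \<le> ennreal (\<epsilon> + \<delta>)"
proof -
  obtain a L where L: "\<And>j t. L j t = (\<Sum>l=1..n. a j l * fbm_cov H t (real l / n))"
    "\<And>i j. i \<in> {1..n} \<Longrightarrow> j \<in> {1..n} \<Longrightarrow> L j (real i / n) = (if i = j then 1 else 0)"
    "\<And>t m. m \<in> {1..n} \<Longrightarrow> (\<Sum>j=1..n. L j t * fbm_cov H (real j / n) (real m / n)) = fbm_cov H t (real m / n)"
    by (rule fbm_grid_basis[OF H n]) (rule that)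
  have Lcont: "continuous_on {0..1} (L j)" for j
    unfolding L(1)[abs_def] using H by (intro continuous_intros)
  define \<sigma> where "\<sigma> = real n powr (H - 1)"
  have \<sigma>: "0 < \<sigma>" using n by (simp add: \<sigma>_def)
  have n\<sigma>: "real n powr H = real n * \<sigma>" using n by (simp add: \<sigma>_def powr_mult_base)
  define X where "X t w = B t w - B 0 w" for t w
  have GX: "gaussian_char W2 {0..1} (fbm_cov H) X" unfolding X_def[abs_def] by (rule centered_fbm(1)[OF fbm])
  have GB: "gaussian_char W2 {0..1} (fbm_cov H) B" by (rule centered_fbm(2)[OF fbm])
  have Bc: "continuous_on {0..1} (\<lambda>t. B t w)" if "w \<in> space W2" for w by (rule centered_fbm(3)[OF fbm that])
  have Xc: "continuous_on {0..1} (\<lambda>t. X t w)" if "w \<in> space W2" for w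
    unfolding X_def using Bc[OF that] by (intro continuous_intros)
  have Xm[measurable]: "X t \<in> borel_measurable W2" if "t \<in> {0..1}" for t by (rule gaussian_charD(2)[OF GX that])
  interpret W1: prob_space W1 by (rule gaussian_charD(1)[OF noise_char])
  interpret W2: prob_space W2 by (rule gaussian_charD(1)[OF GX])
  have grid: "real i / n \<in> {0..1}" "(real i - 1) / n \<in> {0..1}" if "i \<in> {1..n}" for i
    using that by (auto simp: field_simps)
  define Z where "Z t w = X t w - (\<Sum>j=1..n. L j t * X (real j / n) w)" for t w
  \<comment> \<open>Partial sums of the data divided by n are the path values on the grid; they are
    extended by the cardinal functions L, and \<sigma> * Z supplies the prediction error from fresh
    randomness.\<close>
  define \<Phi> where "\<Phi> x w = (\<lambda>t\<in>{0..1}. (\<Sum>j=1..n. L j t * ((\<Sum>i=1..j. x i) / n)) + \<sigma> * Z t w)" for x :: "nat \<Rightarrow> real" and w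
  have Zm: "Z t \<in> borel_measurable W2" if "t \<in> {0..1}" for t
    unfolding Z_def using that grid Xm by (intro borel_measurable_diff borel_measurable_sum borel_measurable_times) auto
  have Zc: "continuous_on {0..1} (\<lambda>t. Z t w)" if "w \<in> space W2" for w
    unfolding Z_def using Xc[OF that] Lcont by (intro continuous_intros)
  have \<Phi>m: "(\<lambda>(x, w). \<Phi> x w) \<in> borel_Rn n \<Otimes>\<^sub>M W2 \<rightarrow>\<^sub>M borel_C01"
  proof (rule measurable_borel_C01I)
    fix p assume "p \<in> space (borel_Rn n \<Otimes>\<^sub>M W2)"
    then have p: "snd p \<in> space W2" by (auto simp: space_pair_measure)
    show "(case p of (x, w) \<Rightarrow> \<Phi> x w) \<in> extensional {0..1}" by (simp add: \<Phi>_def case_prod_unfold)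
    have "continuous_on {0..1} (\<lambda>t. (\<Sum>j=1..n. L j t * ((\<Sum>i=1..j. fst p i) / n)) + \<sigma> * Z t (snd p))"
      using Lcont Zc[OF p] by (intro continuous_intros)
    then show "continuous_on {0..1} (case p of (x, w) \<Rightarrow> \<Phi> x w)"
      by (rule continuous_on_eq) (simp add: \<Phi>_def case_prod_unfold)
  next
    fix t :: real assume t: "t \<in> {0..1}"
    have c: "(\<lambda>p. fst p i) \<in> borel_measurable (borel_Rn n \<Otimes>\<^sub>M W2)" if "i \<in> {1..n}" for i
      using measurable_compose[OF measurable_fst measurable_component_singleton[OF that]] by simp
    have "(\<lambda>p. (\<Sum>j=1..n. L j t * ((\<Sum>i=1..j. fst p i) / n)) + \<sigma> * Z t (snd p)) \<in> borel_measurable (borel_Rn n \<Otimes>\<^sub>M W2)"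
      using measurable_compose[OF measurable_snd Zm[OF t]] c
      by (intro borel_measurable_add borel_measurable_sum borel_measurable_times borel_measurable_divide borel_measurable_const) auto
    then show "(\<lambda>p. (case p of (x, w) \<Rightarrow> \<Phi> x w) t) \<in> borel_measurable (borel_Rn n \<Otimes>\<^sub>M W2)"
      using t by (simp add: \<Phi>_def case_prod_unfold)
  qed
  let ?k = "\<lambda>x. distr W2 borel_C01 (\<Phi> x)"
  have k: "?k \<in> borel_Rn n \<rightarrow>\<^sub>M prob_algebra borel_C01"
    by (rule distr_kernel[OF W2.prob_space_axioms \<Phi>m])
  let ?E = "continuous_experiment H W2 B \<Theta> n" and ?G = "regression_experiment W1 N \<Theta> n"
  have "tv_dist (law ?G f \<bind> ?k) (law ?E f) \<le> ennreal (\<epsilon> + \<delta>)" if f: "f \<in> \<Theta>" for f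
  proof (rule tv_dist_leI)
    let ?F = "primitive f"
    have Fc: "continuous_on {0..1} ?F" by (rule continuous_on_primitive[OF integrable[OF f]])
    define Fh where "Fh t = (\<Sum>j=1..n. L j t * ?F (real j / n))" for t
    define V' where "V' t p = (\<Sum>j=1..n. L j t * X (real j / n) (snd p))" for t and p :: "'w2 \<times> 'w2"
    have Fhc: "continuous_on {0..1} Fh"
      unfolding Fh_def[abs_def] using Lcont by (intro continuous_intros)
    define P where "P = distr W1 (borel_Rn n) (\<lambda>w. \<lambda>i\<in>{1..n}. f (real i / n) + N i w)"
    define Q where "Q = distr W1 (borel_Rn n) (\<lambda>w. \<lambda>i\<in>{1..n}. increment f i + N i w)"
    have PQ: "prob_space P" "prob_space Q" "sets P = sets (borel_Rn n)" "sets Q = sets (borel_Rn n)"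
      unfolding P_def Q_def using regression_law_measurable by (auto intro!: W1.prob_space_distr)
    have GP: "law ?G f = P" by (simp add: P_def regression_experiment_def)
    fix A assume "A \<in> sets (law ?G f \<bind> ?k)"
    moreover have "P \<in> space (prob_algebra (borel_Rn n))" using PQ by (simp add: space_prob_algebra)
    ultimately have A: "A \<in> sets borel_C01" unfolding GP by (simp add: sets_bind'[OF _ k])
    have "\<bar>measure (P \<bind> ?k) A - measure (Q \<bind> ?k) A\<bar> \<le> \<epsilon>"
    proof (rule bind_distr_kernel_tv[OF PQ(1,3,2,4) W2.prob_space_axioms \<Phi>m A])
      fix S assume S: "S \<in> sets (borel_Rn n)"
      have "measure P S = process_prob W1 {1..n} (\<lambda>i w. f (real i / n) + N i w) S"
        "measure Q S = process_prob W1 {1..n} (\<lambda>i w. increment f i + N i w) S"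
        unfolding P_def Q_def using regression_law_measurable S
        by (simp_all add: measure_distr_Collect)
      then show "\<bar>measure P S - measure Q S\<bar> \<le> \<epsilon>" using regression_tv[OF f S] \<epsilon>[OF f] by linarith
    qed
    moreover have "measure (Q \<bind> ?k) A = process_prob W2 {0..1} (\<lambda>t w. Fh t + \<sigma> * X t w) A"
    proof -
      \<comment> \<open>The intermediate law Q is realised by increments of a second, independent X,
        so that the output becomes a function on \<open>W2 \<Otimes>\<^sub>M W2\<close> to which
        kriging applies.\<close>
      define \<psi> where "\<psi> w = (\<lambda>i\<in>{1..n}. increment f i + 1 * (real n powr H * (X (real i / n) w - X ((real i - 1) / n) w)))" for w
      note GI = gaussian_char_increments[OF GX order_refl n]
      have \<psi>: "\<psi> \<in> W2 \<rightarrow>\<^sub>M borel_Rn n"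
        unfolding \<psi>_def using gaussian_charD(2)[OF GI]
        by (intro measurable_restrict borel_measurable_add borel_measurable_times[of "\<lambda>_. 1"] borel_measurable_const) auto
      have "Q = distr W2 (borel_Rn n) \<psi>"
      proof (rule measure_eqI)
        fix S assume "S \<in> sets Q"
        then have S: "S \<in> sets (borel_Rn n)" using PQ by simp
        interpret Q: prob_space Q by fact
        interpret D: prob_space "distr W2 (borel_Rn n) \<psi>" by (rule W2.prob_space_distr[OF \<psi>])
        have "measure Q S = process_prob W1 {1..n} (\<lambda>i w. increment f i + 1 * N i w) S"
          unfolding Q_def using regression_law_measurable S
          by (simp add: measure_distr_Collect)
        also have "\<dots> = measure W2 {w\<in>space W2. \<psi> w \<in> S}"
          unfolding \<psi>_def by (rule gaussian_char_affine_law_eq[OF noise_char GI S])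
        also have "\<dots> = measure (distr W2 (borel_Rn n) \<psi>) S"
          using \<psi> S by (simp add: measure_distr_Collect)
        finally show "emeasure Q S = emeasure (distr W2 (borel_Rn n) \<psi>) S"
          unfolding Q.emeasure_eq_measure D.emeasure_eq_measure by simp
      qed (simp add: PQ)
      then have "Q \<bind> ?k = W2 \<bind> (\<lambda>w. ?k (\<psi> w))"
        using bind_distr[OF \<psi> measurable_prob_algebraD[OF k] W2.not_empty] by simp
      moreover have "(\<lambda>(w, w'). \<Phi> (\<psi> w) w') \<in> W2 \<Otimes>\<^sub>M W2 \<rightarrow>\<^sub>M borel_C01"
      proof -
        have "(\<lambda>p. (\<psi> (fst p), snd p)) \<in> W2 \<Otimes>\<^sub>M W2 \<rightarrow>\<^sub>M borel_Rn n \<Otimes>\<^sub>M W2"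
          using \<psi> by measurable
        from measurable_compose[OF this \<Phi>m] show ?thesis by (simp add: case_prod_unfold)
      qed
      ultimately have "measure (Q \<bind> ?k) A = measure (W2 \<Otimes>\<^sub>M W2) {p\<in>space (W2 \<Otimes>\<^sub>M W2). \<Phi> (\<psi> (snd p)) (fst p) \<in> A}"
        using measure_bind_distr_kernel(1)[OF W2.prob_space_axioms refl W2.prob_space_axioms _ A, of "\<lambda>w. \<Phi> (\<psi> w)"] by simp
      moreover have "\<Phi> (\<psi> (snd p)) (fst p) = (\<lambda>t\<in>{0..1}. Fh t
          + \<sigma> * (Z t (fst p) + V' t p))" for p :: "'w2 \<times> 'w2"
      proof -
        \<comment> \<open>The sums telescope to the value at j/n minus the value at 0, which is 0
          both for the primitive and for the recentred X.\<close>
        have tel: "(\<Sum>i=1..j. g (real i / n) - g ((real i - 1) / n)) = g (real j / n) - g 0" for g :: "real \<Rightarrow> real" and j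
          by (induction j) (auto simp: add.commute)
        have F0: "?F 0 = 0" by (simp add: primitive_def)
        have S: "(\<Sum>i=1..j. \<psi> (snd p) i) / n = ?F (real j / n) + \<sigma> * X (real j / n) (snd p)" if j: "j \<in> {1..n}" for j
        proof -
          have "(\<Sum>i=1..j. \<psi> (snd p) i) = (\<Sum>i=1..j. real n * ((?F (real i / n) - ?F ((real i - 1) / n)) + \<sigma> * (X (real i / n) (snd p) - X ((real i - 1) / n) (snd p))))"
            using j by (intro sum.cong refl) (simp add: \<psi>_def n\<sigma> algebra_simps)
          also have "\<dots> = real n * (?F (real j / n) + \<sigma> * X (real j / n) (snd p))"
            unfolding sum_distrib_left[symmetric] sum.distrib tel[of ?F] tel[of "\<lambda>t. X t (snd p)"] F0
            by (simp add: X_def)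
          finally show ?thesis using n by simp
        qed
        have "(\<Sum>j=1..n. L j t * ((\<Sum>i=1..j. \<psi> (snd p) i) / n)) = Fh t + \<sigma> * V' t p" for t
          unfolding Fh_def V'_def sum_distrib_left sum.distrib[symmetric]
          by (intro sum.cong refl) (simp only: S, simp add: algebra_simps)
        then show "\<Phi> (\<psi> (snd p)) (fst p) = (\<lambda>t\<in>{0..1}. Fh t
          + \<sigma> * (Z t (fst p) + V' t p))"
          unfolding \<Phi>_def by (intro restrict_ext) (simp add: algebra_simps)
      qed
      moreover have "process_prob (W2 \<Otimes>\<^sub>M W2) {0..1} (\<lambda>t p. Fh t
            + \<sigma> * (Z t (fst p) + V' t p)) A
          = process_prob W2 {0..1} (\<lambda>t w. Fh t + \<sigma> * X t w) A"
      proof (rule C01_law_eq[OF _ GX _ Xc Fhc A])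
        show "gaussian_char (W2 \<Otimes>\<^sub>M W2) {0..1} (fbm_cov H) (\<lambda>t p. Z t (fst p) + V' t p)"
          unfolding Z_def V'_def by (rule kriging_process[OF GX n L(3)])
        show "continuous_on {0..1} (\<lambda>t. Z t (fst p) + V' t p)"
          if "p \<in> space (W2 \<Otimes>\<^sub>M W2)" for p
          unfolding V'_def using that Zc[of "fst p"] Lcont by (intro continuous_intros) (auto simp: space_pair_measure)
      qed
      ultimately show ?thesis by simp
    qed
    moreover have "measure (law ?E f) A = process_prob W2 {0..1} (\<lambda>t w. ?F t + \<sigma> * X t w) A"
    proof -
      have "measure (law ?E f) A = process_prob W2 {0..1} (\<lambda>t w. ?F t + \<sigma> * B t w) A"
        using C01_path_measurable[of B W2 ?F \<sigma>] gaussian_charD(2)[OF GB] Bc Fc A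
        by (simp add: continuous_experiment_def \<sigma>_def measure_distr_Collect)
      also have "\<dots> = process_prob W2 {0..1} (\<lambda>t w. ?F t + \<sigma> * X t w) A"
        by (rule C01_law_eq[OF GB GX Bc Xc Fc A])
      finally show ?thesis .
    qed
    moreover have "\<bar>process_prob W2 {0..1} (\<lambda>t w. Fh t + \<sigma> * X t w) A
        - process_prob W2 {0..1} (\<lambda>t w. ?F t + \<sigma> * X t w) A\<bar> \<le> \<delta>"
    proof -
      obtain \<alpha> where \<alpha>: "(\<lambda>t\<in>{0..1}. ?F t - (\<Sum>j=1..n. \<alpha> j * fbm_cov H t (real j / n))) \<in> V" (is "?g \<in> V")
        "real n powr (1 - H) * hilbert_norm ip (\<lambda>t\<in>{0..1}. ?F t - (\<Sum>j=1..n. \<alpha> j * fbm_cov H t (real j / n))) \<le> \<delta>"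
        using \<delta>[OF f] by blast
      \<comment> \<open>Expands the interpolant Fh in the kernels at the grid points, so that it can
        be compared with the competitor \<alpha>.\<close>
      define \<gamma> where "\<gamma> l = (\<Sum>j=1..n. ?F (real j / n) * a j l)" for l
      have \<gamma>: "(\<Sum>l=1..n. \<gamma> l * fbm_cov H t (real l / n)) = Fh t" for t
      proof -
        have "(\<Sum>l=1..n. \<gamma> l * fbm_cov H t (real l / n)) = (\<Sum>l=1..n. \<Sum>j=1..n. ?F (real j / n) * (a j l * fbm_cov H t (real l / n)))"
          unfolding \<gamma>_def by (simp only: sum_distrib_right mult.assoc)
        also have "\<dots> = (\<Sum>j=1..n. ?F (real j / n) * L j t)"
          by (subst sum.swap) (simp only: L(1) sum_distrib_left)
        finally show ?thesis by (simp only: Fh_def mult.commute)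
      qed
      have "Fh (real i / n) = ?F (real i / n)" if i: "i \<in> {1..n}" for i
      proof -
        have "Fh (real i / n) = (\<Sum>j=1..n. if i = j then ?F (real j / n) else 0)"
          unfolding Fh_def by (intro sum.cong refl) (simp add: L(2)[OF i])
        then show ?thesis using i by simp
      qed
      note res = rkhs_residual[OF R n \<alpha>(1), of \<gamma>, unfolded \<gamma>, OF this]
      have "real n powr (1 - H) = 1 / \<sigma>" unfolding \<sigma>_def by (simp add: powr_minus_divide[symmetric])
      then have "hilbert_norm ip (\<lambda>t\<in>{0..1}. ?F t - Fh t) / \<sigma> \<le> real n powr (1 - H) * hilbert_norm ip ?g"
        using divide_right_mono[OF res(2), of \<sigma>] \<sigma> by simp
      then show ?thesis
        using C01_shift_tv[OF GX R fbm_cov_sym Xc Fhc Fc res(1) \<sigma> A] \<alpha>(2) by linarith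
    qed
    ultimately show "\<bar>measure (law ?G f \<bind> ?k) A - measure (law ?E f) A\<bar> \<le> \<epsilon> + \<delta>"
      unfolding GP by linarith
  qed
  then have "(SUP f\<in>params ?G. tv_dist (law ?G f \<bind> ?k) (law ?E f)) \<le> ennreal (\<epsilon> + \<delta>)"
    by (intro SUP_least) (simp add: regression_experiment_def)
  then show ?thesis unfolding deficiency_def
    by (intro INF_lower2[of ?k]) (use k in \<open>simp_all add: continuous_experiment_def regression_experiment_def\<close>)
qed

end


section \<open>Passage to the limit\<close>

lemma tendsto_zero_ennrealI:
  fixes f :: "nat \<Rightarrow> ennreal"
  assumes "\<And>\<epsilon>. 0 < \<epsilon> \<Longrightarrow> eventually (\<lambda>n. f n \<le> ennreal \<epsilon>) sequentially"
  shows "f \<longlonglongrightarrow> 0"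
proof (rule order_tendstoI)
  fix x :: ennreal assume "0 < x"
  then obtain y where y: "0 < y" "y < x" using dense by blast
  then have "y < top" by (metis less_top_ennreal order_less_le_trans top_greatest not_less top.extremum_strict)
  then obtain \<epsilon> where \<epsilon>: "y = ennreal \<epsilon>" "0 < \<epsilon>" using y(1) by (cases y) auto
  show "eventually (\<lambda>n. f n < x) sequentially"
    using assms[OF \<epsilon>(2)] by eventually_elim (use y \<epsilon> in \<open>auto intro: le_less_trans\<close>)
qed simp

text \<open>The extended norm is infinite off the space, so a finite infimum forces some residual to
  be a member. An approximate minimiser is enough because the bound is strict.\<close>

lemma INF_hilbert_enorm_less:
  assumes p: "0 < p" and less: "ennreal p * (INF \<alpha>\<in>I. hilbert_enorm V ip (g \<alpha>)) < ennreal e"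
  obtains \<alpha> where "g \<alpha> \<in> V" "p * hilbert_norm ip (g \<alpha>) < e"
proof -
  define m where "m = (INF \<alpha>\<in>I. hilbert_enorm V ip (g \<alpha>))"
  have "m \<noteq> top" using less p unfolding m_def[symmetric] by (auto simp: ennreal_mult_top)
  then obtain r where r: "m = ennreal r" "0 \<le> r" by (cases m) auto
  have "ennreal (p * r) < ennreal e" using less r p unfolding m_def[symmetric] by (simp add: ennreal_mult)
  then have pr: "p * r < e" using r p by (simp add: ennreal_less_iff)
  then have "r < e / p" using p by (simp add: field_simps)
  then have "m < ennreal (e / p)" unfolding r using r(2) by (simp add: ennreal_less_iff)
  then obtain \<alpha> where \<alpha>: "hilbert_enorm V ip (g \<alpha>) < ennreal (e / p)" unfolding m_def INF_less_iff by blast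
  have V: "g \<alpha> \<in> V" using \<alpha> by (auto simp: hilbert_enorm_def split: if_splits)
  then have "ennreal (hilbert_norm ip (g \<alpha>)) < ennreal (e / p)" using \<alpha> by (simp add: hilbert_enorm_def)
  moreover have "0 \<le> e / p" using r(2) \<open>r < e / p\<close> by linarith
  ultimately have "hilbert_norm ip (g \<alpha>) < e / p" by (meson ennreal_leI not_le)
  then show ?thesis using that[OF V] p by (simp add: field_simps)
qed

theorem theorem1:
  fixes H :: real
    and \<Theta> :: "(real \<Rightarrow> real) set"
    and W1 :: "'w1 measure" and N :: "nat \<Rightarrow> 'w1 \<Rightarrow> real"
    and W2 :: "'w2 measure" and B :: "real \<Rightarrow> 'w2 \<Rightarrow> real"
    and HH :: "(real \<Rightarrow> real) set" and ip :: "(real \<Rightarrow> real) \<Rightarrow> (real \<Rightarrow> real) \<Rightarrow> real"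
  assumes H: "0 < H" "H < 1"
    and noise: "fractional_gaussian_noise H W1 N"
    and fbm: "fractional_brownian_motion H W2 B"
    and rkhs: "is_rkhs {0..1} (fbm_cov H) HH ip"
    and integrable: "\<And>f. f \<in> \<Theta> \<Longrightarrow> f absolutely_integrable_on {0..1}"
    and i: "(\<lambda>n. ennreal (max (real n powr (1 - 2*H)) 1) *
               (SUP f\<in>\<Theta>. ennreal (\<Sum>i=1..n.
                  (real n * integral {(real i - 1) / real n..real i / real n} f
                     - f (real i / real n))\<^sup>2)))
             \<longlonglongrightarrow> 0"
    and ii: "(\<lambda>n. ennreal (real n powr (1 - H)) *
                (SUP f\<in>\<Theta>. INF \<alpha>\<in>({1..n} \<rightarrow>\<^sub>E (UNIV :: real set)).
                   hilbert_enorm HH ip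
                     (\<lambda>t\<in>{0..1}. primitive f t
                        - (\<Sum>j=1..n. \<alpha> j * fbm_cov H t (real j / real n)))))
              \<longlonglongrightarrow> 0"
  shows "asymptotically_equivalent (regression_experiment W1 N \<Theta>) (continuous_experiment H W2 B \<Theta>)"
  unfolding asymptotically_equivalent_def
proof (intro conjI allI tendsto_zero_ennrealI)
  let ?R = "regression_experiment W1 N \<Theta>" and ?C = "continuous_experiment H W2 B \<Theta>"
  show "params (?R n) = params (?C n)" for n
    by (simp add: regression_experiment_def continuous_experiment_def)
  fix \<epsilon> :: real assume \<epsilon>: "0 < \<epsilon>"
  define C where "C = 40 * stable_const H"
  have C: "0 < C" using stable_const_pos[OF H] by (simp add: C_def)
  \<comment> \<open>With this e, a value below e in (i) makes the square root of
    \<open>fgn_bound\<close> times the sampling error at most \<epsilon>/2.\<close>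
  define e where "e = (\<epsilon> / 2)\<^sup>2 / C"
  have e: "0 < e" using \<epsilon> C by (simp add: e_def)
  have "eventually (\<lambda>n. ennreal (max (real n powr (1 - 2*H)) 1) * (SUP f\<in>\<Theta>. ennreal (sampling_error n f)) < ennreal e) sequentially"
    unfolding sampling_error_def using i e by (intro order_tendstoD(2)) auto
  moreover have "eventually (\<lambda>n. ennreal (real n powr (1 - H)) *
      (SUP f\<in>\<Theta>. INF \<alpha>\<in>({1..n} \<rightarrow>\<^sub>E (UNIV :: real set)). hilbert_enorm HH ip
         (\<lambda>t\<in>{0..1}. primitive f t - (\<Sum>j=1..n. \<alpha> j * fbm_cov H t (real j / real n)))) < ennreal (\<epsilon> / 2)) sequentially"
    using ii \<epsilon> by (intro order_tendstoD(2)) auto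
  moreover have "eventually (\<lambda>n. 1 \<le> n) sequentially" by (rule eventually_ge_at_top)
  ultimately show "eventually (\<lambda>n. le_cam_dist (?R n) (?C n) \<le> ennreal \<epsilon>) sequentially"
  proof eventually_elim
    case (elim n)
    have s: "sqrt (fgn_bound H n * sampling_error n f) \<le> \<epsilon> / 2" if f: "f \<in> \<Theta>" for f
    proof -
      have se: "0 \<le> sampling_error n f" unfolding sampling_error_def by (intro sum_nonneg) simp
      have "ennreal (max (real n powr (1 - 2*H)) 1 * sampling_error n f)
          = ennreal (max (real n powr (1 - 2*H)) 1) * ennreal (sampling_error n f)"
        using se by (intro ennreal_mult) auto
      also have "\<dots> \<le> ennreal (max (real n powr (1 - 2*H)) 1) * (SUP f\<in>\<Theta>. ennreal (sampling_error n f))"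
        using f by (intro mult_left_mono SUP_upper) auto
      also have "\<dots> < ennreal e" by (rule elim(1))
      finally have "max (real n powr (1 - 2*H)) 1 * sampling_error n f < e"
        using se by (subst (asm) ennreal_less_iff) auto
      then have "C * (max (real n powr (1 - 2*H)) 1 * sampling_error n f) \<le> (\<epsilon> / 2)\<^sup>2"
        using C by (simp add: e_def field_simps)
      then show ?thesis unfolding fgn_bound_def C_def mult.assoc[symmetric] using \<epsilon> by (intro real_le_lsqrt) simp_all
    qed
    have d: "\<exists>\<alpha>. (\<lambda>t\<in>{0..1}. primitive f t - (\<Sum>j=1..n. \<alpha> j * fbm_cov H t (real j / n))) \<in> HH \<and>
        real n powr (1 - H) * hilbert_norm ip (\<lambda>t\<in>{0..1}. primitive f t - (\<Sum>j=1..n. \<alpha> j * fbm_cov H t (real j / n))) \<le> \<epsilon> / 2"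
      if f: "f \<in> \<Theta>" for f
    proof -
      let ?g = "\<lambda>\<alpha>. \<lambda>t\<in>{0..1}. primitive f t - (\<Sum>j=1..n. \<alpha> j * fbm_cov H t (real j / real n))"
      have "0 < real n powr (1 - H)" using elim(3) by simp
      moreover have "ennreal (real n powr (1 - H)) * (INF \<alpha>\<in>({1..n} \<rightarrow>\<^sub>E (UNIV :: real set)). hilbert_enorm HH ip (?g \<alpha>)) < ennreal (\<epsilon> / 2)"
        using f by (intro le_less_trans[OF _ elim(2)] mult_left_mono SUP_upper) auto
      ultimately obtain \<alpha> where "?g \<alpha> \<in> HH" "real n powr (1 - H) * hilbert_norm ip (?g \<alpha>) < \<epsilon> / 2"
        by (rule INF_hilbert_enorm_less)
      then show ?thesis by (intro exI[of _ \<alpha>]) simp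
    qed
    have "deficiency (?C n) (?R n) \<le> ennreal (\<epsilon> / 2)"
      by (rule deficiency_continuous_regression[OF H elim(3) noise fbm integrable s])
    also have "\<dots> \<le> ennreal \<epsilon>" using \<epsilon> by (intro ennreal_leI) simp
    finally have 1: "deficiency (?C n) (?R n) \<le> ennreal \<epsilon>" .
    have 2: "deficiency (?R n) (?C n) \<le> ennreal (\<epsilon> / 2 + \<epsilon> / 2)"
      by (rule deficiency_regression_continuous[OF H elim(3) noise fbm integrable rkhs s d])
    show ?case using 1 2 by (simp add: le_cam_dist_def)
  qed
qed

end
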